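(* Let $\ell\in\frac12\mathbb{N}$, $\ell>0$, and let $\{R_d^{\ell,t}\}_{d\ge0}$ be the $\mathrm{End}(\mathbb{C}^{2\ell+1})$-valued polynomials of degree $d$ obtained from the full spherical functions as in the context. Define the differential operators (acting from the left) $$\widetilde{\Omega_\ell}=\tfrac14(z^2-1)\Bigl(\frac{d}{dz}\Bigr)^2+\tfrac14\bigl\{(2\ell+3)z+S^\ell\bigr\}\frac{d}{dz}+\Lambda_0,\qquad \widetilde{\Delta_\ell}=\tfrac18\bigl(2zU^\ell_{\mathrm{diag}}+U^\ell_{lu}\bigr)\frac{d}{dz}+\Gamma_0 .$$ Then the $R_d^{\ell,t}$ are eigenfunctions of $\widetilde{\Omega_\ell}$ and $\widetilde{\Delta_\ell}$ with eigenvalues $\Lambda_d$ and $\Gamma_d$ respectively: $$\widetilde{\Omega_\ell}R_d^{\ell,t}=R_d^{\ell,t}\Lambda_d,\qquad \widetilde{\Delta_\ell}R_d^{\ell,t}=R_d^{\ell,t}\Gamma_d\qquad(d\ge0).$$ Moreover the transposed differential operators satisfy, with $x=z$ and after relabelling the matrix index $j\in\{-\ell,\dots,\ell\}$ as $i=\ell-j\in\{0,\dots,2\ell\}$, $$-4(\widetilde{\Omega_\ell})^t+2(\ell^2+\ell)=\tilde D,\qquad -\frac2\ell(\widetilde{\Delta_\ell})^t-(\ell+1)=-2\tilde E,$$ where $\tilde D$ and $\tilde E$ are the differential operators given in the context.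
   Context: Matrices: indices $p,j\in\{-\ell,-\ell+1,\dots,\ell\}$; $$(S^\ell)_{p,j}=-(\ell-j)\delta_{p-j,1}-(\ell+j)\delta_{j-p,1},\quad (U^\ell_{\mathrm{diag}})_{p,j}=2p\,\delta_{p,j},\quad (U^\ell_{lu})_{p,j}=(2\ell-2j)\delta_{p,j+1}-(2\ell+2j)\delta_{p+1,j},$$ $$(\Lambda_d)_{p,j}=\tfrac14\delta_{p,j}\bigl(d^2+j^2+2d(\ell+1)+\ell(\ell+2)\bigr),\quad (\Gamma_d)_{p,j}=\tfrac12\delta_{p,j}\,j(\ell+d+1).$$ Spherical functions: $U=\mathrm{SU}(2)\times\mathrm{SU}(2)$, $K=\mathrm{SU}(2)$ embedded diagonally. $T^\ell$ is the irreducible unitary representation of $\mathrm{SU}(2)$ on $H^\ell$ of dimension $2\ell+1$, with orthonormal weight basis $e_p$, $-\ell\le p\le\ell$, on which $\mathrm{diag}(e^{is},e^{-is})$ acts by $e^{2ips}$; $T^{\ell_1,\ell_2}=T^{\ell_1}\otimes T^{\ell_2}$ is the corresponding irreducible representation of $U$. If $T^\ell$ occurs in $T^{\ell_1,\ell_2}|_K$ (then with multiplicity one), the spherical function is $\Phi^\ell_{\ell_1,\ell_2}(u)=\beta^*T^{\ell_1,\ell_2}(u)\beta\in\mathrm{End}(H^\ell)$, where $\beta\colon H^\ell\to H^{\ell_1}\otimes H^{\ell_2}$ is a $K$-equivariant isometry; it extends holomorphically to $U^{\mathbb{C}}=\mathrm{SL}(2,\mathbb{C})\times\mathrm{SL}(2,\mathbb{C})$.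 For $w\in\mathbb{C}^\times$ put $a(w)=\bigl(\mathrm{diag}(w,w^{-1}),\mathrm{diag}(w^{-1},w)\bigr)$; $\Phi^\ell_{\ell_1,\ell_2}(a(w))$ is diagonal in the basis $e_p$. For $d\in\mathbb{N}$, $h\in\{-\ell,\dots,\ell\}$ let $\zeta(d,h)=(\frac12(d+\ell+h),\frac12(d+\ell-h))$. Let $\Phi^{\ell,t}_d(a(w))$ be the $(2\ell+1)\times(2\ell+1)$ matrix whose $(p,j)$ entry is the $p$-th diagonal entry of $\Phi^\ell_{\zeta(d,j)}(a(w))$. $\Phi^{\ell,t}_0(a(w))$ is invertible for $w^4\ne1$. Put $Q_d^{\ell,t}(a(w))=\Phi_0^{\ell,t}(a(w))^{-1}\Phi_d^{\ell,t}(a(w))$; it is a polynomial of degree $d$ in $\phi(a(w))=\frac12(w^2+w^{-2})$, and $R_d^{\ell,t}$ is the matrix-valued polynomial with $R_d^{\ell,t}(\phi(a(w)))=Q_d^{\ell,t}(a(w))$. Transposition: for $D=\sum_sF_s(z)\frac{d^s}{dz^s}$ acting from the left, $D^t=\sum_s\frac{d^s}{dz^s}F_s(z)^t$ acts from the right, $(PD^t)(z)=\sum_s\frac{d^sP}{dz^s}(z)F_s(z)^t$. Operators $\tilde D,\tilde E$ (acting from the right, matrices indexed by $0,\dots,2\ell$, $E_{ij}$ matrix units, zero if an index is out of range): $$\tilde D=(1-x^2)\frac{d^2}{dx^2}+\Bigl(\frac d{dx}\Bigr)(\tilde C-x\tilde U)-\tilde V,\quad \tilde C=\sum_i(2\ell-i)E_{i,i+1}+\sum_iiE_{i,i-1},\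 \tilde U=(2\ell+3)I,\ \tilde V=-\sum_ii(2\ell-i)E_{ii},$$ $$\tilde E=\Bigl(\frac d{dx}\Bigr)(\tilde B_0+x\tilde B_1)+\tilde A,\quad \tilde B_0=-\sum_i\tfrac{2\ell-i}{4\ell}E_{i,i+1}+\sum_i\tfrac i{4\ell}E_{i,i-1},\ \tilde B_1=\sum_i\tfrac{\ell-i}{2\ell}E_{ii},\ \tilde A=\sum_i\tfrac{(2\ell+2)(2\ell-i)}{4\ell}E_{ii},$$ all sums over $0\le i\le2\ell$. *)

theory Defs
  imports "HOL-Analysis.Analysis" "HOL-Computational_Algebra.Polynomial"
begin

text \<open>A matrix with rows indexed by a finite set \<open>I\<close> and columns by \<open>J\<close> is a function
  of two arguments; only its values on \<open>I \<times> J\<close> are meaningful. This is needed because the spins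
  \<open>\<ell>\<^sub>1, \<ell>\<^sub>2\<close>, and with them the dimensions, vary with the degree \<open>d\<close>.\<close>

definition mmul :: "'j set \<Rightarrow> ('i \<Rightarrow> 'j \<Rightarrow> 'a::comm_ring_1) \<Rightarrow> ('j \<Rightarrow> 'k \<Rightarrow> 'a) \<Rightarrow> 'i \<Rightarrow> 'k \<Rightarrow> 'a"
  where "mmul J A B = (\<lambda>i k. \<Sum>j\<in>J. A i j * B j k)"

definition kd :: "'i \<Rightarrow> 'i \<Rightarrow> 'a::zero_neq_one"
  where "kd i j = (if i = j then 1 else 0)"

definition madj :: "('i \<Rightarrow> 'j \<Rightarrow> complex) \<Rightarrow> 'j \<Rightarrow> 'i \<Rightarrow> complex"
  where "madj A = (\<lambda>j i. cnj (A i j))"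

definition meq :: "'i set \<Rightarrow> 'j set \<Rightarrow> ('i \<Rightarrow> 'j \<Rightarrow> 'a) \<Rightarrow> ('i \<Rightarrow> 'j \<Rightarrow> 'a) \<Rightarrow> bool"
  where "meq I J A B \<longleftrightarrow> (\<forall>i\<in>I. \<forall>j\<in>J. A i j = B i j)"

definition minv :: "'i set \<Rightarrow> ('i \<Rightarrow> 'i \<Rightarrow> complex) \<Rightarrow> 'i \<Rightarrow> 'i \<Rightarrow> complex"
  where "minv I A = (SOME B. meq I I (mmul I A B) kd \<and> meq I I (mmul I B A) kd)"

definition SL2 :: "(complex^2^2) set"
  where "SL2 = {g. det g = 1}"

definition SU2 :: "(complex^2^2) set"
  where "SU2 = {g \<in> SL2. (\<chi> i j. cnj (g $ j $ i)) ** g = mat 1}"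

definition dg :: "complex \<Rightarrow> complex^2^2"
  where "dg w = vector [vector [w, 0], vector [0, inverse w]]"

text \<open>For \<open>2 l\<close> a natural number this is \<open>{-l, -l + 1, \<dots>, l}\<close>; half-integral indices are
  kept literally, as reals.\<close>

definition wts :: "real \<Rightarrow> real set"
  where "wts l = {p. \<exists>k::nat. real k \<le> 2 * l \<and> p = real k - l}"

definition vecs :: "'i set \<Rightarrow> ('i \<Rightarrow> complex) set"
  where "vecs I = {v. \<forall>i. i \<notin> I \<longrightarrow> v i = 0}"

definition mvec :: "'i set \<Rightarrow> ('i \<Rightarrow> 'i \<Rightarrow> complex) \<Rightarrow> ('i \<Rightarrow> complex) \<Rightarrow> 'i \<Rightarrow> complex"
  where "mvec I A v = (\<lambda>i. if i \<in> I then \<Sum>j\<in>I. A i j * v j else 0)"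

definition csubspace :: "'i set \<Rightarrow> ('i \<Rightarrow> complex) set \<Rightarrow> bool"
  where "csubspace I V \<longleftrightarrow> V \<subseteq> vecs I \<and> (\<lambda>_. 0) \<in> V \<and>
    (\<forall>u\<in>V. \<forall>v\<in>V. (\<lambda>i. u i + v i) \<in> V) \<and> (\<forall>c. \<forall>v\<in>V. (\<lambda>i. c * v i) \<in> V)"

definition irreducible_on ::
    "'i set \<Rightarrow> (complex^2^2) set \<Rightarrow> (complex^2^2 \<Rightarrow> 'i \<Rightarrow> 'i \<Rightarrow> complex) \<Rightarrow> bool"
  where "irreducible_on I G T \<longleftrightarrow>
    (\<forall>V. csubspace I V \<and> (\<forall>g\<in>G. \<forall>v\<in>V. mvec I (T g) v \<in> V) \<longrightarrow> V = {\<lambda>_. 0} \<or> V = vecs I)"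

text \<open>The irreducible unitary representation of SU(2) of spin \<open>l\<close>, written as matrices in an
  orthonormal basis \<open>e\<^sub>p\<close>, \<open>p \<in> wts l\<close>, of weight vectors, together with its holomorphic extension
  to SL(2,C). A function on the complex group SL(2,C) is holomorphic iff it is holomorphic along
  every holomorphic curve; this is what the last clause says for the matrix entries.\<close>

definition spin_rep :: "real \<Rightarrow> (complex^2^2 \<Rightarrow> real \<Rightarrow> real \<Rightarrow> complex) \<Rightarrow> bool"
  where "spin_rep l T \<longleftrightarrow>
    meq (wts l) (wts l) (T (mat 1)) kd \<and>
    (\<forall>g\<in>SL2. \<forall>h\<in>SL2. meq (wts l) (wts l) (T (g ** h)) (mmul (wts l) (T g) (T h))) \<and>
    (\<forall>g\<in>SU2. meq (wts l) (wts l) (mmul (wts l) (madj (T g)) (T g)) kd) \<and>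
    irreducible_on (wts l) SU2 T \<and>
    (\<forall>s::real. meq (wts l) (wts l) (T (dg (exp (\<i> * s))))
        (\<lambda>p q. exp (2 * \<i> * p * s) * kd p q)) \<and>
    (\<forall>S c. open S \<and> (\<forall>z\<in>S. c z \<in> SL2) \<and> (\<forall>i j. (\<lambda>z. c z $ i $ j) holomorphic_on S) \<longrightarrow>
        (\<forall>p\<in>wts l. \<forall>q\<in>wts l. (\<lambda>z. T (c z) p q) holomorphic_on S))"

definition wts2 :: "real \<times> real \<Rightarrow> (real \<times> real) set"
  where "wts2 L = wts (fst L) \<times> wts (snd L)"

definition tensor_rep :: "(real \<Rightarrow> complex^2^2 \<Rightarrow> real \<Rightarrow> real \<Rightarrow> complex) \<Rightarrow> real \<times> real \<Rightarrow>
    (complex^2^2) \<times> (complex^2^2) \<Rightarrow> real \<times> real \<Rightarrow> real \<times> real \<Rightarrow> complex"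
  where "tensor_rep T L u = (\<lambda>a b.
    T (fst L) (fst u) (fst a) (fst b) * T (snd L) (snd u) (snd a) (snd b))"

definition equivariant_isometry :: "(real \<Rightarrow> complex^2^2 \<Rightarrow> real \<Rightarrow> real \<Rightarrow> complex) \<Rightarrow>
    real \<Rightarrow> real \<times> real \<Rightarrow> (real \<times> real \<Rightarrow> real \<Rightarrow> complex) \<Rightarrow> bool"
  where "equivariant_isometry T l L \<beta> \<longleftrightarrow>
    meq (wts l) (wts l) (mmul (wts2 L) (madj \<beta>) \<beta>) kd \<and>
    (\<forall>k\<in>SU2. meq (wts2 L) (wts l)
        (mmul (wts2 L) (tensor_rep T L (k, k)) \<beta>) (mmul (wts l) \<beta> (T l k)))"

text \<open>With the representations already extended to SL(2,C), this is the holomorphic extension of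
  the spherical function to SL(2,C) \<open>\<times>\<close> SL(2,C).\<close>

definition spherical :: "(real \<Rightarrow> complex^2^2 \<Rightarrow> real \<Rightarrow> real \<Rightarrow> complex) \<Rightarrow>
    real \<times> real \<Rightarrow> (real \<times> real \<Rightarrow> real \<Rightarrow> complex) \<Rightarrow>
    (complex^2^2) \<times> (complex^2^2) \<Rightarrow> real \<Rightarrow> real \<Rightarrow> complex"
  where "spherical T L \<beta> u = mmul (wts2 L) (madj \<beta>) (mmul (wts2 L) (tensor_rep T L u) \<beta>)"

definition torus :: "complex \<Rightarrow> (complex^2^2) \<times> (complex^2^2)"
  where "torus w = (dg w, dg (inverse w))"

definition zeta :: "real \<Rightarrow> nat \<Rightarrow> real \<Rightarrow> real \<times> real"
  where "zeta l d h = ((real d + l + h) / 2, (real d + l - h) / 2)"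

text \<open>The isometries are given as a family \<open>\<beta>\<close> indexed by the pairs \<open>(\<ell>\<^sub>1, \<ell>\<^sub>2)\<close>.\<close>

definition full_spherical :: "(real \<Rightarrow> complex^2^2 \<Rightarrow> real \<Rightarrow> real \<Rightarrow> complex) \<Rightarrow>
    (real \<times> real \<Rightarrow> real \<times> real \<Rightarrow> real \<Rightarrow> complex) \<Rightarrow> real \<Rightarrow> nat \<Rightarrow> complex \<Rightarrow>
    real \<Rightarrow> real \<Rightarrow> complex"
  where "full_spherical T \<beta> l d w =
    (\<lambda>p j. spherical T (zeta l d j) (\<beta> (zeta l d j)) (torus w) p p)"

definition Qfun :: "(real \<Rightarrow> complex^2^2 \<Rightarrow> real \<Rightarrow> real \<Rightarrow> complex) \<Rightarrow>
    (real \<times> real \<Rightarrow> real \<times> real \<Rightarrow> real \<Rightarrow> complex) \<Rightarrow> real \<Rightarrow> nat \<Rightarrow> complex \<Rightarrow>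
    real \<Rightarrow> real \<Rightarrow> complex"
  where "Qfun T \<beta> l d w =
    mmul (wts l) (minv (wts l) (full_spherical T \<beta> l 0 w)) (full_spherical T \<beta> l d w)"

definition phi :: "complex \<Rightarrow> complex"
  where "phi w = (w\<^sup>2 + inverse (w\<^sup>2)) / 2"

text \<open>The list \<open>[F\<^sub>0, F\<^sub>1, \<dots>]\<close> of matrices of polynomials stands for the differential operator
  with coefficient \<open>F\<^sub>s\<close> at the \<open>s\<close>-th derivative, acting from the left or from the right.\<close>

type_synonym 'i polymat = "'i \<Rightarrow> 'i \<Rightarrow> complex poly"

definition left_act :: "'i set \<Rightarrow> 'i polymat list \<Rightarrow> 'i polymat \<Rightarrow> 'i polymat"
  where "left_act I F P = (\<lambda>p j. \<Sum>s<length F.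
    mmul I (F ! s) (\<lambda>r k. (pderiv ^^ s) (P r k)) p j)"

definition right_act :: "'i set \<Rightarrow> 'i polymat \<Rightarrow> 'i polymat list \<Rightarrow> 'i polymat"
  where "right_act I P F = (\<lambda>p j. \<Sum>s<length F.
    mmul I (\<lambda>r k. (pderiv ^^ s) (P r k)) (F ! s) p j)"

definition dop_transpose :: "'i polymat list \<Rightarrow> 'i polymat list"
  where "dop_transpose F = map (\<lambda>A p j. A j p) F"

abbreviation cp :: "real \<Rightarrow> complex poly"
  where "cp c \<equiv> [:complex_of_real c:]"

abbreviation Z :: "complex poly"
  where "Z \<equiv> [:0, 1:]"

definition Smat :: "real \<Rightarrow> real \<Rightarrow> real \<Rightarrow> real"
  where "Smat l p j = - (l - j) * kd (p - j) 1 - (l + j) * kd (j - p) 1"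

definition Udiag :: "real \<Rightarrow> real \<Rightarrow> real \<Rightarrow> real"
  where "Udiag l p j = 2 * p * kd p j"

definition Ulu :: "real \<Rightarrow> real \<Rightarrow> real \<Rightarrow> real"
  where "Ulu l p j = (2 * l - 2 * j) * kd p (j + 1) - (2 * l + 2 * j) * kd (p + 1) j"

definition Lam :: "real \<Rightarrow> nat \<Rightarrow> real \<Rightarrow> real \<Rightarrow> real"
  where "Lam l d p j = 1/4 * kd p j * ((real d)\<^sup>2 + j\<^sup>2 + 2 * real d * (l + 1) + l * (l + 2))"

definition Gam :: "real \<Rightarrow> nat \<Rightarrow> real \<Rightarrow> real \<Rightarrow> real"
  where "Gam l d p j = 1/2 * kd p j * j * (l + real d + 1)"

definition Omega :: "real \<Rightarrow> real polymat list"
  where "Omega l =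
   [\<lambda>p j. cp (Lam l 0 p j),
    \<lambda>p j. cp (1/4) * (cp (2 * l + 3) * Z * kd p j + cp (Smat l p j)),
    \<lambda>p j. cp (1/4) * (Z\<^sup>2 - 1) * kd p j]"

definition Delta :: "real \<Rightarrow> real polymat list"
  where "Delta l =
   [\<lambda>p j. cp (Gam l 0 p j),
    \<lambda>p j. cp (1/8) * (2 * Z * cp (Udiag l p j) + cp (Ulu l p j))]"

text \<open>The operators acting from the right, whose matrices are indexed by \<open>0, \<dots>, 2 l\<close>. Entry
  \<open>(r, c)\<close> of \<open>\<Sum>\<^sub>i a\<^sub>i E\<^sub>i\<^sub>,\<^sub>i\<^sub>+\<^sub>1\<close> is \<open>a\<^sub>r\<close> if \<open>c = r + 1\<close>, that of
  \<open>\<Sum>\<^sub>i a\<^sub>i E\<^sub>i\<^sub>,\<^sub>i\<^sub>-\<^sub>1\<close> is \<open>a\<^sub>r\<close> if \<open>r = c + 1\<close>.\<close>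

definition idx :: "real \<Rightarrow> nat set"
  where "idx l = {i. real i \<le> 2 * l}"

definition Ct :: "real \<Rightarrow> nat \<Rightarrow> nat \<Rightarrow> real"
  where "Ct l r c = (2 * l - real r) * kd c (r + 1) + real r * kd r (c + 1)"

definition Ut :: "real \<Rightarrow> nat \<Rightarrow> nat \<Rightarrow> real"
  where "Ut l r c = (2 * l + 3) * kd r c"

definition Vt :: "real \<Rightarrow> nat \<Rightarrow> nat \<Rightarrow> real"
  where "Vt l r c = - (real r * (2 * l - real r) * kd r c)"

definition B0t :: "real \<Rightarrow> nat \<Rightarrow> nat \<Rightarrow> real"
  where "B0t l r c =
    - ((2 * l - real r) / (4 * l) * kd c (r + 1)) + real r / (4 * l) * kd r (c + 1)"

definition B1t :: "real \<Rightarrow> nat \<Rightarrow> nat \<Rightarrow> real"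
  where "B1t l r c = (l - real r) / (2 * l) * kd r c"

definition At :: "real \<Rightarrow> nat \<Rightarrow> nat \<Rightarrow> real"
  where "At l r c = (2 * l + 2) * (2 * l - real r) / (4 * l) * kd r c"

definition Dtilde :: "real \<Rightarrow> nat polymat list"
  where "Dtilde l =
   [\<lambda>r c. - cp (Vt l r c),
    \<lambda>r c. cp (Ct l r c) - Z * cp (Ut l r c),
    \<lambda>r c. (1 - Z\<^sup>2) * kd r c]"

definition Etilde :: "real \<Rightarrow> nat polymat list"
  where "Etilde l =
   [\<lambda>r c. cp (At l r c),
    \<lambda>r c. cp (B0t l r c) + Z * cp (B1t l r c)]"

definition relabel :: "real \<Rightarrow> real polymat \<Rightarrow> nat polymat"
  where "relabel l P = (\<lambda>i k. P (l - real i) (l - real k))"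

end

theory Submission
  imports Defs
begin

text \<open>The two differential operators are the Casimir elements of the two factors of
  SU(2) \<open>\<times>\<close> SU(2) in disguise: \<open>Omega\<close> comes from their sum and \<open>Delta\<close> from their difference.

  On the torus put \<open>w = exp (\<i> * t)\<close>, \<open>q = w\<^sup>2\<close>, \<open>k = q - 1/q\<close> and \<open>c = q + 1/q\<close>, let \<open>A\<close> be the action of
  \<open>a(w)\<close> on the tensor product, and let \<open>e\<^sub>1, f\<^sub>1, e\<^sub>2, f\<^sub>2\<close> be the raising and lowering operators of the
  factors. The torus scales \<open>e\<^sub>1\<close> and \<open>e\<^sub>2\<close> by inverse factors, whereas \<open>\<beta>\<close> intertwines \<open>e\<^sub>1 + e\<^sub>2\<close> with
  the raising operator of spin \<open>l\<close>. This is enough to eliminate \<open>e\<^sub>1\<close> and \<open>f\<^sub>1\<close> from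
  \<open>\<beta>\<^sup>* e\<^sub>1 f\<^sub>1 A \<beta>\<close> (\<open>casimir_first\<close>). As the Casimir element of a factor acts by a scalar, the diagonal
  entries of \<open>\<Phi> = \<beta>\<^sup>* A \<beta>\<close> satisfy two differential equations in \<open>t\<close> that couple neighbouring weights
  (\<open>radial\<close>). For the pair \<open>zeta l d j\<close> their eigenvalues are twice the diagonal entries of \<open>Lam l d\<close>
  and \<open>Gam l d\<close>.

  Now write \<open>\<Phi>\<^sub>d = \<Phi>\<^sub>0 Q\<^sub>d\<close>. The columns of \<open>\<Phi>\<^sub>0\<close> satisfy the same equations with \<open>d = 0\<close>, so all
  terms without a derivative of \<open>Q\<^sub>d\<close> reduce to eigenvalues, and the operators for \<open>Q\<^sub>d\<close> are known once
  the conjugate by \<open>\<Phi>\<^sub>0\<close> of the diagonal matrix of weights and the logarithmic derivative of \<open>\<Phi>\<^sub>0\<close> are.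
  For \<open>d = 0\<close> the spin \<open>l\<close> component is the Cartan component. Its squared Clebsch-Gordan coefficients are
  quotients of binomial coefficients (\<open>cartan_weight\<close>), so that, up to scaling of rows, the entries of
  column \<open>j\<close> are the coefficients of \<open>(w + s/w)\<^sup>l\<^sup>+\<^sup>j (1/w + s w)\<^sup>l\<^sup>-\<^sup>j\<close> as a polynomial in \<open>s\<close>. Both
  \<open>w d/dw\<close> and \<open>s d/ds\<close> send one linear factor to a combination of the two, whence three-term relations
  between neighbouring columns (\<open>cartan_contiguous\<close>); these yield \<open>Smat\<close>, \<open>Udiag\<close> and \<open>Ulu\<close>. The
  independence of the two linear forms makes \<open>\<Phi>\<^sub>0\<close> invertible (\<open>cartan_matrix_inverse\<close>), so it can be
  cancelled. What remains is an identity between polynomials at \<open>z = cos (2 t)\<close>, and it suffices to have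
  it for \<open>0 < t < pi / 2\<close>.

  The representations are given by their global properties. Their infinitesimal operators are obtained by
  differentiating along one-parameter subgroups: the group law of SL(2) gives weights and commutator,
  unitarity gives the adjoint, and together these determine the absolute values of the ladder
  coefficients (\<open>ladder_norm\<close>). The statement on transposed operators is a
  comparison of coefficient matrices.\<close>

section \<open>Weights\<close>

lemma finite_wts: "finite (wts l)"
proof -
  have "wts l \<subseteq> (\<lambda>k::nat. real k - l) ` {..nat \<lfloor>2 * l\<rfloor>}"
    unfolding wts_def by (auto simp: le_nat_floor)
  then show ?thesis by (rule finite_subset) simp
qed

lemma wts_bounds: "p \<in> wts l \<Longrightarrow> - l \<le> p \<and> p \<le> l"
  by (auto simp: wts_def)

lemma wts_eq_image: "2 * l = real n \<Longrightarrow> wts l = (\<lambda>k. real k - l) ` {..n}"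
  by (auto simp: wts_def)

lemma wts_raise_iff:
  assumes "2 * l \<in> \<nat>" "p \<in> wts l"
  shows "p + 1 \<in> wts l \<longleftrightarrow> p \<noteq> l"
proof -
  obtain n where n: "2 * l = real n" using assms(1) by (auto elim: Nats_cases)
  obtain k where k: "k \<le> n" "p = real k - l"
    using assms(2) n by (auto simp: wts_eq_image[OF n])
  have "p + 1 \<in> wts l" if "p \<noteq> l"
  proof -
    have "k < n" using that k n by (metis add_diff_cancel_right' le_neq_implies_less mult_2)
    then show ?thesis unfolding wts_eq_image[OF n] k by (intro image_eqI[of _ _ "Suc k"]) auto
  qed
  moreover have "p \<noteq> l" if "p + 1 \<in> wts l" using wts_bounds[OF that] by auto
  ultimately show ?thesis by blast
qed

lemma wts_lower_iff:
  assumes "2 * l \<in> \<nat>" "p \<in> wts l"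
  shows "p - 1 \<in> wts l \<longleftrightarrow> p \<noteq> - l"
proof -
  obtain n where n: "2 * l = real n" using assms(1) by (auto elim: Nats_cases)
  obtain k where k: "k \<le> n" "p = real k - l"
    using assms(2) n by (auto simp: wts_eq_image[OF n])
  have "p - 1 \<in> wts l" if "p \<noteq> - l"
  proof -
    have "k > 0" using that k by (cases k) auto
    then show ?thesis unfolding wts_eq_image[OF n] k
      using k by (intro image_eqI[of _ _ "k - 1"]) auto
  qed
  moreover have "p \<noteq> - l" if "p - 1 \<in> wts l" using wts_bounds[OF that] by auto
  ultimately show ?thesis by blast
qed

lemma wts_top: "2 * l \<in> \<nat> \<Longrightarrow> l \<in> wts l"
  by (auto simp: wts_def elim!: Nats_cases intro!: exI[of _ "nat \<lfloor>2*l\<rfloor>"])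

lemma wts_uminus:
  assumes "2 * l \<in> \<nat>" "p \<in> wts l" shows "- p \<in> wts l"
proof -
  obtain n where n: "2 * l = real n" using assms(1) by (auto elim: Nats_cases)
  obtain k where k: "k \<le> n" "p = real k - l"
    using assms(2) n by (auto simp: wts_eq_image[OF n])
  show ?thesis unfolding wts_eq_image[OF n] k using k n
    by (intro image_eqI[of _ _ "n - k"]) auto
qed

lemma wts_downward_induct [consumes 2, case_names top lower]:
  assumes "2 * l \<in> \<nat>" "p \<in> wts l"
    and top: "P l"
    and lower: "\<And>p. p \<in> wts l \<Longrightarrow> p + 1 \<in> wts l \<Longrightarrow> P (p + 1) \<Longrightarrow> P p"
  shows "P p"
proof -
  obtain n where n: "2 * l = real n" using assms(1) by (auto elim: Nats_cases)
  have *: "real k - l \<in> wts l" if "k \<le> n" for k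
    using that n by (auto simp: wts_eq_image[OF n])
  have "P (real k - l)" if "k \<le> n" for k
    using that
  proof (induction k rule: inc_induct)
    case base
    have "real n - l = l" using n by simp
    then show ?case using top by simp
  next
    case (step k)
    have e: "real (Suc k) - l = real k - l + 1" by simp
    show ?case
      using lower[of "real k - l"] *[of k] *[of "Suc k"] step unfolding e by simp
  qed
  then show ?thesis using assms(2) by (auto simp: wts_eq_image[OF n])
qed

section \<open>One-parameter subgroups of SL(2)\<close>

definition upper :: "complex \<Rightarrow> complex^2^2"
  where "upper x = vector [vector [1, x], vector [0, 1]]"

definition lower :: "complex \<Rightarrow> complex^2^2"
  where "lower y = vector [vector [1, 0], vector [y, 1]]"

text \<open>Every real point of this curve lies in SU(2), and its tangent at the origin is \<open>e - f\<close>. The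
  equivariance of \<open>\<beta>\<close> and the unitarity of \<open>T\<close> are available on SU(2) only, so this is the curve
  along which they are differentiated.\<close>

definition rot :: "complex \<Rightarrow> complex^2^2"
  where "rot z = vector [vector [cos z, sin z], vector [- sin z, cos z]]"

lemmas mat2_defs = upper_def lower_def rot_def dg_def

lemma mat2_eq_iff: "(A :: 'a^2^2) = B \<longleftrightarrow>
    A $ 1 $ 1 = B $ 1 $ 1 \<and> A $ 1 $ 2 = B $ 1 $ 2 \<and> A $ 2 $ 1 = B $ 2 $ 1 \<and> A $ 2 $ 2 = B $ 2 $ 2"
  by (simp add: vec_eq_iff forall_2)

lemma upper_SL2: "upper x \<in> SL2" and lower_SL2: "lower y \<in> SL2"
  by (auto simp: SL2_def det_2 mat2_defs)

lemma dg_SL2: "w \<noteq> 0 \<Longrightarrow> dg w \<in> SL2"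
  by (auto simp: SL2_def det_2 mat2_defs)

lemma rot_SL2: "rot z \<in> SL2"
  by (auto simp: SL2_def det_2 mat2_defs power2_eq_square[symmetric])

lemma rot_SU2: "rot (of_real s) \<in> SU2"
  unfolding SU2_def using rot_SL2
  by (auto simp: mat2_eq_iff matrix_matrix_mult_def sum_2 mat_def rot_def cnj_cos cnj_sin
      simp flip: power2_eq_square)

lemma dg_SU2: "dg (exp (\<i> * of_real s)) \<in> SU2"
  unfolding SU2_def using dg_SL2[of "exp (\<i> * of_real s)"]
  by (auto simp: mat2_eq_iff matrix_matrix_mult_def sum_2 mat_def dg_def exp_cnj
      simp flip: exp_minus exp_add)

text \<open>The adjoint action of the torus on the two root subgroups: it is what fixes the weights of the
  infinitesimal generators \<open>e\<close> and \<open>f\<close>.\<close>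

lemma dg_mult_upper: "w \<noteq> 0 \<Longrightarrow> dg w ** upper x = upper (w\<^sup>2 * x) ** dg w"
  by (auto simp: mat2_eq_iff matrix_matrix_mult_def sum_2 mat2_defs field_simps power2_eq_square)

lemma dg_mult_lower: "w \<noteq> 0 \<Longrightarrow> lower y ** dg w = dg w ** lower (w\<^sup>2 * y)"
  by (auto simp: mat2_eq_iff matrix_matrix_mult_def sum_2 mat2_defs field_simps power2_eq_square)

text \<open>To first order in \<open>y\<close>, this is the adjoint action
  \<open>Ad (upper x) f = f + x h - x\<^sup>2 e\<close>. A representation is known to be differentiable along single
  curves only, so its derivative along the left-hand side cannot be obtained from the tangent vector
  by linearity; the factorization on the right splits the curve into pieces in the three
  one-parameter directions.\<close>

lemma lower_conj_upper:
  assumes "1 + x * y \<noteq> 0"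
  shows "upper x ** (lower y ** upper (- x)) =
     lower (y / (1 + x * y)) ** (dg (1 + x * y) ** upper (- (x\<^sup>2 * y) / (1 + x * y)))"
proof -
  define D where "D = 1 + x * y"
  have D: "D \<noteq> 0" using assms by (simp add: D_def)
  have D2: "x * y = D - 1" by (simp add: D_def)
  have "1 - x * y = - (y * (x\<^sup>2 * y) / D) + inverse D"
    using D by (simp add: field_simps) (use D2 in algebra)
  then show ?thesis
    unfolding D_def[symmetric] using D D2
    by (auto simp: mat2_eq_iff matrix_matrix_mult_def sum_2 mat2_defs power2_eq_square
        algebra_simps)
qed

text \<open>The same device as in \<open>lower_conj_upper\<close>: it gives the derivative along \<open>rot\<close> as \<open>e - f\<close>.\<close>

lemma rot_decomp:
  assumes "cos z \<noteq> 0"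
  shows "rot z = lower (- tan z) ** (dg (cos z) ** upper (tan z))"
proof -
  have "cos z = - (tan z * (cos z * tan z)) + inverse (cos z)"
    using assms by (simp add: tan_def field_simps flip: power2_eq_square)
  then show ?thesis using assms
    by (auto simp: mat2_eq_iff matrix_matrix_mult_def sum_2 mat2_defs tan_def)
qed

lemma upper_0: "upper 0 = mat 1" and lower_0: "lower 0 = mat 1" and dg_1: "dg 1 = mat 1"
  and rot_0: "rot 0 = mat 1"
  by (auto simp: mat2_eq_iff mat2_defs mat_def)

section \<open>The infinitesimal action on a spin representation\<close>

lemma mmul_has_field_derivative:
  assumes "\<And>r. r \<in> I \<Longrightarrow> ((\<lambda>z. A z p r) has_field_derivative A' p r) (at z)"
    and "\<And>r. r \<in> I \<Longrightarrow> ((\<lambda>z. B z r q) has_field_derivative B' r q) (at z)"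
  shows "((\<lambda>z. mmul I (A z) (B z) p q) has_field_derivative
    mmul I A' (B z) p q + mmul I (A z) B' p q) (at z)"
proof -
  have "((\<lambda>z. \<Sum>r\<in>I. A z p r * B z r q) has_field_derivative
     (\<Sum>r\<in>I. A' p r * B z r q + B' r q * A z p r)) (at z)"
    by (rule DERIV_sum, rule DERIV_mult, simp_all add: assms)
  then show ?thesis by (simp add: mmul_def sum.distrib mult.commute)
qed

lemma mmul_kd_left:
  assumes "finite I" "p \<in> I" "\<And>r. r \<in> I \<Longrightarrow> A p r = c * kd p r"
  shows "mmul I A B p q = c * B p q"
proof -
  have "mmul I A B p q = (\<Sum>r\<in>I. if p = r then c * B r q else 0)"
    unfolding mmul_def by (rule sum.cong) (auto simp: assms(3) kd_def)
  then show ?thesis using assms(1,2) by simp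
qed

lemma mmul_kd_right:
  assumes "finite I" "q \<in> I" "\<And>r. r \<in> I \<Longrightarrow> B r q = c * kd r q"
  shows "mmul I A B p q = A p q * c"
proof -
  have "mmul I A B p q = (\<Sum>r\<in>I. if q = r then A p r * c else 0)"
    unfolding mmul_def by (rule sum.cong) (auto simp: assms(3) kd_def)
  then show ?thesis using assms(1,2) by simp
qed

text \<open>Distinct weights are separated by the character values of the torus.\<close>

lemma phase_separates:
  fixes a b :: real
  assumes "\<And>s::real. exp (2 * \<i> * a * s) * c = exp (2 * \<i> * b * s) * c" "a \<noteq> b"
  shows "c = 0"
proof -
  define s where "s = pi / (2 * (a - b))"
  have "2 * \<i> * a * s - 2 * \<i> * b * s = \<i> * complex_of_real (2 * (a - b) * s)"
    by (simp add: algebra_simps)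
  also have "2 * (a - b) * s = pi" using assms(2) by (simp add: s_def)
  finally have *: "2 * \<i> * a * s - 2 * \<i> * b * s = \<i> * pi" by simp
  have "exp (2 * \<i> * a * s) = exp (2 * \<i> * b * s) * exp (\<i> * pi)"
    unfolding *[symmetric] by (simp flip: exp_add)
  then have "exp (2 * \<i> * b * s) * (- c) = exp (2 * \<i> * b * s) * c"
    using assms(1)[of s] by (simp add: mult.commute)
  then show ?thesis by simp
qed

text \<open>Fixing the types keeps the coercion from \<open>real\<close> to \<open>complex\<close> outside of the Kronecker delta.\<close>

abbreviation kdc :: "real \<Rightarrow> real \<Rightarrow> complex"
  where "kdc \<equiv> kd"

lemma kd_of_real: "kd (complex_of_real p) (complex_of_real q) = kdc p q"
  by (simp add: kd_def)

locale spin_representation =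
  fixes l :: real and T :: "complex^2^2 \<Rightarrow> real \<Rightarrow> real \<Rightarrow> complex"
  assumes half_integral: "2 * l \<in> \<nat>" and rep: "spin_rep l T"
begin

lemma T_one: "p \<in> wts l \<Longrightarrow> q \<in> wts l \<Longrightarrow> T (mat 1) p q = kdc p q"
  using rep by (auto simp: spin_rep_def meq_def)

lemma T_mult: "g \<in> SL2 \<Longrightarrow> h \<in> SL2 \<Longrightarrow> p \<in> wts l \<Longrightarrow> q \<in> wts l \<Longrightarrow>
    T (g ** h) p q = mmul (wts l) (T g) (T h) p q"
  using rep by (auto simp: spin_rep_def meq_def)

lemma T_unitary: "g \<in> SU2 \<Longrightarrow> p \<in> wts l \<Longrightarrow> q \<in> wts l \<Longrightarrow>
    mmul (wts l) (madj (T g)) (T g) p q = kd p q"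
  using rep by (auto simp: spin_rep_def meq_def)

lemma T_torus: "p \<in> wts l \<Longrightarrow> q \<in> wts l \<Longrightarrow>
    T (dg (exp (\<i> * of_real s))) p q = exp (2 * \<i> * p * s) * kdc p q"
  using rep by (auto simp: spin_rep_def meq_def kd_of_real)

lemma mmul_torus_left:
  assumes "p \<in> wts l"
  shows "mmul (wts l) (T (dg (exp (\<i> * of_real s)))) B p q = exp (2 * \<i> * p * s) * B p q"
  by (rule mmul_kd_left) (use assms T_torus finite_wts in auto)

lemma mmul_torus_right:
  assumes "q \<in> wts l"
  shows "mmul (wts l) A (T (dg (exp (\<i> * of_real s)))) p q = A p q * exp (2 * \<i> * q * s)"
  by (rule mmul_kd_right) (use assms T_torus finite_wts in \<open>auto simp: kd_def\<close>)

lemma T_holomorphic: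
  assumes "open S" "\<And>z. z \<in> S \<Longrightarrow> c z \<in> SL2"
    "(\<lambda>z. c z $ 1 $ 1) holomorphic_on S" "(\<lambda>z. c z $ 1 $ 2) holomorphic_on S"
    "(\<lambda>z. c z $ 2 $ 1) holomorphic_on S" "(\<lambda>z. c z $ 2 $ 2) holomorphic_on S"
    "p \<in> wts l" "q \<in> wts l"
  shows "(\<lambda>z. T (c z) p q) holomorphic_on S"
proof -
  have "\<forall>i j. (\<lambda>z. c z $ i $ j) holomorphic_on S" using assms by (auto simp: forall_2)
  moreover have "open S \<and> (\<forall>z\<in>S. c z \<in> SL2) \<and> (\<forall>i j. (\<lambda>z. c z $ i $ j) holomorphic_on S) \<longrightarrow>
        (\<forall>p\<in>wts l. \<forall>q\<in>wts l. (\<lambda>z. T (c z) p q) holomorphic_on S)"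
    using rep unfolding spin_rep_def by blast
  ultimately show ?thesis using assms by blast
qed

definition e :: "real \<Rightarrow> real \<Rightarrow> complex"
  where "e p q = deriv (\<lambda>x. T (upper x) p q) 0"

definition f :: "real \<Rightarrow> real \<Rightarrow> complex"
  where "f p q = deriv (\<lambda>y. T (lower y) p q) 0"

lemma T_upper_deriv:
  assumes "p \<in> wts l" "q \<in> wts l" "(u has_field_derivative u') (at z)" "u z = 0"
  shows "((\<lambda>z. T (upper (u z)) p q) has_field_derivative e p q * u') (at z)"
proof -
  have "(\<lambda>x. T (upper x) p q) holomorphic_on UNIV"
    by (rule T_holomorphic) (auto simp: assms upper_SL2, auto simp: upper_def)
  then have "((\<lambda>x. T (upper x) p q) has_field_derivative e p q) (at (u z))"
    unfolding e_def assms(4) by (intro holomorphic_derivI[of _ UNIV]) auto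
  from DERIV_chain2[OF this assms(3)] show ?thesis .
qed

lemma T_lower_deriv:
  assumes "p \<in> wts l" "q \<in> wts l" "(u has_field_derivative u') (at z)" "u z = 0"
  shows "((\<lambda>z. T (lower (u z)) p q) has_field_derivative f p q * u') (at z)"
proof -
  have "(\<lambda>x. T (lower x) p q) holomorphic_on UNIV"
    by (rule T_holomorphic) (auto simp: assms lower_SL2, auto simp: lower_def)
  then have "((\<lambda>x. T (lower x) p q) has_field_derivative f p q) (at (u z))"
    unfolding f_def assms(4) by (intro holomorphic_derivI[of _ UNIV]) auto
  from DERIV_chain2[OF this assms(3)] show ?thesis .
qed

text \<open>The entry is known on the unit circle only. It is holomorphic in \<open>w\<close>, so its complex
  derivative at \<open>1\<close> is already determined by the derivative along the circle.\<close>

lemma T_dg_deriv: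
  assumes "p \<in> wts l" "q \<in> wts l" "(u has_field_derivative u') (at z)" "u z = 1"
  shows "((\<lambda>z. T (dg (u z)) p q) has_field_derivative (2 * of_real p * kdc p q) * u') (at z)"
proof -
  have "(\<lambda>w. T (dg w) p q) holomorphic_on - {0}"
    by (rule T_holomorphic) (auto simp: assms dg_SL2, auto simp: dg_def intro!: holomorphic_intros)
  then obtain d where d: "((\<lambda>w. T (dg w) p q) has_field_derivative d) (at 1)"
    using holomorphic_derivI[of _ "- {0}" 1] by auto
  have "((\<lambda>w. T (dg (exp (\<i> * w))) p q) has_field_derivative d * \<i>) (at (of_real 0))"
    by (rule DERIV_chain2[where f = "\<lambda>w. T (dg w) p q"])
       (use d in \<open>auto intro!: derivative_eq_intros\<close>)
  from has_vector_derivative_real_field[OF this, of UNIV]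
  have 1: "((\<lambda>s::real. exp (2 * \<i> * p * s) * kdc p q) has_vector_derivative d * \<i>) (at 0)"
    by (simp add: T_torus assms)
  have "((\<lambda>z. exp (2 * \<i> * p * z) * kdc p q) has_field_derivative (2 * \<i> * p) * kdc p q)
      (at (of_real 0))"
    by (auto intro!: derivative_eq_intros)
  from has_vector_derivative_real_field[OF this, of UNIV]
  have 2: "((\<lambda>s::real. exp (2 * \<i> * p * s) * kdc p q) has_vector_derivative
      (2 * \<i> * p) * kdc p q) (at 0)"
    by simp
  have "d * \<i> = (2 * \<i> * p) * kdc p q" by (rule vector_derivative_unique_at[OF 1 2])
  then have "d = 2 * p * kdc p q" by (simp add: algebra_simps)
  with DERIV_chain2[of "\<lambda>w. T (dg w) p q" d u z u' UNIV] d assms(3,4) show ?thesis by simp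
qed

text \<open>Differentiating \<open>dg w ** upper x = upper (w\<^sup>2 * x) ** dg w\<close> at \<open>x = 0\<close> shows that \<open>e\<close> raises
  weights by one; likewise \<open>f\<close> lowers them.\<close>

lemma e_weight:
  assumes "p \<in> wts l" "q \<in> wts l" "e p q \<noteq> 0"
  shows "p = q + 1"
proof (rule ccontr)
  assume "p \<noteq> q + 1"
  moreover have "exp (2 * \<i> * p * s) * e p q = exp (2 * \<i> * (q + 1) * s) * e p q" for s :: real
  proof -
    let ?w = "exp (\<i> * s)"
    have "T (dg ?w ** upper x) p q = T (upper (?w\<^sup>2 * x) ** dg ?w) p q" for x
      by (simp add: dg_mult_upper)
    then have eq: "exp (2 * \<i> * p * s) * T (upper x) p q
        = T (upper (?w\<^sup>2 * x)) p q * exp (2 * \<i> * q * s)" for x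
      using assms
      by (simp add: T_mult dg_SL2 upper_SL2 mmul_torus_left mmul_torus_right)
    have 1: "((\<lambda>x. exp (2 * \<i> * p * s) * T (upper x) p q) has_field_derivative
         exp (2 * \<i> * p * s) * (e p q * 1)) (at 0)"
      by (intro DERIV_cmult T_upper_deriv assms) auto
    have 2: "((\<lambda>x. T (upper (?w\<^sup>2 * x)) p q * exp (2 * \<i> * q * s)) has_field_derivative
         e p q * (?w\<^sup>2 * 1) * exp (2 * \<i> * q * s)) (at 0)"
      by (intro DERIV_cmult_right T_upper_deriv assms DERIV_cmult) auto
    have "exp (2 * \<i> * p * s) * (e p q * 1) = e p q * (?w\<^sup>2 * 1) * exp (2 * \<i> * q * s)"
      using 1 2 unfolding eq by (rule DERIV_unique)
    moreover have "?w\<^sup>2 * exp (2 * \<i> * q * s) = exp (2 * \<i> * (q + 1) * s)"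
      by (simp add: algebra_simps flip: exp_double exp_add)
    ultimately show ?thesis by (simp add: algebra_simps)
  qed
  ultimately show False using phase_separates[of p "e p q" "q + 1"] assms by auto
qed

lemma f_weight:
  assumes "p \<in> wts l" "q \<in> wts l" "f p q \<noteq> 0"
  shows "q = p + 1"
proof (rule ccontr)
  assume "q \<noteq> p + 1"
  moreover have "exp (2 * \<i> * q * s) * f p q = exp (2 * \<i> * (p + 1) * s) * f p q" for s :: real
  proof -
    let ?w = "exp (\<i> * s)"
    have "T (lower x ** dg ?w) p q = T (dg ?w ** lower (?w\<^sup>2 * x)) p q" for x
      by (simp add: dg_mult_lower)
    then have eq: "T (lower x) p q * exp (2 * \<i> * q * s)
        = exp (2 * \<i> * p * s) * T (lower (?w\<^sup>2 * x)) p q" for x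
      using assms
      by (simp add: T_mult dg_SL2 lower_SL2 mmul_torus_left mmul_torus_right)
    have 1: "((\<lambda>x. T (lower x) p q * exp (2 * \<i> * q * s)) has_field_derivative
         (f p q * 1) * exp (2 * \<i> * q * s)) (at 0)"
      by (intro DERIV_cmult_right T_lower_deriv assms) auto
    have 2: "((\<lambda>x. exp (2 * \<i> * p * s) * T (lower (?w\<^sup>2 * x)) p q) has_field_derivative
         exp (2 * \<i> * p * s) * (f p q * (?w\<^sup>2 * 1))) (at 0)"
      by (intro DERIV_cmult T_lower_deriv assms DERIV_cmult) auto
    have "(f p q * 1) * exp (2 * \<i> * q * s) = exp (2 * \<i> * p * s) * (f p q * (?w\<^sup>2 * 1))"
      using 1 2 unfolding eq by (rule DERIV_unique)
    moreover have "exp (2 * \<i> * p * s) * ?w\<^sup>2 = exp (2 * \<i> * (p + 1) * s)"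
      by (simp add: algebra_simps flip: exp_double exp_add)
    ultimately show ?thesis by (simp add: algebra_simps)
  qed
  ultimately show False using phase_separates[of q "f p q" "p + 1"] assms by auto
qed

lemma mmul_one_left: "p \<in> wts l \<Longrightarrow> mmul (wts l) (T (mat 1)) B p q = B p q"
  using mmul_kd_left[of "wts l" p "T (mat 1)" 1] by (simp add: finite_wts T_one)

lemma mmul_one_right: "q \<in> wts l \<Longrightarrow> mmul (wts l) A (T (mat 1)) p q = A p q"
  using mmul_kd_right[of "wts l" q "T (mat 1)" 1] by (simp add: finite_wts T_one)

lemma SL2_mult: "g \<in> SL2 \<Longrightarrow> h \<in> SL2 \<Longrightarrow> g ** h \<in> SL2"
  by (simp add: SL2_def det_mul)

lemma T_mult3:
  assumes "a \<in> SL2" "b \<in> SL2" "c \<in> SL2" "r \<in> wts l" "s \<in> wts l"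
  shows "T (a ** (b ** c)) r s = mmul (wts l) (T a) (mmul (wts l) (T b) (T c)) r s"
proof -
  have "T (a ** (b ** c)) r s = mmul (wts l) (T a) (T (b ** c)) r s"
    using assms by (simp add: T_mult SL2_mult)
  also have "\<dots> = mmul (wts l) (T a) (mmul (wts l) (T b) (T c)) r s"
    unfolding mmul_def[of _ "T a"] by (rule sum.cong) (use assms in \<open>auto simp: T_mult\<close>)
  finally show ?thesis .
qed

text \<open>Both sides are the derivative at \<open>y = 0\<close> of \<open>T (upper x ** lower y ** upper (- x))\<close>, the right one
  by way of \<open>lower_conj_upper\<close>.\<close>

lemma upper_conj_f:
  assumes "p \<in> wts l" "q \<in> wts l"
  shows "mmul (wts l) (T (upper x)) (mmul (wts l) f (T (upper (- x)))) p q
    = f p q + (x * (2 * of_real p * kdc p q) - x\<^sup>2 * e p q)"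
proof -
  let ?W = "wts l"
  have ev: "eventually (\<lambda>y. 1 + x * y \<noteq> 0) (nhds 0)"
  proof -
    have "((\<lambda>y. 1 + x * y) \<longlongrightarrow> 1 + x * 0) (nhds 0)"
      by (intro tendsto_intros filterlim_ident)
    from tendsto_imp_eventually_ne[OF this, of 0] show ?thesis by simp
  qed
  define l3 where "l3 = (\<lambda>y. mmul ?W (T (upper x)) (mmul ?W (T (lower y)) (T (upper (- x)))) p q)"
  define r3 where "r3 = (\<lambda>y. mmul ?W (T (lower (y / (1 + x * y))))
     (mmul ?W (T (dg (1 + x * y))) (T (upper (- (x\<^sup>2 * y) / (1 + x * y))))) p q)"
  have eq: "eventually (\<lambda>y. l3 y = r3 y) (nhds 0)"
    using ev
  proof eventually_elim
    case (elim y)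
    then show ?case unfolding l3_def r3_def
      using lower_conj_upper[OF elim] assms
      by (simp flip: T_mult3 add: upper_SL2 lower_SL2 dg_SL2)
  qed
  have L: "(l3 has_field_derivative
       mmul ?W (\<lambda>p q. 0) (mmul ?W (T (lower 0)) (T (upper (- x)))) p q
     + mmul ?W (T (upper x)) (\<lambda>p q. mmul ?W (\<lambda>p q. f p q * 1) (T (upper (- x))) p q
         + mmul ?W (T (lower 0)) (\<lambda>p q. 0) p q) p q) (at 0)"
    unfolding l3_def
    by (intro mmul_has_field_derivative DERIV_const T_lower_deriv assms) (auto simp: assms)
  have 1: "((\<lambda>y. y / (1 + x * y)) has_field_derivative 1) (at 0)"
   and 2: "((\<lambda>y. 1 + x * y) has_field_derivative x) (at 0)"
   and 3: "((\<lambda>y. - (x\<^sup>2 * y) / (1 + x * y)) has_field_derivative - (x\<^sup>2)) (at 0)"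
    by (auto intro!: derivative_eq_intros)
  have R: "(r3 has_field_derivative
       mmul ?W (\<lambda>p q. f p q * 1) (mmul ?W (T (dg (1 + x * 0))) (T (upper (- (x\<^sup>2 * 0) / (1 + x * 0))))) p q
     + mmul ?W (T (lower (0 / (1 + x * 0)))) (\<lambda>p q.
         mmul ?W (\<lambda>p q. (2 * of_real p * kdc p q) * x) (T (upper (- (x\<^sup>2 * 0) / (1 + x * 0)))) p q
       + mmul ?W (T (dg (1 + x * 0))) (\<lambda>p q. e p q * - (x\<^sup>2)) p q) p q) (at 0)"
    unfolding r3_def
    by (intro mmul_has_field_derivative T_lower_deriv T_dg_deriv T_upper_deriv 1 2 3)
       (auto simp: assms)
  have z1: "mmul ?W A (\<lambda>p q. 0) = (\<lambda>p q. 0)" "mmul ?W (\<lambda>p q. 0) A = (\<lambda>p q. 0)"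
    for A :: "real \<Rightarrow> real \<Rightarrow> complex"
    by (auto simp: mmul_def)
  have *: "mmul ?W f (mmul ?W (T (mat 1)) (T (mat 1))) p q = f p q"
  proof -
    have "mmul ?W f (mmul ?W (T (mat 1)) (T (mat 1))) p q = mmul ?W f (T (mat 1)) p q"
      unfolding mmul_def[of _ f] by (rule sum.cong) (auto simp: mmul_one_left)
    then show ?thesis using assms by (simp add: mmul_one_right)
  qed
  have "(r3 has_field_derivative mmul ?W (T (upper x)) (mmul ?W f (T (upper (- x)))) p q) (at 0)"
    using L by (simp add: z1 DERIV_cong_ev[OF refl eq refl])
  moreover have "(r3 has_field_derivative f p q + (x * (2 * of_real p * kdc p q) - x\<^sup>2 * e p q)) (at 0)"
    using R assms by (simp add: upper_0 lower_0 dg_1 mmul_one_left mmul_one_right * mult.commute)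
  ultimately show ?thesis by (rule DERIV_unique)
qed

text \<open>The derivative of \<open>upper_conj_f\<close> at \<open>x = 0\<close>, that is, \<open>[e, f] = h\<close>.\<close>

lemma e_f_commutator:
  assumes "p \<in> wts l"
  shows "mmul (wts l) e f p p - mmul (wts l) f e p p = 2 * p"
proof -
  let ?W = "wts l"
  have "((\<lambda>x. mmul ?W (T (upper x)) (mmul ?W f (T (upper (- x)))) p p) has_field_derivative
       mmul ?W (\<lambda>p q. e p q * 1) (mmul ?W f (T (upper (- 0)))) p p
     + mmul ?W (T (upper 0)) (\<lambda>p q. mmul ?W (\<lambda>p q. 0) (T (upper (- 0))) p q
         + mmul ?W f (\<lambda>p q. e p q * - 1) p q) p p) (at 0)"
    by (intro mmul_has_field_derivative DERIV_const T_upper_deriv)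
       (auto simp: assms intro!: derivative_eq_intros)
  moreover have "mmul ?W e (mmul ?W f (T (mat 1))) p p = mmul ?W e f p p"
    unfolding mmul_def[of _ e] by (rule sum.cong) (auto simp: mmul_one_right assms)
  moreover have "mmul ?W f (\<lambda>p q. - e p q) p p = - mmul ?W f e p p"
    by (simp add: mmul_def sum_negf)
  moreover have "mmul ?W (\<lambda>(p::real) q. 0) (T (mat 1)) = (\<lambda>p q. 0)" by (simp add: mmul_def)
  ultimately have 1: "((\<lambda>x. mmul ?W (T (upper x)) (mmul ?W f (T (upper (- x)))) p p)
     has_field_derivative mmul ?W e f p p - mmul ?W f e p p) (at 0)"
    by (simp add: assms upper_0 mmul_one_left)
  have 2: "((\<lambda>x. f p p + (x * (2 * of_real p * kdc p p) - x\<^sup>2 * e p p)) has_field_derivative 2 * of_real p) (at 0)"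
    by (auto intro!: derivative_eq_intros simp: kd_def)
  show ?thesis using 1 2 unfolding upper_conj_f[OF assms assms] by (simp add: DERIV_unique)
qed

lemma T_rot_deriv:
  assumes "p \<in> wts l" "q \<in> wts l"
  shows "((\<lambda>s::real. T (rot (of_real s)) p q) has_vector_derivative e p q - f p q) (at 0)"
proof -
  let ?W = "wts l"
  define r3 where "r3 = (\<lambda>z. mmul ?W (T (lower (- tan z)))
     (mmul ?W (T (dg (cos z))) (T (upper (tan z)))) p q)"
  have ev: "eventually (\<lambda>z::complex. cos z \<noteq> 0) (nhds 0)"
  proof -
    have "((\<lambda>z::complex. cos z) \<longlongrightarrow> cos 0) (nhds 0)"
      by (intro tendsto_intros filterlim_ident)
    from tendsto_imp_eventually_ne[OF this, of 0] show ?thesis by simp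
  qed
  have eq: "eventually (\<lambda>z. T (rot z) p q = r3 z) (nhds 0)"
    using ev
  proof eventually_elim
    case (elim z)
    then show ?case unfolding r3_def using rot_decomp[OF elim] assms
      by (simp flip: T_mult3 add: upper_SL2 lower_SL2 dg_SL2)
  qed
  have 1: "((\<lambda>z::complex. - tan z) has_field_derivative - 1) (at 0)"
   and 2: "((\<lambda>z::complex. cos z) has_field_derivative 0) (at 0)"
   and 3: "((\<lambda>z::complex. tan z) has_field_derivative 1) (at 0)"
    by (auto intro!: derivative_eq_intros)
  have R: "(r3 has_field_derivative
       mmul ?W (\<lambda>p q. f p q * - 1) (mmul ?W (T (dg (cos 0))) (T (upper (tan 0)))) p q
     + mmul ?W (T (lower (- tan 0))) (\<lambda>p q.
         mmul ?W (\<lambda>p q. (2 * of_real p * kdc p q) * 0) (T (upper (tan 0))) p q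
       + mmul ?W (T (dg (cos 0))) (\<lambda>p q. e p q * 1) p q) p q) (at 0)"
    unfolding r3_def
    by (intro mmul_has_field_derivative T_lower_deriv T_dg_deriv T_upper_deriv 1 2 3)
       (auto simp: assms)
  have *: "mmul ?W (\<lambda>p q. - f p q) (mmul ?W (T (mat 1)) (T (mat 1))) p q = - f p q"
  proof -
    have "mmul ?W (\<lambda>p q. - f p q) (mmul ?W (T (mat 1)) (T (mat 1))) p q
        = mmul ?W (\<lambda>p q. - f p q) (T (mat 1)) p q"
      unfolding mmul_def[of _ "\<lambda>p q. - f p q"] by (rule sum.cong) (auto simp: mmul_one_left)
    then show ?thesis using assms by (simp add: mmul_one_right)
  qed
  have z1: "mmul ?W (\<lambda>p q. 0) A = (\<lambda>p q. 0)" for A :: "real \<Rightarrow> real \<Rightarrow> complex"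
    by (auto simp: mmul_def)
  have "(r3 has_field_derivative e p q - f p q) (at 0)"
    using R assms by (simp add: upper_0 lower_0 dg_1 mmul_one_left mmul_one_right * z1)
  then have "((\<lambda>z. T (rot z) p q) has_field_derivative e p q - f p q) (at (of_real 0))"
    by (simp add: DERIV_cong_ev[OF refl eq refl])
  from has_vector_derivative_real_field[OF this, of UNIV] show ?thesis by simp
qed

text \<open>Unitarity on SU(2) makes the derivative \<open>e - f\<close> along \<open>rot\<close> skew-Hermitian; since \<open>e\<close> and \<open>f\<close>
  shift weights in opposite directions, this says that \<open>f\<close> is the adjoint of \<open>e\<close>.\<close>

lemma f_eq_cnj_e:
  assumes "p \<in> wts l" "p + 1 \<in> wts l"
  shows "f p (p + 1) = cnj (e (p + 1) p)"
proof -
  let ?W = "wts l" and ?X = "\<lambda>p q. e p q - f p q"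
  let ?p = "p + 1"
  have "((\<lambda>s::real. \<Sum>r\<in>?W. cnj (T (rot s) r p) * T (rot s) r ?p) has_vector_derivative
     (\<Sum>r\<in>?W. cnj (T (rot (of_real 0)) r p) * ?X r ?p + cnj (?X r p) * T (rot (of_real 0)) r ?p)) (at 0)"
    by (intro has_vector_derivative_sum has_vector_derivative_mult has_vector_derivative_cnj T_rot_deriv assms)
  moreover have "(\<Sum>r\<in>?W. cnj (T (rot (of_real 0)) r p) * ?X r ?p) = ?X p ?p"
  proof -
    have "(\<Sum>r\<in>?W. cnj (T (rot (of_real 0)) r p) * ?X r ?p) = (\<Sum>r\<in>?W. if r = p then ?X r ?p else 0)"
      by (rule sum.cong) (use assms in \<open>auto simp: rot_0 T_one kd_def\<close>)
    then show ?thesis using assms by (simp add: finite_wts)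
  qed
  moreover have "(\<Sum>r\<in>?W. cnj (?X r p) * T (rot (of_real 0)) r ?p) = cnj (?X ?p p)"
  proof -
    have "(\<Sum>r\<in>?W. cnj (?X r p) * T (rot (of_real 0)) r ?p) = (\<Sum>r\<in>?W. if r = ?p then cnj (?X r p) else 0)"
      by (rule sum.cong) (use assms in \<open>auto simp: rot_0 T_one kd_def\<close>)
    then show ?thesis using assms by (simp add: finite_wts)
  qed
  ultimately have "((\<lambda>s::real. \<Sum>r\<in>?W. cnj (T (rot s) r p) * T (rot s) r ?p) has_vector_derivative
     ?X p ?p + cnj (?X ?p p)) (at 0)"
    by (simp add: sum.distrib)
  moreover have "(\<Sum>r\<in>?W. cnj (T (rot s) r p) * T (rot s) r ?p) = kd p ?p" for s :: real
    using T_unitary[OF rot_SU2 assms] by (simp add: mmul_def madj_def)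
  ultimately have "((\<lambda>s::real. kd p ?p :: complex) has_vector_derivative
     ?X p ?p + cnj (?X ?p p)) (at 0)" by simp
  then have "?X p ?p + cnj (?X ?p p) = 0"
    using has_vector_derivative_const by (rule vector_derivative_unique_at)
  moreover have "e p ?p = 0" using e_weight[of p ?p] assms by (cases "e p ?p = 0") simp_all
  moreover have "f ?p p = 0" using f_weight[of ?p p] assms by (cases "f ?p p = 0") simp_all
  ultimately have "cnj (e ?p p) = f p ?p" by (simp only: complex_cnj_diff) simp
  then show ?thesis by simp
qed

text \<open>The coefficient of \<open>e\<close> from weight \<open>p\<close> to weight \<open>p + 1\<close>, set to zero when either weight does not
  occur. With this convention the recurrences below hold for all real arguments and need no
  boundary cases.\<close>

definition ladder :: "real \<Rightarrow> complex"
  where "ladder p = (if p \<in> wts l \<and> p + 1 \<in> wts l then e (p + 1) p else 0)"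

lemma T_rot_ladder:
  assumes "p \<in> wts l" "q \<in> wts l"
  shows "((\<lambda>s::real. T (rot (of_real s)) p q) has_vector_derivative
    (if p = q + 1 then ladder q else if q = p + 1 then - cnj (ladder p) else 0)) (at 0)"
proof -
  have "e p q - f p q = (if p = q + 1 then ladder q else if q = p + 1 then - cnj (ladder p) else 0)"
  proof -
    consider "p = q + 1" | "q = p + 1" | "p \<noteq> q + 1" "q \<noteq> p + 1" by blast
    then show ?thesis
    proof cases
      case 1
      have "f p q = 0" using f_weight[OF assms] 1 by (cases "f p q = 0") simp_all
      then show ?thesis using 1 assms by (simp add: ladder_def)
    next
      case 2
      have "e p q = 0" using e_weight[OF assms] 2 by (cases "e p q = 0") simp_all
      moreover have "f p q = cnj (ladder p)" using 2 assms f_eq_cnj_e[of p] by (simp add: ladder_def)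
      ultimately show ?thesis using 2 by simp
    next
      case 3
      have "f p q = 0" "e p q = 0" using e_weight[OF assms] f_weight[OF assms] 3 by blast+
      then show ?thesis using 3 by simp
    qed
  qed
  with T_rot_deriv[OF assms] show ?thesis by simp
qed

lemma ladder_step:
  assumes "p \<in> wts l"
  shows "ladder (p - 1) * cnj (ladder (p - 1)) - ladder p * cnj (ladder p) = 2 * p"
proof -
  let ?W = "wts l"
  have "mmul ?W e f p p = ladder (p - 1) * cnj (ladder (p - 1))"
  proof -
    have "mmul ?W e f p p = (\<Sum>r\<in>?W. if r = p - 1 then ladder (p - 1) * cnj (ladder (p - 1)) else 0)"
      unfolding mmul_def
    proof (rule sum.cong[OF refl])
      fix r assume r: "r \<in> ?W"
      show "e p r * f r p = (if r = p - 1 then ladder (p - 1) * cnj (ladder (p - 1)) else 0)"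
      proof (cases "r = p - 1")
        case True
        then show ?thesis using f_eq_cnj_e[of "p - 1"] assms r by (auto simp: ladder_def)
      next
        case False
        then have "e p r = 0" using e_weight[OF assms r] by (cases "e p r = 0") simp_all
        then show ?thesis using False by simp
      qed
    qed
    also have "\<dots> = ladder (p - 1) * cnj (ladder (p - 1))"
      by (auto simp: finite_wts ladder_def)
    finally show ?thesis .
  qed
  moreover have "mmul ?W f e p p = ladder p * cnj (ladder p)"
  proof -
    have "mmul ?W f e p p = (\<Sum>r\<in>?W. if r = p + 1 then ladder p * cnj (ladder p) else 0)"
      unfolding mmul_def
    proof (rule sum.cong[OF refl])
      fix r assume r: "r \<in> ?W"
      show "f p r * e r p = (if r = p + 1 then ladder p * cnj (ladder p) else 0)"
      proof (cases "r = p + 1")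
        case True
        then show ?thesis using f_eq_cnj_e[of p] assms r by (auto simp: ladder_def)
      next
        case False
        then have "e r p = 0" using e_weight[OF r assms] by (cases "e r p = 0") simp_all
        then show ?thesis using False by simp
      qed
    qed
    also have "\<dots> = ladder p * cnj (ladder p)"
      by (auto simp: finite_wts ladder_def)
    finally show ?thesis .
  qed
  ultimately show ?thesis using e_f_commutator[OF assms] by simp
qed

text \<open>The weight basis is determined up to phases only, so the ladder coefficients are known in absolute
  value only. Their squares telescope: the relation \<open>[e, f] = h\<close> fixes consecutive differences, and the
  coefficient at the highest weight vanishes.\<close>

lemma ladder_norm:
  assumes "p \<in> wts l"
  shows "ladder p * cnj (ladder p) = (l - p) * (l + p + 1)"
  using half_integral assms
proof (induction rule: wts_downward_induct)
  case top
  have "l + 1 \<notin> wts l" using wts_bounds by fastforce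
  then show ?case by (simp add: ladder_def)
next
  case (lower p)
  have "ladder p * cnj (ladder p) - ladder (p + 1) * cnj (ladder (p + 1)) = 2 * (p + 1)"
    using ladder_step[of "p + 1"] lower by simp
  then have "ladder p * cnj (ladder p) = 2 * (p + 1) + (l - (p + 1)) * (l + (p + 1) + 1)"
    unfolding lower by (simp add: algebra_simps)
  also have "\<dots> = (l - p) * (l + p + 1)"
    by (rule arg_cong[of _ _ complex_of_real]) (simp add: algebra_simps)
  finally show ?case .
qed

lemma ladder_norm_below:
  assumes "p \<in> wts l"
  shows "ladder (p - 1) * cnj (ladder (p - 1)) = (l + p) * (l - p + 1)"
  using ladder_norm[OF assms] ladder_step[OF assms] by (simp add: algebra_simps)

lemma ladder_support: "ladder p \<noteq> 0 \<Longrightarrow> p \<in> wts l \<and> p + 1 \<in> wts l"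
  by (auto simp: ladder_def split: if_splits)

end

section \<open>Radial parts of the Casimir elements\<close>

text \<open>The relations among Clebsch-Gordan coefficients that the Casimir computation uses. The number
  \<open>x m n\<close> is the coefficient of \<open>e\<^sub>m \<otimes> e\<^sub>n\<close> in \<open>\<beta> e\<^sub>m\<^sub>+\<^sub>n\<close>, extended by zero. The first two assumptions
  say that \<open>\<beta>\<close> intertwines the raising and the lowering operators; \<open>a\<close>, \<open>a1\<close>, \<open>a2\<close> are the ladder
  coefficients of the three representations.\<close>

locale clebsch_gordan =
  fixes l l1 l2 :: real and a a1 a2 :: "real \<Rightarrow> complex" and x :: "real \<Rightarrow> real \<Rightarrow> complex"
  assumes raise: "a (m + n - 1) * x m n = a1 (m - 1) * x (m - 1) n + a2 (n - 1) * x m (n - 1)"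
    and lower: "cnj (a (m + n)) * x m n = cnj (a1 m) * x (m + 1) n + cnj (a2 n) * x m (n + 1)"
    and support: "x m n \<noteq> 0 \<Longrightarrow> m \<in> wts l1 \<and> n \<in> wts l2"
    and norm: "p \<in> wts l \<Longrightarrow> a p * cnj (a p) = (l - p) * (l + p + 1)"
      "p \<in> wts l \<Longrightarrow> a (p - 1) * cnj (a (p - 1)) = (l + p) * (l - p + 1)"
    and norm1: "m \<in> wts l1 \<Longrightarrow> a1 m * cnj (a1 m) = (l1 - m) * (l1 + m + 1)"
      "m \<in> wts l1 \<Longrightarrow> a1 (m - 1) * cnj (a1 (m - 1)) = (l1 + m) * (l1 - m + 1)"
    and a1_raises: "a1 m \<noteq> 0 \<Longrightarrow> m \<in> wts l1 \<and> m + 1 \<in> wts l1"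
    and a2_raises: "a2 n \<noteq> 0 \<Longrightarrow> n \<in> wts l2 \<and> n + 1 \<in> wts l2"
    and norm2: "n \<in> wts l2 \<Longrightarrow> a2 n * cnj (a2 n) = (l2 - n) * (l2 + n + 1)"
      "n \<in> wts l2 \<Longrightarrow> a2 (n - 1) * cnj (a2 (n - 1)) = (l2 + n) * (l2 - n + 1)"
begin

text \<open>Exchanging the tensor factors turns the identity for the first Casimir element into that for the
  second one; on the torus it amounts to \<open>t \<mapsto> - t\<close>.\<close>

lemma swap: "clebsch_gordan l l2 l1 a a2 a1 (\<lambda>m n. x n m)"
proof
  fix m n p :: real
  show "a (m + n - 1) * x n m = a2 (m - 1) * x n (m - 1) + a1 (n - 1) * x (n - 1) m"
    using raise[of n m] by (simp add: add.commute)
  show "cnj (a (m + n)) * x n m = cnj (a2 m) * x n (m + 1) + cnj (a1 n) * x (n + 1) m"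
    using lower[of n m] by (simp add: add.commute)
qed (use support norm norm1 norm2 a1_raises a2_raises in auto)

text \<open>The diagonal entry at weight \<open>p\<close> of \<open>\<beta>\<^sup>* g A \<beta>\<close>, where \<open>A\<close> is the action of the torus element
  with parameter \<open>w = exp (\<i> * t)\<close> and \<open>g\<close> is an operator that is diagonal in the basis
  \<open>e\<^sub>m \<otimes> e\<^sub>n\<close>; on weight \<open>p\<close> one has \<open>n = p - m\<close>.\<close>

definition mom :: "(real \<Rightarrow> real \<Rightarrow> complex) \<Rightarrow> real \<Rightarrow> real \<Rightarrow> complex"
  where "mom g t p = (\<Sum>m\<in>wts l1. g m (p - m) *
    (cnj (x m (p - m)) * x m (p - m) * exp (2 * \<i> * t * (2 * m - p))))"

lemma mom_has_vector_derivative: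
  "((\<lambda>t. mom g t p) has_vector_derivative \<i> * mom (\<lambda>m n. 2 * (m - n) * g m n) t p) (at t)"
proof -
  have "((\<lambda>z. \<Sum>m\<in>wts l1. g m (p - m) * (cnj (x m (p - m)) * x m (p - m) * exp (2 * \<i> * z * (2 * m - p))))
     has_field_derivative (\<Sum>m\<in>wts l1. \<i> * (of_real (2 * (m - (p - m))) * g m (p - m) *
       (cnj (x m (p - m)) * x m (p - m) * exp (2 * \<i> * of_real t * (2 * m - p)))))) (at (of_real t))"
    by (rule DERIV_sum) (auto intro!: derivative_eq_intros simp: algebra_simps)
  from has_vector_derivative_real_field[OF this, of UNIV] show ?thesis
    unfolding mom_def sum_distrib_left by simp
qed

lemma mom_cmult: "mom (\<lambda>m n. c * g m n) t p = c * mom g t p"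
  by (simp add: mom_def sum_distrib_left mult.assoc)

lemma mom_cong: "(\<And>m n. m + n = p \<Longrightarrow> g m n = h m n) \<Longrightarrow> mom g t p = mom h t p"
  unfolding mom_def by (rule sum.cong) auto

lemma mom_swap: "clebsch_gordan.mom l2 (\<lambda>m n. x n m) g (- t) p = mom (\<lambda>m n. g n m) t p"
proof -
  interpret sw: clebsch_gordan l l2 l1 a a2 a1 "\<lambda>m n. x n m" by (rule swap)
  show ?thesis unfolding sw.mom_def mom_def
    by (rule sum.reindex_bij_witness_not_neutral[where i = "\<lambda>m. p - m" and j = "\<lambda>m. p - m"
      and S' = "{m \<in> wts l2. x (p - m) m = 0}" and T' = "{m \<in> wts l1. x m (p - m) = 0}"])
      (use support in \<open>auto simp: finite_wts algebra_simps\<close>)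
qed

text \<open>This moves a raising operator from one argument of the Hermitian form to the other.\<close>

lemma sum_shift:
  assumes "\<And>m. g m \<noteq> (0::complex) \<Longrightarrow> m \<in> wts l1 \<and> m + 1 \<in> wts l1"
  shows "(\<Sum>m\<in>wts l1. g (m - 1)) = (\<Sum>m\<in>wts l1. g m)"
proof -
  have "m \<in> wts l1" "m + 1 \<in> wts l1" if "g m \<noteq> 0" for m using assms[OF that] by auto
  then show ?thesis
    by (intro sum.reindex_bij_witness_not_neutral[where i = "\<lambda>m. m + 1" and j = "\<lambda>m. m - 1"
      and S' = "{m \<in> wts l1. g (m - 1) = 0}" and T' = "{m \<in> wts l1. g m = 0}"])
      (auto simp: finite_wts)
qed

text \<open>The radial part of \<open>e\<^sub>1 f\<^sub>1\<close>. With \<open>A\<close> the torus action, \<open>A e\<^sub>1 = q e\<^sub>1 A\<close> and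
  \<open>A e\<^sub>2 = q\<^sup>-\<^sup>1 e\<^sub>2 A\<close>, whereas \<open>e\<^sub>1 + e\<^sub>2\<close> commutes past \<open>\<beta>\<close> and past its adjoint. These are two linear
  equations for \<open>\<beta>\<^sup>* e\<^sub>1 A \<beta>\<close> and \<open>\<beta>\<^sup>* e\<^sub>2 A \<beta>\<close>, and they express both through the spherical
  function \<open>\<beta>\<^sup>* A \<beta>\<close>. Applying the same step to \<open>f\<^sub>1\<close> expresses \<open>\<beta>\<^sup>* e\<^sub>1 f\<^sub>1 A \<beta>\<close>. That operator is
  diagonal, which is the left-hand side.\<close>

lemma casimir_first:
  fixes t p :: real
  assumes p: "p \<in> wts l"
  defines "q \<equiv> exp (2 * \<i> * t)"
  defines "k \<equiv> q - inverse q"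
  shows "k\<^sup>2 * mom (\<lambda>m n. (l1 + m) * (l1 - m + 1)) t p =
    - ((l + p) * (l - p + 1) * (mom (\<lambda>m n. 1) t p - mom (\<lambda>m n. 1) t (p - 1) / q))
    + q * ((l - p) * (l + p + 1) * (mom (\<lambda>m n. 1) t (p + 1) - mom (\<lambda>m n. 1) t p / q))
    + q * k * mom (\<lambda>m n. 2 * m) t p"
proof -
  define y where "y = (\<lambda>m n. cnj (x m n))"
  define E where "E = (\<lambda>(m::real) (n::real). exp (2 * \<i> * t * (m - n)))"
  define F where "F = mom (\<lambda>m n. 1) t"
  define W where "W = wts l1"
  have q0: "q \<noteq> 0" by (simp add: q_def)
  have E1: "E (m - 1) n = E m n / q" and E2: "E m (n + 1) = E m n / q"
    and E3: "E m (n - 1) = E m n * q" for m n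
    by (simp_all add: E_def q_def flip: exp_diff exp_add, simp_all add: algebra_simps)
  have mom: "mom g t p = (\<Sum>m\<in>W. g m (p - m) * (y m (p - m) * x m (p - m) * E m (p - m)))" for g p
    unfolding mom_def W_def by (rule sum.cong) (auto simp: y_def E_def)
  have y0: "y m n = 0 \<longleftrightarrow> x m n = 0" for m n by (simp add: y_def)
  have raise_y: "cnj (a (m + n - 1)) * y m n = cnj (a1 (m - 1)) * y (m - 1) n + cnj (a2 (n - 1)) * y m (n - 1)"
    for m n using arg_cong[OF raise[of m n], of cnj] by (simp add: y_def)
  have lower_y: "a (m + n) * y m n = a1 m * y (m + 1) n + a2 n * y m (n + 1)"
    for m n using arg_cong[OF lower[of m n], of cnj] by (simp add: y_def)
  \<comment> \<open>the matrix entries of \<open>\<beta>\<^sup>* e\<^sub>1 A \<beta>\<close> and \<open>\<beta>\<^sup>* e\<^sub>2 A \<beta>\<close> from weight \<open>p\<close> to weight \<open>p + 1\<close>\<close>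
  define G where "G = (\<lambda>p. \<Sum>m\<in>W. y m (p + 1 - m) * a1 (m - 1) * E (m - 1) (p + 1 - m) * x (m - 1) (p + 1 - m))"
  define G' where "G' = (\<lambda>p. \<Sum>m\<in>W. y m (p + 1 - m) * a2 (p - m) * E m (p - m) * x m (p - m))"
  have G1: "q * G p + G' p / q = a p * F (p + 1)" for p
  proof -
    have "q * (y m (p + 1 - m) * a1 (m - 1) * E (m - 1) (p + 1 - m) * x (m - 1) (p + 1 - m))
        + y m (p + 1 - m) * a2 (p - m) * E m (p - m) * x m (p - m) / q
        = a p * (y m (p + 1 - m) * x m (p + 1 - m) * E m (p + 1 - m))" for m
    proof -
      have 1: "E m (p + 1 - m) = E m (p - m) / q" using E2[of m "p - m"] by (simp add: algebra_simps)
      have 2: "E (m - 1) (p + 1 - m) = E m (p - m) / (q * q)" using E1 1 by simp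
      have 3: "a p * x m (p + 1 - m) = a1 (m - 1) * x (m - 1) (p + 1 - m) + a2 (p - m) * x m (p - m)"
        using raise[of m "p + 1 - m"] by simp
      have "q * (y m (p + 1 - m) * a1 (m - 1) * E (m - 1) (p + 1 - m) * x (m - 1) (p + 1 - m))
        + y m (p + 1 - m) * a2 (p - m) * E m (p - m) * x m (p - m) / q
        = y m (p + 1 - m) * (E m (p - m) / q) * (a1 (m - 1) * x (m - 1) (p + 1 - m) + a2 (p - m) * x m (p - m))"
        unfolding 2 using q0 by (simp add: field_simps)
      then show ?thesis unfolding 3[symmetric] 1 by (simp add: mult_ac)
    qed
    then show ?thesis
      unfolding F_def mom G_def G'_def
      by (simp add: sum_distrib_left sum_divide_distrib flip: sum.distrib)
  qed
  have shiftG: "G p = (\<Sum>m\<in>W. y (m + 1) (p - m) * a1 m * E m (p - m) * x m (p - m))" for p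
  proof -
    have "G p = (\<Sum>m\<in>W. (\<lambda>m. y (m + 1) (p - m) * a1 m * E m (p - m) * x m (p - m)) (m - 1))"
      unfolding G_def by (rule sum.cong) (auto simp: algebra_simps)
    also have "\<dots> = (\<Sum>m\<in>W. y (m + 1) (p - m) * a1 m * E m (p - m) * x m (p - m))"
      unfolding W_def by (rule sum_shift) (use support y0 in auto)
    finally show ?thesis .
  qed
  have G2: "G p + G' p = a p * F p" for p
  proof -
    have "y (m + 1) (p - m) * a1 m * E m (p - m) * x m (p - m)
        + y m (p + 1 - m) * a2 (p - m) * E m (p - m) * x m (p - m)
        = a p * (y m (p - m) * x m (p - m) * E m (p - m))" for m
    proof -
      have "a p * y m (p - m) = a1 m * y (m + 1) (p - m) + a2 (p - m) * y m (p + 1 - m)"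
        using lower_y[of m "p - m"] by (simp add: algebra_simps)
      then show ?thesis by algebra
    qed
    then show ?thesis
      unfolding F_def mom shiftG G'_def
      by (simp add: sum_distrib_left flip: sum.distrib)
  qed
  \<comment> \<open>solving the two linear equations for the first unknown\<close>
  have kG: "k * G p = a p * (F (p + 1) - F p / q)" for p
  proof -
    have G': "G' p = a p * F p - G p" using G2[of p] by (simp add: algebra_simps)
    show ?thesis using G1[of p] unfolding G'
      by (simp add: k_def inverse_eq_divide diff_divide_distrib algebra_simps)
  qed
  \<comment> \<open>the diagonal entries of \<open>\<beta>\<^sup>* e\<^sub>1 f\<^sub>1 A \<beta>\<close> and \<open>\<beta>\<^sup>* f\<^sub>1 e\<^sub>1 A \<beta>\<close>, and the mixed term
    \<open>\<beta>\<^sup>* e\<^sub>1 f\<^sub>2 A \<beta>\<close>, which cancels in the end\<close>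
  define H where "H = (\<Sum>m\<in>W. a1 (m - 1) * cnj (a1 (m - 1)) * (y m (p - m) * x m (p - m) * E m (p - m)))"
  define H' where "H' = (\<Sum>m\<in>W. a1 m * cnj (a1 m) * (y m (p - m) * x m (p - m) * E m (p - m)))"
  define K where "K = (\<Sum>m\<in>W. y m (p - m) * a1 (m - 1) * cnj (a2 (p - m)) * E (m - 1) (p + 1 - m) * x (m - 1) (p + 1 - m))"
  have HK: "- k * H = cnj (a (p - 1)) * G (p - 1) - q * (H + K)"
  proof -
    have "- k * (a1 (m - 1) * cnj (a1 (m - 1)) * (y m (p - m) * x m (p - m) * E m (p - m)))
       = cnj (a (p - 1)) * (y m (p - m) * a1 (m - 1) * E (m - 1) (p - m) * x (m - 1) (p - m))
       - q * (a1 (m - 1) * cnj (a1 (m - 1)) * (y m (p - m) * x m (p - m) * E m (p - m))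
           + y m (p - m) * a1 (m - 1) * cnj (a2 (p - m)) * E (m - 1) (p + 1 - m) * x (m - 1) (p + 1 - m))" for m
    proof -
      have 1: "E (m - 1) (p - m) = E m (p - m) / q" by (rule E1)
      have 2: "E (m - 1) (p + 1 - m) = E m (p - m) / (q * q)"
        using E2[of "m - 1" "p - m"] E1[of m "p - m"] by (simp add: algebra_simps)
      have 3: "cnj (a (p - 1)) * x (m - 1) (p - m)
          = cnj (a1 (m - 1)) * x m (p - m) + cnj (a2 (p - m)) * x (m - 1) (p + 1 - m)"
        using lower[of "m - 1" "p - m"] by (simp add: algebra_simps)
      have "cnj (a (p - 1)) * (y m (p - m) * a1 (m - 1) * E (m - 1) (p - m) * x (m - 1) (p - m))
          = y m (p - m) * a1 (m - 1) * (E m (p - m) / q) * (cnj (a (p - 1)) * x (m - 1) (p - m))"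
        unfolding 1 by (simp add: mult_ac)
      then show ?thesis unfolding 2 3 k_def using q0 by (simp add: field_simps)
    qed
    then show ?thesis
      unfolding H_def G_def K_def
      by (simp only: sum_distrib_left sum.distrib[symmetric] sum_subtractf[symmetric]) simp
  qed
  have HK': "cnj (a p) * G p = H' + K"
  proof -
    have "cnj (a p) * (y m (p + 1 - m) * a1 (m - 1) * E (m - 1) (p + 1 - m) * x (m - 1) (p + 1 - m))
      = a1 (m - 1) * cnj (a1 (m - 1)) * (y (m - 1) (p - (m - 1)) * x (m - 1) (p - (m - 1)) * E (m - 1) (p - (m - 1)))
      + y m (p - m) * a1 (m - 1) * cnj (a2 (p - m)) * E (m - 1) (p + 1 - m) * x (m - 1) (p + 1 - m)" for m
    proof -
      have 1: "p - (m - 1) = p + 1 - m" by simp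
      have "cnj (a p) * y m (p + 1 - m) = cnj (a1 (m - 1)) * y (m - 1) (p + 1 - m) + cnj (a2 (p - m)) * y m (p - m)"
        using raise_y[of m "p + 1 - m"] by simp
      then show ?thesis unfolding 1 by algebra
    qed
    then have "cnj (a p) * G p = (\<Sum>m\<in>W. (\<lambda>m. a1 m * cnj (a1 m) * (y m (p - m) * x m (p - m) * E m (p - m))) (m - 1)) + K"
      unfolding G_def K_def by (simp add: sum_distrib_left flip: sum.distrib)
    also have "(\<Sum>m\<in>W. (\<lambda>m. a1 m * cnj (a1 m) * (y m (p - m) * x m (p - m) * E m (p - m))) (m - 1)) = H'"
      unfolding H'_def W_def
    proof (rule sum_shift)
      fix m assume *: "a1 m * cnj (a1 m) * (y m (p - m) * x m (p - m) * E m (p - m)) \<noteq> 0"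
      then have m: "m \<in> wts l1" using support by auto
      have "a1 m * cnj (a1 m) \<noteq> 0" using * by auto
      then show "m \<in> wts l1 \<and> m + 1 \<in> wts l1" using m a1_raises by simp
    qed
    finally show ?thesis .
  qed
  have MH: "H = mom (\<lambda>m n. (l1 + m) * (l1 - m + 1)) t p"
    unfolding mom H_def by (rule sum.cong) (auto simp: norm1 W_def)
  have "H - H' = mom (\<lambda>m n. 2 * m) t p"
    unfolding mom H_def H'_def sum_subtractf[symmetric]
    by (rule sum.cong) (auto simp: norm1 W_def algebra_simps)
  then have "- k * H = cnj (a (p - 1)) * G (p - 1) - q * (mom (\<lambda>m n. 2 * m) t p + cnj (a p) * G p)"
    using HK HK' by (simp add: algebra_simps)
  then have "- k * (k * H) = cnj (a (p - 1)) * (k * G (p - 1))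
      - q * (k * mom (\<lambda>m n. 2 * m) t p + cnj (a p) * (k * G p))"
    by algebra
  then have "k\<^sup>2 * H = - ((a (p - 1) * cnj (a (p - 1))) * (F p - F (p - 1) / q))
     + q * ((a p * cnj (a p)) * (F (p + 1) - F p / q)) + q * k * mom (\<lambda>m n. 2 * m) t p"
    unfolding kG by (simp add: algebra_simps power2_eq_square)
  then show ?thesis unfolding norm[OF p] MH F_def .
qed

definition F :: "real \<Rightarrow> real \<Rightarrow> complex"
  where "F = mom (\<lambda>m n. 1)"

text \<open>The derivations \<open>w d/dw = - \<i> d/dt\<close> and its square act on the spherical function by inserting the
  weight \<open>2 (m - n)\<close> of the torus and its square.\<close>

definition DF :: "real \<Rightarrow> real \<Rightarrow> complex"
  where "DF = mom (\<lambda>m n. 2 * (m - n))"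

definition D2F :: "real \<Rightarrow> real \<Rightarrow> complex"
  where "D2F = mom (\<lambda>m n. 2 * (m - n) * (2 * (m - n)))"

lemma F_deriv: "((\<lambda>t. F t p) has_vector_derivative \<i> * DF t p) (at t)"
  using mom_has_vector_derivative[of "\<lambda>m n. 1"] by (simp add: F_def DF_def)

lemma DF_deriv: "((\<lambda>t. DF t p) has_vector_derivative \<i> * D2F t p) (at t)"
  using mom_has_vector_derivative[of "\<lambda>m n. 2 * (m - n)"] by (simp add: DF_def D2F_def)

lemma F_outside: "(\<And>m n. x m n \<noteq> 0 \<Longrightarrow> m + n \<noteq> p) \<Longrightarrow> F t p = 0"
  unfolding F_def mom_def by (rule sum.neutral) force

text \<open>The sum and the difference of the identities for the two Casimir elements. In the difference the
  second-order parts cancel, which is why \<open>Delta\<close> is of first order.\<close>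

lemma radial:
  fixes t p :: real and q k c \<alpha> \<alpha>' :: complex
  assumes p: "p \<in> wts l"
  defines "q \<equiv> exp (2 * \<i> * t)"
  defines "k \<equiv> q - inverse q" and "c \<equiv> q + inverse q"
  defines "\<alpha> \<equiv> complex_of_real ((l + p) * (l - p + 1))" and "\<alpha>' \<equiv> complex_of_real ((l - p) * (l + p + 1))"
  shows "k\<^sup>2 * ((l1 * (l1 + 1) + l2 * (l2 + 1)) * F t p - p\<^sup>2 / 2 * F t p - D2F t p / 8) =
      \<alpha> * (c * F t (p - 1) - 2 * F t p) + \<alpha>' * (c * F t (p + 1) - 2 * F t p) + k * c * DF t p / 2"
    and "k\<^sup>2 * ((l1 * (l1 + 1) - l2 * (l2 + 1)) * F t p - p / 2 * DF t p) =
      k * (\<alpha>' * F t (p + 1) - \<alpha> * F t (p - 1) + c * p * F t p)"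
proof -
  define M1 where "M1 = mom (\<lambda>m n. complex_of_real m) t p"
  define M2 where "M2 = mom (\<lambda>m n. complex_of_real (m * m)) t p"
  have q0: "q \<noteq> 0" by (simp add: q_def)
  interpret sw: clebsch_gordan l l2 l1 a a2 a1 "\<lambda>m n. x n m" by (rule swap)
  have lin: "mom (\<lambda>m n. of_real (u + v * m + w * (m * m))) t p = u * F t p + v * M1 + w * M2"
    for u v w :: real
    unfolding F_def M1_def M2_def mom_def sum_distrib_left sum.distrib[symmetric]
    by (rule sum.cong) (auto simp: algebra_simps)
  have F_swap: "sw.mom (\<lambda>m n. 1) (- t) p' = F t p'" for p'
    by (simp add: mom_swap F_def)
  have DF: "DF t p = 4 * M1 - 2 * p * F t p"
  proof -
    have "DF t p = mom (\<lambda>m n. of_real (- 2 * p + 4 * m + 0 * (m * m))) t p"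
      unfolding DF_def by (rule mom_cong) (auto simp: algebra_simps)
    then show ?thesis unfolding lin by (simp add: algebra_simps)
  qed
  have D2F: "D2F t p = 16 * M2 - 16 * p * M1 + 4 * p\<^sup>2 * F t p"
  proof -
    have "D2F t p = mom (\<lambda>m n. of_real (4 * p\<^sup>2 + (- 16 * p) * m + 16 * (m * m))) t p"
      unfolding D2F_def by (rule mom_cong) (auto simp: algebra_simps power2_eq_square)
    then show ?thesis unfolding lin by (simp add: algebra_simps)
  qed
  have 1: "k\<^sup>2 * (l1 * (l1 + 1) * F t p + M1 - M2) =
    - (\<alpha> * (F t p - F t (p - 1) / q)) + q * (\<alpha>' * (F t (p + 1) - F t p / q)) + q * k * (2 * M1)"
  proof -
    have "mom (\<lambda>m n. complex_of_real ((l1 + m) * (l1 - m + 1))) t p =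
        mom (\<lambda>m n. of_real (l1 * (l1 + 1) + 1 * m + (- 1) * (m * m))) t p"
      by (rule mom_cong) (auto simp: algebra_simps)
    moreover have "mom (\<lambda>m n. complex_of_real (2 * m)) t p = 2 * M1"
      using lin[of 0 2 0] by simp
    ultimately show ?thesis
      using casimir_first[OF p, of t] unfolding lin
      by (simp add: F_def \<alpha>_def \<alpha>'_def k_def q_def)
  qed
  have 2: "k\<^sup>2 * (l2 * (l2 + 1) * F t p + (p * F t p - M1) - (p\<^sup>2 * F t p - 2 * p * M1 + M2)) =
    - (\<alpha> * (F t p - F t (p - 1) * q)) + inverse q * (\<alpha>' * (F t (p + 1) - F t p * q))
     - inverse q * k * (2 * (p * F t p - M1))"
  proof -
    have "sw.mom (\<lambda>m n. complex_of_real ((l2 + m) * (l2 - m + 1))) (- t) p =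
        mom (\<lambda>m n. of_real (l2 * (l2 + 1) + p - p\<^sup>2 + (2 * p - 1) * m + (- 1) * (m * m))) t p"
      unfolding mom_swap by (rule mom_cong) (auto simp: algebra_simps power2_eq_square)
    then have s1: "sw.mom (\<lambda>m n. complex_of_real ((l2 + m) * (l2 - m + 1))) (- t) p =
        l2 * (l2 + 1) * F t p + (p * F t p - M1) - (p\<^sup>2 * F t p - 2 * p * M1 + M2)"
      unfolding lin by (simp add: algebra_simps)
    have s2: "sw.mom (\<lambda>m n. complex_of_real (2 * m)) (- t) p = 2 * (p * F t p - M1)"
    proof -
      have "sw.mom (\<lambda>m n. complex_of_real (2 * m)) (- t) p
          = mom (\<lambda>m n. of_real (2 * p + (- 2) * m + 0 * (m * m))) t p"
        unfolding mom_swap by (rule mom_cong) (auto simp: algebra_simps)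
      then show ?thesis unfolding lin by (simp add: algebra_simps)
    qed
    have ex: "exp (2 * \<i> * complex_of_real (- t)) = inverse q"
      by (simp add: q_def exp_minus)
    have k: "inverse q - q = - k" by (simp add: k_def)
    show ?thesis
      using sw.casimir_first[OF p, of "- t"] unfolding s1 s2 F_swap ex inverse_inverse_eq k
      by (simp add: \<alpha>_def \<alpha>'_def divide_inverse)
  qed
  have c1: "k\<^sup>2 * (l1 * (l1 + 1) * F t p + M1 - M2) =
    \<alpha> * (inverse q * F t (p - 1) - F t p) + \<alpha>' * (q * F t (p + 1) - F t p) + q * k * (2 * M1)"
    unfolding 1 using q0 by (simp add: field_simps)
  have c2: "k\<^sup>2 * (l2 * (l2 + 1) * F t p + (p * F t p - M1) - (p\<^sup>2 * F t p - 2 * p * M1 + M2)) =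
    \<alpha> * (q * F t (p - 1) - F t p) + \<alpha>' * (inverse q * F t (p + 1) - F t p)
     - inverse q * k * (2 * (p * F t p - M1))"
    unfolding 2 using q0 by (simp add: field_simps)
  have M1: "M1 = DF t p / 4 + p * F t p / 2" unfolding DF by (simp add: field_simps)
  have M2: "M2 = D2F t p / 16 + p * M1 - p\<^sup>2 * F t p / 4" unfolding D2F by (simp add: field_simps)
  show "k\<^sup>2 * ((l1 * (l1 + 1) + l2 * (l2 + 1)) * F t p - p\<^sup>2 / 2 * F t p - D2F t p / 8) =
      \<alpha> * (c * F t (p - 1) - 2 * F t p) + \<alpha>' * (c * F t (p + 1) - 2 * F t p) + k * c * DF t p / 2" (is "?lhs = ?rhs")
  proof -
    have "?lhs = k\<^sup>2 * (l1 * (l1 + 1) * F t p + M1 - M2)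
        + k\<^sup>2 * (l2 * (l2 + 1) * F t p + (p * F t p - M1) - (p\<^sup>2 * F t p - 2 * p * M1 + M2))
        - k\<^sup>2 * p * F t p"
      unfolding M2 M1 by (simp add: algebra_simps add_divide_distrib diff_divide_distrib power2_eq_square)
    also have "\<dots> = ?rhs"
      unfolding c1 c2 unfolding M1 c_def k_def
      by (simp add: algebra_simps add_divide_distrib diff_divide_distrib power2_eq_square)
    finally show ?thesis .
  qed
  show "k\<^sup>2 * ((l1 * (l1 + 1) - l2 * (l2 + 1)) * F t p - p / 2 * DF t p) =
      k * (\<alpha>' * F t (p + 1) - \<alpha> * F t (p - 1) + c * p * F t p)" (is "?lhs = ?rhs")
  proof -
    have "?lhs = k\<^sup>2 * (l1 * (l1 + 1) * F t p + M1 - M2)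
        - k\<^sup>2 * (l2 * (l2 + 1) * F t p + (p * F t p - M1) - (p\<^sup>2 * F t p - 2 * p * M1 + M2))
        - k\<^sup>2 * DF t p / 2"
      unfolding M2 M1 by (simp add: algebra_simps add_divide_distrib diff_divide_distrib power2_eq_square)
    also have "\<dots> = ?rhs"
      unfolding c1 c2 unfolding M1 c_def k_def
      by (simp add: algebra_simps add_divide_distrib diff_divide_distrib power2_eq_square)
    finally show ?thesis .
  qed
qed

end

section \<open>Clebsch-Gordan coefficients of an equivariant isometry\<close>

locale isometry_setting =
  V: spin_representation l "T l" + V1: spin_representation l1 "T l1" + V2: spin_representation l2 "T l2"
  for l l1 l2 :: real and T :: "real \<Rightarrow> complex^2^2 \<Rightarrow> real \<Rightarrow> real \<Rightarrow> complex" +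
  fixes \<beta> :: "real \<times> real \<Rightarrow> real \<Rightarrow> complex"
  assumes equivariant: "equivariant_isometry T l (l1, l2) \<beta>"
begin

lemma wts2_eq: "wts2 (l1, l2) = wts l1 \<times> wts l2"
  by (simp add: wts2_def)

lemma intertwines:
  assumes "k \<in> SU2" "m \<in> wts l1" "n \<in> wts l2" "p \<in> wts l"
  shows "(\<Sum>m'\<in>wts l1. \<Sum>n'\<in>wts l2. T l1 k m m' * T l2 k n n' * \<beta> (m', n') p)
    = (\<Sum>r\<in>wts l. \<beta> (m, n) r * T l k r p)"
proof -
  have "mmul (wts2 (l1, l2)) (tensor_rep T (l1, l2) (k, k)) \<beta> (m, n) p = mmul (wts l) \<beta> (T l k) (m, n) p"
    using equivariant assms by (auto simp: equivariant_isometry_def meq_def wts2_eq)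
  then show ?thesis
    by (simp add: mmul_def wts2_eq sum.cartesian_product tensor_rep_def case_prod_beta)
qed

lemma isometric:
  assumes "p \<in> wts l"
  shows "(\<Sum>m\<in>wts l1. \<Sum>n\<in>wts l2. cnj (\<beta> (m, n) p) * \<beta> (m, n) p) = 1"
proof -
  have "mmul (wts2 (l1, l2)) (madj \<beta>) \<beta> p p = 1"
    using equivariant assms by (auto simp: equivariant_isometry_def meq_def kd_def)
  then show ?thesis
    by (simp add: mmul_def madj_def wts2_eq sum.cartesian_product case_prod_beta)
qed

text \<open>Equivariance under the torus.\<close>

lemma weight_preserving:
  assumes "m \<in> wts l1" "n \<in> wts l2" "p \<in> wts l" "\<beta> (m, n) p \<noteq> 0"
  shows "p = m + n"
proof (rule ccontr)
  assume "p \<noteq> m + n"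
  moreover have "exp (2 * \<i> * (m + n) * s) * \<beta> (m, n) p = exp (2 * \<i> * p * s) * \<beta> (m, n) p" for s :: real
  proof -
    let ?k = "dg (exp (\<i> * s))"
    have "(\<Sum>m'\<in>wts l1. \<Sum>n'\<in>wts l2. T l1 ?k m m' * T l2 ?k n n' * \<beta> (m', n') p)
      = mmul (wts l1) (T l1 ?k) (\<lambda>m' p. mmul (wts l2) (T l2 ?k) (\<lambda>n' p. \<beta> (m', n') p) n p) m p"
      by (simp add: mmul_def sum_distrib_left mult.assoc)
    also have "\<dots> = exp (2 * \<i> * m * s) * (exp (2 * \<i> * n * s) * \<beta> (m, n) p)"
      using assms by (simp add: V1.mmul_torus_left V2.mmul_torus_left)
    finally have "(\<Sum>m'\<in>wts l1. \<Sum>n'\<in>wts l2. T l1 ?k m m' * T l2 ?k n n' * \<beta> (m', n') p)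
      = exp (2 * \<i> * (m + n) * s) * \<beta> (m, n) p"
      by (simp add: algebra_simps exp_add)
    moreover have "(\<Sum>r\<in>wts l. \<beta> (m, n) r * T l ?k r p) = exp (2 * \<i> * p * s) * \<beta> (m, n) p"
      using V.mmul_torus_right[of p \<beta> s "(m, n)"] assms by (simp add: mmul_def mult.commute)
    ultimately show ?thesis using intertwines[OF dg_SU2 assms(1-3), of s] by metis
  qed
  ultimately show False using phase_separates[of "m + n" "\<beta> (m, n) p" p] assms by auto
qed

definition x :: "real \<Rightarrow> real \<Rightarrow> complex"
  where "x m n = (if m \<in> wts l1 \<and> n \<in> wts l2 \<and> m + n \<in> wts l then \<beta> (m, n) (m + n) else 0)"

lemma beta_eq_x:
  assumes "m \<in> wts l1" "n \<in> wts l2" "p \<in> wts l"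
  shows "\<beta> (m, n) p = (if p = m + n then x m n else 0)"
  using weight_preserving[OF assms] assms by (auto simp: x_def)

text \<open>The matrix of \<open>e - f\<close> in terms of the ladder coefficients.\<close>

definition gen :: "(real \<Rightarrow> complex) \<Rightarrow> real \<Rightarrow> real \<Rightarrow> complex"
  where "gen a p q = (if p = q + 1 then a q else if q = p + 1 then - cnj (a p) else 0)"

text \<open>The derivative at \<open>s = 0\<close> of equivariance under \<open>rot s\<close>. Its components of weight \<open>+ 1\<close> and
  \<open>- 1\<close> are the intertwining relations for \<open>e\<close> and for \<open>f\<close>.\<close>

lemma intertwines_gen:
  assumes "m \<in> wts l1" "n \<in> wts l2" "p \<in> wts l"
  shows "(\<Sum>m'\<in>wts l1. gen V1.ladder m m' * \<beta> (m', n) p) + (\<Sum>n'\<in>wts l2. gen V2.ladder n n' * \<beta> (m, n') p)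
    = (\<Sum>r\<in>wts l. \<beta> (m, n) r * gen V.ladder r p)"
proof -
  let ?W1 = "wts l1" and ?W2 = "wts l2"
  let ?r = "\<lambda>s::real. rot (of_real s)"
  have "((\<lambda>s. \<Sum>m'\<in>?W1. \<Sum>n'\<in>?W2. (T l1 (?r s) m m' * T l2 (?r s) n n') * \<beta> (m', n') p) has_vector_derivative
      (\<Sum>m'\<in>?W1. \<Sum>n'\<in>?W2. (T l1 (?r 0) m m' * gen V2.ladder n n' + gen V1.ladder m m' * T l2 (?r 0) n n') * \<beta> (m', n') p)) (at 0)"
    unfolding gen_def
    by (intro has_vector_derivative_sum has_vector_derivative_mult_left has_vector_derivative_mult
        V1.T_rot_ladder V2.T_rot_ladder assms)
  moreover have "((\<lambda>s. \<Sum>r\<in>wts l. \<beta> (m, n) r * T l (?r s) r p) has_vector_derivative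
      (\<Sum>r\<in>wts l. \<beta> (m, n) r * gen V.ladder r p)) (at 0)"
    unfolding gen_def
    by (intro has_vector_derivative_sum has_vector_derivative_mult_right V.T_rot_ladder assms)
  ultimately have "(\<Sum>m'\<in>?W1. \<Sum>n'\<in>?W2. (T l1 (?r 0) m m' * gen V2.ladder n n' + gen V1.ladder m m' * T l2 (?r 0) n n') * \<beta> (m', n') p)
     = (\<Sum>r\<in>wts l. \<beta> (m, n) r * gen V.ladder r p)"
    unfolding intertwines[OF rot_SU2 assms] by (rule vector_derivative_unique_at)
  moreover have "(\<Sum>m'\<in>?W1. \<Sum>n'\<in>?W2. T l1 (?r 0) m m' * gen V2.ladder n n' * \<beta> (m', n') p)
      = (\<Sum>n'\<in>?W2. gen V2.ladder n n' * \<beta> (m, n') p)"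
  proof -
    have "(\<Sum>m'\<in>?W1. \<Sum>n'\<in>?W2. T l1 (?r 0) m m' * gen V2.ladder n n' * \<beta> (m', n') p)
        = (\<Sum>m'\<in>?W1. if m = m' then (\<Sum>n'\<in>?W2. gen V2.ladder n n' * \<beta> (m', n') p) else 0)"
      by (rule sum.cong) (use assms in \<open>auto simp: rot_0 V1.T_one kd_def\<close>)
    then show ?thesis using assms by (simp add: finite_wts)
  qed
  moreover have "(\<Sum>m'\<in>?W1. \<Sum>n'\<in>?W2. gen V1.ladder m m' * T l2 (?r 0) n n' * \<beta> (m', n') p)
      = (\<Sum>m'\<in>?W1. gen V1.ladder m m' * \<beta> (m', n) p)"
  proof (rule sum.cong[OF refl])
    fix m' assume "m' \<in> ?W1"
    have "(\<Sum>n'\<in>?W2. gen V1.ladder m m' * T l2 (?r 0) n n' * \<beta> (m', n') p)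
        = (\<Sum>n'\<in>?W2. if n = n' then gen V1.ladder m m' * \<beta> (m', n') p else 0)"
      by (rule sum.cong) (use assms in \<open>auto simp: rot_0 V2.T_one kd_def\<close>)
    then show "(\<Sum>n'\<in>?W2. gen V1.ladder m m' * T l2 (?r 0) n n' * \<beta> (m', n') p)
        = gen V1.ladder m m' * \<beta> (m', n) p" using assms by (simp add: finite_wts)
  qed
  ultimately show ?thesis by (simp add: distrib_right sum.distrib add.commute)
qed

lemma raise_x: "V.ladder (m + n - 1) * x m n = V1.ladder (m - 1) * x (m - 1) n + V2.ladder (n - 1) * x m (n - 1)"
proof (cases "m \<in> wts l1 \<and> n \<in> wts l2 \<and> m + n - 1 \<in> wts l")
  case True
  then have mn: "m \<in> wts l1" "n \<in> wts l2" and p: "m + n - 1 \<in> wts l" by auto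
  have "(\<Sum>m'\<in>wts l1. gen V1.ladder m m' * \<beta> (m', n) (m + n - 1))
      = (\<Sum>m'\<in>wts l1. if m' = m - 1 then V1.ladder (m - 1) * x (m - 1) n else 0)"
    by (rule sum.cong) (use mn p in \<open>auto simp: beta_eq_x gen_def\<close>)
  also have "\<dots> = V1.ladder (m - 1) * x (m - 1) n"
    using V1.ladder_support[of "m - 1"] by (auto simp: finite_wts)
  finally have 1: "(\<Sum>m'\<in>wts l1. gen V1.ladder m m' * \<beta> (m', n) (m + n - 1)) = \<dots>" .
  have "(\<Sum>n'\<in>wts l2. gen V2.ladder n n' * \<beta> (m, n') (m + n - 1))
      = (\<Sum>n'\<in>wts l2. if n' = n - 1 then V2.ladder (n - 1) * x m (n - 1) else 0)"
    by (rule sum.cong) (use mn p in \<open>auto simp: beta_eq_x gen_def\<close>)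
  also have "\<dots> = V2.ladder (n - 1) * x m (n - 1)"
    using V2.ladder_support[of "n - 1"] by (auto simp: finite_wts)
  finally have 2: "(\<Sum>n'\<in>wts l2. gen V2.ladder n n' * \<beta> (m, n') (m + n - 1)) = \<dots>" .
  have "(\<Sum>r\<in>wts l. \<beta> (m, n) r * gen V.ladder r (m + n - 1))
      = (\<Sum>r\<in>wts l. if r = m + n then V.ladder (m + n - 1) * x m n else 0)"
    by (rule sum.cong) (use mn in \<open>auto simp: beta_eq_x gen_def\<close>)
  also have "\<dots> = V.ladder (m + n - 1) * x m n"
    using V.ladder_support[of "m + n - 1"] by (auto simp: finite_wts)
  finally have 3: "(\<Sum>r\<in>wts l. \<beta> (m, n) r * gen V.ladder r (m + n - 1)) = \<dots>" .
  show ?thesis using intertwines_gen[OF mn p] unfolding 1 2 3 by simp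
next
  case False
  have z1: "V.ladder (m + n - 1) * x m n = 0"
    using False V.ladder_support[of "m + n - 1"] by (auto simp: x_def)
  have z2: "V1.ladder (m - 1) * x (m - 1) n = 0"
    using False V1.ladder_support[of "m - 1"] by (auto simp: x_def algebra_simps)
  have z3: "V2.ladder (n - 1) * x m (n - 1) = 0"
    using False V2.ladder_support[of "n - 1"] by (auto simp: x_def algebra_simps)
  show ?thesis unfolding z1 z2 z3 by simp
qed

lemma lower_x: "cnj (V.ladder (m + n)) * x m n = cnj (V1.ladder m) * x (m + 1) n + cnj (V2.ladder n) * x m (n + 1)"
proof (cases "m \<in> wts l1 \<and> n \<in> wts l2 \<and> m + n + 1 \<in> wts l")
  case True
  then have mn: "m \<in> wts l1" "n \<in> wts l2" and p: "m + n + 1 \<in> wts l" by auto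
  have "(\<Sum>m'\<in>wts l1. gen V1.ladder m m' * \<beta> (m', n) (m + n + 1))
      = (\<Sum>m'\<in>wts l1. if m' = m + 1 then - cnj (V1.ladder m) * x (m + 1) n else 0)"
    by (rule sum.cong) (use mn p in \<open>auto simp: beta_eq_x gen_def\<close>)
  also have "\<dots> = - cnj (V1.ladder m) * x (m + 1) n"
    using V1.ladder_support[of m] by (auto simp: finite_wts)
  finally have 1: "(\<Sum>m'\<in>wts l1. gen V1.ladder m m' * \<beta> (m', n) (m + n + 1)) = \<dots>" .
  have "(\<Sum>n'\<in>wts l2. gen V2.ladder n n' * \<beta> (m, n') (m + n + 1))
      = (\<Sum>n'\<in>wts l2. if n' = n + 1 then - cnj (V2.ladder n) * x m (n + 1) else 0)"
    by (rule sum.cong) (use mn p in \<open>auto simp: beta_eq_x gen_def\<close>)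
  also have "\<dots> = - cnj (V2.ladder n) * x m (n + 1)"
    using V2.ladder_support[of n] by (auto simp: finite_wts)
  finally have 2: "(\<Sum>n'\<in>wts l2. gen V2.ladder n n' * \<beta> (m, n') (m + n + 1)) = \<dots>" .
  have "(\<Sum>r\<in>wts l. \<beta> (m, n) r * gen V.ladder r (m + n + 1))
      = (\<Sum>r\<in>wts l. if r = m + n then - cnj (V.ladder (m + n)) * x m n else 0)"
    by (rule sum.cong) (use mn in \<open>auto simp: beta_eq_x gen_def\<close>)
  also have "\<dots> = - cnj (V.ladder (m + n)) * x m n"
    using V.ladder_support[of "m + n"] by (auto simp: finite_wts)
  finally have 3: "(\<Sum>r\<in>wts l. \<beta> (m, n) r * gen V.ladder r (m + n + 1)) = \<dots>" .
  have "- (cnj (V1.ladder m) * x (m + 1) n) + - (cnj (V2.ladder n) * x m (n + 1)) = - (cnj (V.ladder (m + n)) * x m n)"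
    using intertwines_gen[OF mn p] unfolding 1 2 3 by simp
  then show ?thesis by algebra
next
  case False
  have z1: "cnj (V.ladder (m + n)) * x m n = 0"
    using False V.ladder_support[of "m + n"] by (auto simp: x_def)
  have z2: "cnj (V1.ladder m) * x (m + 1) n = 0"
    using False V1.ladder_support[of m] by (auto simp: x_def algebra_simps)
  have z3: "cnj (V2.ladder n) * x m (n + 1) = 0"
    using False V2.ladder_support[of n] by (auto simp: x_def algebra_simps)
  show ?thesis unfolding z1 z2 z3 by simp
qed

sublocale clebsch_gordan l l1 l2 V.ladder V1.ladder V2.ladder x
proof
  fix m n p :: real
  show "V.ladder (m + n - 1) * x m n = V1.ladder (m - 1) * x (m - 1) n + V2.ladder (n - 1) * x m (n - 1)"
    by (rule raise_x)
  show "cnj (V.ladder (m + n)) * x m n = cnj (V1.ladder m) * x (m + 1) n + cnj (V2.ladder n) * x m (n + 1)"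
    by (rule lower_x)
  show "x m n \<noteq> 0 \<Longrightarrow> m \<in> wts l1 \<and> n \<in> wts l2" by (auto simp: x_def split: if_splits)
qed (use V.ladder_norm V.ladder_norm_below V1.ladder_norm V1.ladder_norm_below V2.ladder_norm
     V2.ladder_norm_below V1.ladder_support V2.ladder_support in auto)

lemma spherical_eq_F:
  assumes "p \<in> wts l"
  shows "spherical T (l1, l2) \<beta> (torus (exp (\<i> * of_real t))) p p = F t p"
proof -
  let ?W1 = "wts l1" and ?W2 = "wts l2"
  define w where "w = exp (\<i> * of_real t)"
  have w': "inverse w = exp (\<i> * of_real (- t))" by (simp add: w_def exp_minus)
  have inner: "mmul (wts2 (l1, l2)) (tensor_rep T (l1, l2) (torus w)) \<beta> (m, n) p
      = exp (2 * \<i> * t * (m - n)) * \<beta> (m, n) p" if "m \<in> ?W1" "n \<in> ?W2" for m n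
  proof -
    have "mmul (wts2 (l1, l2)) (tensor_rep T (l1, l2) (torus w)) \<beta> (m, n) p
      = mmul ?W1 (T l1 (dg w)) (\<lambda>m' p. mmul ?W2 (T l2 (dg (inverse w))) (\<lambda>n' p. \<beta> (m', n') p) n p) m p"
      by (simp add: mmul_def wts2_eq tensor_rep_def torus_def sum_distrib_left mult.assoc
          sum.cartesian_product case_prod_beta)
    also have "\<dots> = exp (2 * \<i> * m * t) * (exp (2 * \<i> * n * (- t)) * \<beta> (m, n) p)"
      unfolding w' using that by (simp only: w_def V1.mmul_torus_left V2.mmul_torus_left)
    also have "\<dots> = exp (2 * \<i> * t * (m - n)) * \<beta> (m, n) p"
      by (simp add: algebra_simps flip: exp_add)
    finally show ?thesis .
  qed
  have "spherical T (l1, l2) \<beta> (torus w) p p = (\<Sum>a\<in>?W1 \<times> ?W2. cnj (\<beta> a p) *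
      mmul (wts2 (l1, l2)) (tensor_rep T (l1, l2) (torus w)) \<beta> a p)"
    unfolding spherical_def by (subst mmul_def) (simp add: madj_def wts2_eq)
  also have "\<dots> = (\<Sum>m\<in>?W1. \<Sum>n\<in>?W2. cnj (\<beta> (m, n) p) *
      mmul (wts2 (l1, l2)) (tensor_rep T (l1, l2) (torus w)) \<beta> (m, n) p)"
    by (simp add: sum.cartesian_product case_prod_beta)
  also have "\<dots> = (\<Sum>m\<in>?W1. \<Sum>n\<in>?W2. cnj (\<beta> (m, n) p) * (exp (2 * \<i> * t * (m - n)) * \<beta> (m, n) p))"
    by (intro sum.cong refl) (simp add: inner)
  also have "\<dots> = (\<Sum>m\<in>?W1. cnj (x m (p - m)) * x m (p - m) * exp (2 * \<i> * t * (2 * m - p)))"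
  proof (rule sum.cong[OF refl])
    fix m assume m: "m \<in> ?W1"
    have "(\<Sum>n\<in>?W2. cnj (\<beta> (m, n) p) * (exp (2 * \<i> * t * (m - n)) * \<beta> (m, n) p))
       = (\<Sum>n\<in>?W2. if n = p - m then cnj (x m (p - m)) * x m (p - m) * exp (2 * \<i> * t * (2 * m - p)) else 0)"
      by (rule sum.cong) (use m assms in \<open>auto simp: beta_eq_x\<close>)
    also have "\<dots> = cnj (x m (p - m)) * x m (p - m) * exp (2 * \<i> * t * (2 * m - p))"
      using support[of m "p - m"] by (auto simp: finite_wts)
    finally show "(\<Sum>n\<in>?W2. cnj (\<beta> (m, n) p) * (exp (2 * \<i> * t * (m - n)) * \<beta> (m, n) p))
       = cnj (x m (p - m)) * x m (p - m) * exp (2 * \<i> * t * (2 * m - p))" .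
  qed
  finally show ?thesis by (simp add: F_def mom_def w_def)
qed

text \<open>The columns of \<open>\<beta>\<close> are unit vectors, and each is supported on one weight.\<close>

lemma norm_x:
  assumes "p \<in> wts l"
  shows "(\<Sum>m\<in>wts l1. cnj (x m (p - m)) * x m (p - m)) = 1"
proof -
  have "(\<Sum>m\<in>wts l1. \<Sum>n\<in>wts l2. cnj (\<beta> (m, n) p) * \<beta> (m, n) p)
    = (\<Sum>m\<in>wts l1. cnj (x m (p - m)) * x m (p - m))"
  proof (rule sum.cong[OF refl])
    fix m assume m: "m \<in> wts l1"
    have "(\<Sum>n\<in>wts l2. cnj (\<beta> (m, n) p) * \<beta> (m, n) p)
       = (\<Sum>n\<in>wts l2. if n = p - m then cnj (x m (p - m)) * x m (p - m) else 0)"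
      by (rule sum.cong) (use m assms in \<open>auto simp: beta_eq_x\<close>)
    also have "\<dots> = cnj (x m (p - m)) * x m (p - m)"
      using support[of m "p - m"] by (auto simp: finite_wts)
    finally show "(\<Sum>n\<in>wts l2. cnj (\<beta> (m, n) p) * \<beta> (m, n) p) = cnj (x m (p - m)) * x m (p - m)" .
  qed
  then show ?thesis using isometric[OF assms] by simp
qed

lemma x_support: "x m n \<noteq> 0 \<Longrightarrow> m \<in> wts l1 \<and> n \<in> wts l2 \<and> m + n \<in> wts l"
  by (auto simp: x_def split: if_splits)

lemma F_zero: "p \<notin> wts l \<Longrightarrow> F t p = 0"
  by (rule F_outside) (use x_support in blast)

end

section \<open>Products of powers of two linear forms\<close>

text \<open>The binary form of degree \<open>n\<close> with dehomogenization \<open>f\<close>, evaluated at two polynomials. Substituting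
  linear forms into products of linear forms is the action of \<open>2 \<times> 2\<close> matrices on binary forms.\<close>

definition homog :: "nat \<Rightarrow> complex poly \<Rightarrow> complex poly \<Rightarrow> complex poly \<Rightarrow> complex poly"
  where "homog n f a b = (\<Sum>i\<le>n. smult (coeff f i) (a ^ i * b ^ (n - i)))"

lemma homog_mult_linear:
  assumes "degree f \<le> n"
  shows "homog (Suc n) (f * [:x, y:]) a b = homog n f a b * (smult x b + smult y a)"
proof -
  have c: "coeff (f * [:x, y:]) i = x * coeff f i + (if i = 0 then 0 else y * coeff f (i - 1))" for i
    by (cases i) (auto simp: mult.commute)
  have "homog (Suc n) (f * [:x, y:]) a b = (\<Sum>i\<le>Suc n. smult (x * coeff f i) (a ^ i * b ^ (Suc n - i)))
     + (\<Sum>i\<le>Suc n. smult (if i = 0 then 0 else y * coeff f (i - 1)) (a ^ i * b ^ (Suc n - i)))"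
    unfolding homog_def c by (simp add: smult_add_left sum.distrib del: sum.atMost_Suc)
  also have "(\<Sum>i\<le>Suc n. smult (x * coeff f i) (a ^ i * b ^ (Suc n - i))) = homog n f a b * smult x b"
  proof -
    have "coeff f (Suc n) = 0" using assms by (simp add: coeff_eq_0)
    then have "(\<Sum>i\<le>Suc n. smult (x * coeff f i) (a ^ i * b ^ (Suc n - i)))
        = (\<Sum>i\<le>n. smult (x * coeff f i) (a ^ i * b ^ (Suc n - i)))" by simp
    also have "\<dots> = (\<Sum>i\<le>n. smult (coeff f i) (a ^ i * b ^ (n - i)) * smult x b)"
      by (rule sum.cong) (auto simp: Suc_diff_le algebra_simps)
    finally show ?thesis unfolding homog_def sum_distrib_right .
  qed
  also have "(\<Sum>i\<le>Suc n. smult (if i = 0 then 0 else y * coeff f (i - 1)) (a ^ i * b ^ (Suc n - i)))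
      = homog n f a b * smult y a"
  proof -
    have "(\<Sum>i\<le>Suc n. smult (if i = 0 then 0 else y * coeff f (i - 1)) (a ^ i * b ^ (Suc n - i)))
      = (\<Sum>i\<le>n. smult (y * coeff f i) (a ^ Suc i * b ^ (n - i)))"
      by (subst sum.atMost_Suc_shift) simp
    also have "\<dots> = (\<Sum>i\<le>n. smult (coeff f i) (a ^ i * b ^ (n - i)) * smult y a)"
      by (rule sum.cong) (auto simp: algebra_simps)
    finally show ?thesis unfolding homog_def sum_distrib_right .
  qed
  finally show ?thesis by (simp add: algebra_simps)
qed

lemma degree_linear_powers: "degree ([:x, y:] ^ i * [:x', y':] ^ m :: complex poly) \<le> i + m"
proof -
  have 1: "degree ([:x, y:] ^ k) \<le> k" for x y :: complex and k
    by (rule order.trans[OF degree_power_le]) simp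
  show ?thesis by (rule order.trans[OF degree_mult_le]) (intro add_mono 1)
qed

text \<open>Substitution respects products, so a product of powers of linear forms goes to the product of the
  powers of their images. In terms of coefficients, this is the multiplicativity of symmetric powers
  of \<open>2 \<times> 2\<close> matrices.\<close>

lemma homog_linear_powers:
  "homog (i + m) ([:x, y:] ^ i * [:x', y':] ^ m) a b
    = (smult x b + smult y a) ^ i * (smult x' b + smult y' a) ^ m"
proof (induction m)
  case 0
  show ?case
  proof (induction i)
    case 0
    show ?case by (simp add: homog_def)
  next
    case (Suc i)
    have "degree ([:x, y:] ^ i) \<le> i" using degree_linear_powers[of x y i 0 0 0] by simp
    from homog_mult_linear[OF this, of x y a b] show ?case using Suc by (simp add: mult_ac)
  qed
next
  case (Suc m)
  have "[:x, y:] ^ i * [:x', y':] ^ Suc m = [:x, y:] ^ i * [:x', y':] ^ m * [:x', y':]"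
    by (simp only: power_Suc2 mult.assoc)
  then show ?case
    using homog_mult_linear[OF degree_linear_powers[of x y i x' y' m], of x' y' a b] Suc
    by (simp only: add_Suc_right power_Suc2 mult.assoc)
qed

definition plus_form :: "complex \<Rightarrow> complex poly"
  where "plus_form w = [:w, inverse w:]"

definition minus_form :: "complex \<Rightarrow> complex poly"
  where "minus_form w = [:inverse w, w:]"

text \<open>The generating polynomial of one column of the degree-zero matrix, in a variable \<open>s\<close> that counts
  rows. Each tensor factor contributes one linear form, to the power of twice its spin.\<close>

definition cartan_poly :: "complex \<Rightarrow> nat \<Rightarrow> nat \<Rightarrow> complex poly"
  where "cartan_poly w i m = plus_form w ^ i * minus_form w ^ m"

text \<open>The coefficient matrix is a symmetric power of the \<open>2 \<times> 2\<close> matrix of the two linear forms, whose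
  determinant vanishes only if \<open>w\<^sup>4 = 1\<close>. The symmetric power of the inverse \<open>2 \<times> 2\<close> matrix is
  then an inverse on both sides.\<close>

lemma cartan_matrix_inverse:
  assumes "w \<noteq> 0" "w ^ 4 \<noteq> 1"
  obtains B :: "nat \<Rightarrow> nat \<Rightarrow> complex" where
    "\<And>N j. N \<le> n \<Longrightarrow> j \<le> n \<Longrightarrow> (\<Sum>i\<le>n. coeff (cartan_poly w i (n - i)) N * B i j) = kd N j"
    "\<And>i j. i \<le> n \<Longrightarrow> j \<le> n \<Longrightarrow> (\<Sum>N\<le>n. B i N * coeff (cartan_poly w j (n - j)) N) = kd i j"
proof -
  define k where "k = w\<^sup>2 - inverse (w\<^sup>2)"
  have "k * w\<^sup>2 = w ^ 4 - 1" using assms(1)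
    by (simp add: k_def left_diff_distrib flip: power_add)
  then have k: "k \<noteq> 0" using assms by auto
  have kw: "k = w * w - inverse w * inverse w" by (simp add: k_def power2_eq_square)
  \<comment> \<open>\<open>P\<close> and \<open>R\<close> are the entries of the inverse of the \<open>2 \<times> 2\<close> matrix with rows \<open>(w, 1/w)\<close> and
    \<open>(1/w, w)\<close>; the inverse has the same shape\<close>
  define P where "P = w / k"
  define R where "R = - inverse w / k"
  have "P * w + R * inverse w = (w * w - inverse w * inverse w) / k"
    by (simp add: P_def R_def diff_divide_distrib)
  then have e1: "P * w + R * inverse w = 1" using k by (simp flip: kw)
  have e2: "P * inverse w + R * w = 0" by (simp add: P_def R_def)
  define a where "a = [:P, R:]"
  define b where "b = [:R, P:]"
  define B where "B = (\<lambda>i j. coeff (a ^ j * b ^ (n - j)) i)"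
  have X: "[:0, 1:] ^ j = monom (1::complex) j" for j
    by (simp add: monom_altdef)
  have 1: "smult P (minus_form w) + smult R (plus_form w) = [:0, 1:]"
    "smult R (minus_form w) + smult P (plus_form w) = 1"
    using e1 e2 by (simp_all add: plus_form_def minus_form_def one_pCons mult.commute add.commute)
  have 2: "smult w b + smult (inverse w) a = [:0, 1:]" "smult (inverse w) b + smult w a = 1"
    using e1 e2 by (simp_all add: a_def b_def one_pCons mult.commute add.commute)
  show ?thesis
  proof (rule that[of B])
    fix N j assume j: "j \<le> n"
    have "(\<Sum>i\<le>n. coeff (cartan_poly w i (n - i)) N * B i j)
        = coeff (homog (j + (n - j)) (a ^ j * b ^ (n - j)) (plus_form w) (minus_form w)) N"
      using j by (simp add: homog_def B_def cartan_poly_def coeff_sum mult.commute)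
    also have "\<dots> = coeff ([:0, 1:] ^ j * 1 ^ (n - j)) N"
      unfolding a_def b_def homog_linear_powers 1 ..
    also have "\<dots> = kd N j" by (simp add: X kd_def)
    finally show "(\<Sum>i\<le>n. coeff (cartan_poly w i (n - i)) N * B i j) = kd N j" .
  next
    fix i j assume j: "j \<le> n"
    have "(\<Sum>N\<le>n. B i N * coeff (cartan_poly w j (n - j)) N)
        = coeff (homog (j + (n - j)) (cartan_poly w j (n - j)) a b) i"
      using j by (simp add: homog_def B_def coeff_sum mult.commute)
    also have "\<dots> = coeff ([:0, 1:] ^ j * 1 ^ (n - j)) i"
      unfolding cartan_poly_def plus_form_def minus_form_def homog_linear_powers 2 ..
    also have "\<dots> = kd i j" by (simp add: X kd_def)
    finally show "(\<Sum>N\<le>n. B i N * coeff (cartan_poly w j (n - j)) N) = kd i j" .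
  qed
qed

text \<open>For \<open>f = (x + y s)\<^sup>n\<close> this is the effect of the torus derivation \<open>x \<partial>/\<partial>x - y \<partial>/\<partial>y\<close>. On coefficients
  it multiplies by the weight \<open>n - 2 u\<close>, hence the differential operator in \<open>s\<close>.\<close>

definition flow :: "nat \<Rightarrow> complex poly \<Rightarrow> complex poly"
  where "flow n f = smult (of_nat n) f - smult 2 ([:0, 1:] * pderiv f)"

lemma coeff_flow: "coeff (flow n f) u = (of_nat n - 2 * of_nat u) * coeff f u"
  by (cases u) (simp_all add: flow_def coeff_pderiv algebra_simps)

lemma flow_linear_power: "flow n ([:x, y:] ^ n) = smult (of_nat n) ([:x, y:] ^ (n - 1) * [:x, - y:])"
proof (cases n)
  case 0
  then show ?thesis by (simp add: flow_def)
next
  case (Suc k)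
  define L where "L = [:x, y:]"
  have D: "pderiv (L ^ n) = smult (of_nat n) (L ^ k) * [:y:]"
    unfolding Suc by (subst pderiv_power_Suc) (simp add: L_def pderiv_pCons)
  have "flow n (L ^ n) = smult (of_nat n) (L ^ k * (L - smult 2 ([:0, 1:] * [:y:])))"
    unfolding flow_def D by (simp only: Suc power_Suc) (simp add: algebra_simps smult_diff_right)
  also have "L - smult 2 ([:0, 1:] * [:y:]) = [:x, - y:]" by (simp add: L_def)
  finally show ?thesis by (simp add: L_def Suc)
qed

text \<open>The derivation sends \<open>plus_form w = w + s/w\<close> to \<open>w - s/w\<close>, and \<open>k\<close> times the latter is
  \<open>c (w + s/w) - 2 (1/w + s w)\<close>. So differentiation trades one linear factor for the other, which
  moves to a neighbouring column.\<close>

lemma cartan_poly_flow: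
  assumes "w \<noteq> 0"
  defines "k \<equiv> w\<^sup>2 - inverse (w\<^sup>2)" and "c \<equiv> w\<^sup>2 + inverse (w\<^sup>2)"
  shows "smult k (flow i (plus_form w ^ i) * minus_form w ^ m) =
      smult (of_nat i) (smult c (cartan_poly w i m) - smult 2 (cartan_poly w (i - 1) (m + 1)))"
    and "smult k (plus_form w ^ i * flow m (minus_form w ^ m)) =
      - smult (of_nat m) (smult c (cartan_poly w i m) - smult 2 (cartan_poly w (i + 1) (m - 1)))"
proof -
  have 1: "smult k [:w, - inverse w:] = smult c (plus_form w) - smult 2 (minus_form w)"
    "smult k [:inverse w, - w:] = - (smult c (minus_form w) - smult 2 (plus_form w))"
    using assms by (auto simp: k_def c_def plus_form_def minus_form_def field_simps power2_eq_square)
  have pull: "smult k (smult r (P * D) * M) = smult r (P * smult k D * M)"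
    "smult k (M * smult r (P * D)) = smult r (P * smult k D * M)" for r and P D M :: "complex poly"
    by (simp_all add: mult_ac)
  show "smult k (flow i (plus_form w ^ i) * minus_form w ^ m) =
      smult (of_nat i) (smult c (cartan_poly w i m) - smult 2 (cartan_poly w (i - 1) (m + 1)))"
  proof (cases i)
    case (Suc j)
    have "smult k (flow i (plus_form w ^ i) * minus_form w ^ m)
       = smult (of_nat i) (plus_form w ^ j * smult k [:w, - inverse w:] * minus_form w ^ m)"
      unfolding plus_form_def flow_linear_power pull by (simp only: Suc diff_Suc_1)
    then show ?thesis unfolding 1 cartan_poly_def
      by (simp add: Suc algebra_simps smult_diff_right)
  qed (simp add: flow_def)
  show "smult k (plus_form w ^ i * flow m (minus_form w ^ m)) =
      - smult (of_nat m) (smult c (cartan_poly w i m) - smult 2 (cartan_poly w (i + 1) (m - 1)))"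
  proof (cases m)
    case (Suc j)
    have "smult k (plus_form w ^ i * flow m (minus_form w ^ m))
       = smult (of_nat m) (minus_form w ^ j * smult k [:inverse w, - w:] * plus_form w ^ i)"
      unfolding minus_form_def flow_linear_power pull by (simp only: Suc diff_Suc_1)
    then show ?thesis unfolding 1 cartan_poly_def
      by (simp add: Suc algebra_simps smult_diff_right)
  qed (simp add: flow_def)
qed

lemma coeff_linear_power: "coeff ([:x, y:] ^ n) u = of_nat (n choose u) * x ^ (n - u) * (y::complex) ^ u"
proof (induction n arbitrary: u)
  case 0
  show ?case by (cases u) auto
next
  case (Suc n)
  show ?case
  proof (cases u)
    case 0
    then show ?thesis using Suc[of 0] by simp
  next
    case (Suc v)
    have "coeff ([:x, y:] ^ Suc n) u = x * coeff ([:x, y:] ^ n) (Suc v) + y * coeff ([:x, y:] ^ n) v"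
      by (simp add: Suc)
    also have "\<dots> = of_nat (n choose Suc v) * (x * x ^ (n - Suc v)) * y ^ Suc v + of_nat (n choose v) * x ^ (n - v) * y ^ Suc v"
      unfolding Suc.IH by (simp add: mult_ac)
    also have "of_nat (n choose Suc v) * (x * x ^ (n - Suc v)) = of_nat (n choose Suc v) * x ^ (n - v)"
      by (cases "Suc v \<le> n") (auto simp: binomial_eq_0 simp flip: power_Suc Suc_diff_le)
    finally show ?thesis by (simp add: Suc algebra_simps)
  qed
qed

lemma prod_binomial: "N \<le> n \<Longrightarrow> (\<Prod>i<N. (real i + 1) * (real n - real i)) = (fact N)\<^sup>2 * real (n choose N)"
proof (induction N)
  case 0
  show ?case by simp
next
  case (Suc N)
  have "Suc N * (n choose Suc N) = (n - N) * (n choose N)"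
    using Suc.prems binomial_absorb_comp[of n N] binomial_absorption[of N n]
    by (metis Suc_times_binomial_eq add_diff_cancel_left' binomial_absorption choose_reduce_nat)
  then have "real (Suc N * (n choose Suc N)) = real ((n - N) * (n choose N))" by (rule arg_cong)
  then have *: "(real n - real N) * real (n choose N) = (real N + 1) * real (n choose Suc N)"
    using Suc.prems by (simp add: of_nat_diff algebra_simps)
  have "(\<Prod>i<Suc N. (real i + 1) * (real n - real i))
      = (fact N)\<^sup>2 * (real N + 1) * ((real n - real N) * real (n choose N))"
    using Suc by simp
  also have "\<dots> = (fact N * (real N + 1))\<^sup>2 * real (n choose Suc N)"
    unfolding * by (simp add: power2_eq_square)
  finally show ?case by (simp add: algebra_simps)
qed

section \<open>Spherical functions of the Cartan component\<close>

text \<open>The scalar by which \<open>f\<^sup>N\<close> takes the highest weight vector to the basis vector of weight \<open>l - N\<close>.\<close>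

definition descent :: "(real \<Rightarrow> complex) \<Rightarrow> real \<Rightarrow> nat \<Rightarrow> complex"
  where "descent a l N = (\<Prod>i<N. cnj (a (l - real i - 1)))"

lemma descent_Suc: "descent a l (Suc N) = descent a l N * cnj (a (l - real N - 1))"
  by (simp add: descent_def)

lemma (in spin_representation) descent_norm:
  assumes "2 * l = real n" "N \<le> n"
  shows "cnj (descent ladder l N) * descent ladder l N = (fact N)\<^sup>2 * of_nat (n choose N)"
proof -
  have "cnj (descent ladder l N) * descent ladder l N
      = (\<Prod>i<N. ladder (l - real i - 1) * cnj (ladder (l - real i - 1)))"
    by (simp add: descent_def prod.distrib)
  also have "\<dots> = (\<Prod>i<N. complex_of_real ((real i + 1) * (real n - real i)))"
  proof (rule prod.cong[OF refl])
    fix i assume "i \<in> {..<N}"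
    then have "l - real i - 1 \<in> wts l"
      using assms unfolding wts_eq_image[OF assms(1)]
      by (intro image_eqI[of _ _ "n - i - 1"]) (auto simp: of_nat_diff)
    from ladder_norm[OF this] show "ladder (l - real i - 1) * cnj (ladder (l - real i - 1))
        = complex_of_real ((real i + 1) * (real n - real i))"
      unfolding assms(1)[symmetric] by (simp add: algebra_simps)
  qed
  also have "\<dots> = complex_of_real ((fact N)\<^sup>2 * real (n choose N))"
    unfolding prod_binomial[OF assms(2), symmetric] by simp
  finally show ?thesis by simp
qed

lemma (in spin_representation) ladder_top: "ladder l = 0"
  using ladder_support[of l] wts_bounds[of "l + 1" l] by (cases "ladder l = 0") auto

text \<open>For \<open>l = l1 + l2\<close> the image of \<open>\<beta>\<close> is the Cartan component, generated by the product of the two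
  highest weight vectors.\<close>

locale cartan_setting = isometry_setting +
  fixes n1 n2 :: nat
  assumes spins: "2 * l1 = real n1" "2 * l2 = real n2" and cartan: "l = l1 + l2"
begin

text \<open>Both sides are the coefficient of \<open>f\<^sup>u\<^sup>+\<^sup>v\<close> applied to the highest weight vector, the right-hand side
  by the binomial expansion of \<open>(f\<^sub>1 + f\<^sub>2)\<^sup>u\<^sup>+\<^sup>v\<close>. Pascal's rule is the induction step.\<close>

lemma cartan_x: "descent V.ladder l (u + v) * x (l1 - real u) (l2 - real v)
    = x l1 l2 * of_nat ((u + v) choose u) * descent V1.ladder l1 u * descent V2.ladder l2 v"
proof (induction "u + v" arbitrary: u v)
  case 0
  then show ?case by (simp add: descent_def)
next
  case (Suc N)
  let ?m = "l1 - real u" and ?n = "l2 - real v"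
  have mn: "?m + ?n = l - real N - 1" using Suc(2) cartan by simp
  have 1: "descent V.ladder l N * (cnj (V1.ladder ?m) * x (?m + 1) ?n)
    = x l1 l2 * of_nat (case u of 0 \<Rightarrow> 0 | Suc u' \<Rightarrow> N choose u') * descent V1.ladder l1 u * descent V2.ladder l2 v"
  proof (cases u)
    case 0
    then show ?thesis by (simp add: V1.ladder_top)
  next
    case (Suc u')
    then have N: "N = u' + v" using \<open>Suc N = u + v\<close> by simp
    have "?m + 1 = l1 - real u'" "?m = l1 - real u' - 1" using Suc by auto
    then show ?thesis using Suc(1) Suc.hyps(1)[OF N] unfolding N
      by (simp add: descent_Suc algebra_simps)
  qed
  have 2: "descent V.ladder l N * (cnj (V2.ladder ?n) * x ?m (?n + 1))
    = x l1 l2 * of_nat (N choose u) * descent V1.ladder l1 u * descent V2.ladder l2 v"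
  proof (cases v)
    case 0
    then show ?thesis using Suc(2) by (simp add: V2.ladder_top binomial_eq_0)
  next
    case (Suc v')
    then have N: "N = u + v'" using \<open>Suc N = u + v\<close> by simp
    have "?n + 1 = l2 - real v'" "?n = l2 - real v' - 1" using Suc by auto
    then show ?thesis using Suc(1) Suc.hyps(1)[OF N] unfolding N
      by (simp add: descent_Suc algebra_simps)
  qed
  have "descent V.ladder l (u + v) * x ?m ?n
      = descent V.ladder l N * (cnj (V.ladder (?m + ?n)) * x ?m ?n)"
    unfolding mn Suc(2)[symmetric] descent_Suc by simp
  also have "\<dots> = x l1 l2 * (of_nat (case u of 0 \<Rightarrow> 0 | Suc u' \<Rightarrow> N choose u') + of_nat (N choose u))
      * descent V1.ladder l1 u * descent V2.ladder l2 v"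
    unfolding lower_x distrib_left 1 2 by (simp add: algebra_simps)
  also have "of_nat (case u of 0 \<Rightarrow> 0 | Suc u' \<Rightarrow> N choose u') + of_nat (N choose u) = (of_nat ((u + v) choose u) :: complex)"
    unfolding Suc(2)[symmetric] by (cases u) auto
  finally show ?case .
qed

lemma top_norm: "cnj (x l1 l2) * x l1 l2 = 1"
proof -
  have "l \<in> wts l" by (rule wts_top[OF V.half_integral])
  have "l1 \<in> wts l1" by (rule wts_top[OF V1.half_integral])
  have "1 = (\<Sum>m\<in>wts l1. cnj (x m (l - m)) * x m (l - m))" by (rule norm_x[symmetric]) fact
  also have "\<dots> = (\<Sum>m\<in>wts l1. if m = l1 then cnj (x l1 l2) * x l1 l2 else 0)"
  proof (rule sum.cong[OF refl])
    fix m assume "m \<in> wts l1"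
    have "x m (l - m) = 0" if "m \<noteq> l1"
    proof (rule ccontr)
      assume "x m (l - m) \<noteq> 0"
      then have "m \<in> wts l1" "l - m \<in> wts l2" using x_support by auto
      then show False using wts_bounds[of "l - m" l2] wts_bounds[of m l1] cartan that by linarith
    qed
    then show "cnj (x m (l - m)) * x m (l - m) = (if m = l1 then cnj (x l1 l2) * x l1 l2 else 0)"
      by (simp add: cartan)
  qed
  finally show ?thesis using \<open>l1 \<in> wts l1\<close> by (simp add: finite_wts)
qed

text \<open>The unknown phases disappear in absolute values, and the squared Clebsch-Gordan coefficients are
  hypergeometric probabilities.\<close>

lemma cartan_weight:
  assumes "u \<le> n1" "v \<le> n2"
  shows "of_nat ((n1 + n2) choose (u + v)) *
    (cnj (x (l1 - real u) (l2 - real v)) * x (l1 - real u) (l2 - real v))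
    = of_nat (n1 choose u) * of_nat (n2 choose v)"
proof -
  let ?x = "x (l1 - real u) (l2 - real v)"
  let ?d = "descent V.ladder l (u + v)" and ?d1 = "descent V1.ladder l1 u" and ?d2 = "descent V2.ladder l2 v"
  let ?c = "of_nat ((u + v) choose u) :: complex"
  have l2: "2 * l = real (n1 + n2)" using spins cartan by simp
  have "cnj (?d * ?x) * (?d * ?x) = cnj (x l1 l2 * ?c * ?d1 * ?d2) * (x l1 l2 * ?c * ?d1 * ?d2)"
    unfolding cartan_x ..
  then have "(cnj ?d * ?d) * (cnj ?x * ?x)
      = (cnj (x l1 l2) * x l1 l2) * (?c * ?c) * (cnj ?d1 * ?d1) * (cnj ?d2 * ?d2)"
    by (simp add: mult_ac)
  then have "(fact (u + v))\<^sup>2 * (of_nat ((n1 + n2) choose (u + v)) * (cnj ?x * ?x))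
      = (?c * fact u * fact v)\<^sup>2 * (of_nat (n1 choose u) * of_nat (n2 choose v))"
    unfolding top_norm V.descent_norm[OF l2 add_mono[OF assms]] V1.descent_norm[OF spins(1) assms(1)]
      V2.descent_norm[OF spins(2) assms(2)]
    by (simp add: power2_eq_square mult_ac)
  also have "?c * fact u * fact v = fact (u + v)"
  proof -
    have "fact u * fact v * ((u + v) choose u) = (fact (u + v) :: nat)"
      using binomial_fact_lemma[of u "u + v"] by simp
    from arg_cong[OF this, of "of_nat :: nat \<Rightarrow> complex"] show ?thesis by (simp add: mult_ac)
  qed
  finally show ?thesis by simp
qed

lemma cartan_mom:
  fixes t :: real and w :: complex
  assumes "N \<le> n1 + n2"
  defines "w \<equiv> exp (\<i> * of_real t)"
  shows "of_nat ((n1 + n2) choose N) * mom g t (l - real N) =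
    (\<Sum>u\<le>N. g (l1 - real u) (l2 - real (N - u)) *
       (coeff (plus_form w ^ n1) u * coeff (minus_form w ^ n2) (N - u)))"
proof -
  have w: "w ^ k = exp (\<i> * t * of_nat k)" "inverse w ^ k = exp (- (\<i> * t * of_nat k))" for k
    unfolding w_def by (simp_all add: exp_of_nat_mult[symmetric] exp_minus[symmetric] mult_ac)
  let ?S = "{u. u \<le> N \<and> u \<le> n1 \<and> N - u \<le> n2}"
  let ?g = "\<lambda>m. g m (l - real N - m) *
    (cnj (x m (l - real N - m)) * x m (l - real N - m) * exp (2 * \<i> * t * (2 * m - (l - real N))))"
  have "wts l1 = (\<lambda>u. l1 - real u) ` {..n1}"
    unfolding wts_eq_image[OF spins(1)]
  proof (rule set_eqI, rule iffI)
    fix m assume "m \<in> (\<lambda>k. real k - l1) ` {..n1}"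
    then obtain k where "k \<le> n1" "m = real k - l1" by auto
    then show "m \<in> (\<lambda>u. l1 - real u) ` {..n1}" using spins
      by (intro image_eqI[of _ _ "n1 - k"]) (auto simp: of_nat_diff)
  next
    fix m assume "m \<in> (\<lambda>u. l1 - real u) ` {..n1}"
    then obtain k where "k \<le> n1" "m = l1 - real k" by auto
    then show "m \<in> (\<lambda>k. real k - l1) ` {..n1}" using spins
      by (intro image_eqI[of _ _ "n1 - k"]) (auto simp: of_nat_diff)
  qed
  then have "mom g t (l - real N) = (\<Sum>u\<le>n1. ?g (l1 - real u))"
    unfolding mom_def by (simp add: sum.reindex inj_on_def)
  also have "\<dots> = (\<Sum>u\<in>?S. ?g (l1 - real u))"
  proof (rule sum.mono_neutral_right)
    show "\<forall>u\<in>{..n1} - ?S. ?g (l1 - real u) = 0"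
    proof
      fix u assume "u \<in> {..n1} - ?S"
      then have "N < u \<or> n2 + u < N" by auto
      then have "l - real N - (l1 - real u) > l2 \<or> l - real N - (l1 - real u) < - l2"
        using cartan spins by auto
      then have "x (l1 - real u) (l - real N - (l1 - real u)) = 0"
        using x_support[of "l1 - real u" "l - real N - (l1 - real u)"]
          wts_bounds[of "l - real N - (l1 - real u)" l2]
        by (cases "x (l1 - real u) (l - real N - (l1 - real u)) = 0") auto
      then show "?g (l1 - real u) = 0" by simp
    qed
  qed auto
  finally have "of_nat ((n1 + n2) choose N) * mom g t (l - real N)
      = (\<Sum>u\<in>?S. of_nat ((n1 + n2) choose N) * ?g (l1 - real u))"
    by (simp add: sum_distrib_left)
  also have "\<dots> = (\<Sum>u\<in>?S. g (l1 - real u) (l2 - real (N - u)) *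
       (coeff (plus_form w ^ n1) u * coeff (minus_form w ^ n2) (N - u)))"
  proof (rule sum.cong[OF refl])
    fix u assume "u \<in> ?S"
    then obtain v where v: "N = u + v" "u \<le> n1" "v \<le> n2" by (auto simp: le_iff_add)
    have Nu: "N - u = v" using v by simp
    have e: "l - real N - (l1 - real u) = l2 - real v" using cartan v by simp
    have "coeff (plus_form w ^ n1) u * coeff (minus_form w ^ n2) v
        = of_nat (n1 choose u) * of_nat (n2 choose v) *
          ((w ^ (n1 - u) * inverse w ^ u) * (inverse w ^ (n2 - v) * w ^ v))"
      by (simp add: plus_form_def minus_form_def coeff_linear_power)
    also have "(w ^ (n1 - u) * inverse w ^ u) * (inverse w ^ (n2 - v) * w ^ v)
        = exp (2 * \<i> * t * (2 * (l1 - real u) - (l - real N)))"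
    proof -
      have "\<i> * t * of_nat (n1 - u) + - (\<i> * t * of_nat u) + (- (\<i> * t * of_nat (n2 - v)) + \<i> * t * of_nat v)
        = \<i> * t * of_real (real n1 - 2 * real u - real n2 + 2 * real v)"
        using v by (simp add: of_nat_diff algebra_simps)
      also have "real n1 - 2 * real u - real n2 + 2 * real v = 2 * (2 * (l1 - real u) - (l - real N))"
        using spins cartan v by simp
      finally show ?thesis unfolding w exp_add[symmetric] by (simp add: mult_ac)
    qed
    finally show "of_nat ((n1 + n2) choose N) * ?g (l1 - real u)
      = g (l1 - real u) (l2 - real (N - u)) *
        (coeff (plus_form w ^ n1) u * coeff (minus_form w ^ n2) (N - u))"
      using cartan_weight[OF v(2,3)] unfolding e Nu v(1)[symmetric] by (simp add: mult_ac)
  qed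
  also have "\<dots> = (\<Sum>u\<le>N. g (l1 - real u) (l2 - real (N - u)) *
       (coeff (plus_form w ^ n1) u * coeff (minus_form w ^ n2) (N - u)))"
    by (rule sum.mono_neutral_left)
       (auto simp: plus_form_def minus_form_def coeff_linear_power binomial_eq_0)
  finally show ?thesis .
qed

lemma cartan_F:
  assumes "N \<le> n1 + n2"
  shows "of_nat ((n1 + n2) choose N) * F t (l - real N)
    = coeff (cartan_poly (exp (\<i> * of_real t)) n1 n2) N"
  unfolding F_def cartan_mom[OF assms] cartan_poly_def coeff_mult by simp

text \<open>Weights of the torus in the two factors add up to the weight of the diagonal subgroup, and their
  difference is the derivative along the torus.\<close>

lemma cartan_flow:
  fixes t :: real and w :: complex
  assumes "N \<le> n1 + n2"
  defines "w \<equiv> exp (\<i> * of_real t)"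
  shows "of_nat ((n1 + n2) choose N) * DF t (l - real N)
    = coeff (flow n1 (plus_form w ^ n1) * minus_form w ^ n2 - plus_form w ^ n1 * flow n2 (minus_form w ^ n2)) N"
    and "of_nat ((n1 + n2) choose N) * (2 * (l - real N) * F t (l - real N))
    = coeff (flow n1 (plus_form w ^ n1) * minus_form w ^ n2 + plus_form w ^ n1 * flow n2 (minus_form w ^ n2)) N"
proof -
  have l: "complex_of_real l1 = of_nat n1 / 2" "complex_of_real l2 = of_nat n2 / 2"
  proof -
    have h: "l1 = real n1 / 2" "l2 = real n2 / 2" using spins by auto
    show "complex_of_real l1 = of_nat n1 / 2" "complex_of_real l2 = of_nat n2 / 2"
      unfolding h by simp_all
  qed
  show "of_nat ((n1 + n2) choose N) * DF t (l - real N)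
    = coeff (flow n1 (plus_form w ^ n1) * minus_form w ^ n2 - plus_form w ^ n1 * flow n2 (minus_form w ^ n2)) N"
    unfolding DF_def cartan_mom[OF assms(1)] coeff_diff coeff_mult coeff_flow w_def[symmetric] sum_subtractf[symmetric]
  proof (rule sum.cong[OF refl])
    fix u assume "u \<in> {..N}"
    have e: "complex_of_real (2 * (l1 - real u - (l2 - real (N - u))))
        = (of_nat n1 - 2 * of_nat u) - (of_nat n2 - 2 * of_nat (N - u))"
      by (simp add: l)
    show "complex_of_real (2 * (l1 - real u - (l2 - real (N - u)))) *
        (coeff (plus_form w ^ n1) u * coeff (minus_form w ^ n2) (N - u)) =
      (of_nat n1 - 2 * of_nat u) * coeff (plus_form w ^ n1) u * coeff (minus_form w ^ n2) (N - u) -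
      coeff (plus_form w ^ n1) u * ((of_nat n2 - 2 * of_nat (N - u)) * coeff (minus_form w ^ n2) (N - u))"
      unfolding e left_diff_distrib[of "of_nat n1 - 2 * of_nat u"] by (simp only: mult_ac)
  qed
  have "of_nat ((n1 + n2) choose N) * mom (\<lambda>m n. complex_of_real (2 * (l - real N)) * 1) t (l - real N)
    = coeff (flow n1 (plus_form w ^ n1) * minus_form w ^ n2 + plus_form w ^ n1 * flow n2 (minus_form w ^ n2)) N"
    unfolding cartan_mom[OF assms(1)] coeff_add coeff_mult coeff_flow w_def[symmetric] sum.distrib[symmetric]
  proof (rule sum.cong[OF refl])
    fix u assume u: "u \<in> {..N}"
    have e: "complex_of_real (2 * (l - real N)) * 1
        = (of_nat n1 - 2 * of_nat u) + (of_nat n2 - 2 * of_nat (N - u))"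
      using u by (simp add: l cartan of_nat_diff)
    show "complex_of_real (2 * (l - real N)) * 1 *
        (coeff (plus_form w ^ n1) u * coeff (minus_form w ^ n2) (N - u)) =
      (of_nat n1 - 2 * of_nat u) * coeff (plus_form w ^ n1) u * coeff (minus_form w ^ n2) (N - u) +
      coeff (plus_form w ^ n1) u * ((of_nat n2 - 2 * of_nat (N - u)) * coeff (minus_form w ^ n2) (N - u))"
      unfolding e distrib_right[of "of_nat n1 - 2 * of_nat u"] by (simp only: mult_ac)
  qed
  then show "of_nat ((n1 + n2) choose N) * (2 * (l - real N) * F t (l - real N))
    = coeff (flow n1 (plus_form w ^ n1) * minus_form w ^ n2 + plus_form w ^ n1 * flow n2 (minus_form w ^ n2)) N"
    unfolding mom_cmult F_def by simp
qed

text \<open>These two relations determine the conjugates by the degree-zero matrix of the derivation and of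
  the diagonal matrix of weights. Both are tridiagonal in the column index. When \<open>n1 = 0\<close> or \<open>n2 = 0\<close>
  the truncated subtraction occurs with coefficient zero.\<close>

lemma cartan_contiguous:
  fixes t :: real and w k c :: complex and G :: "nat \<Rightarrow> nat \<Rightarrow> complex"
  assumes "N \<le> n1 + n2"
  defines "w \<equiv> exp (\<i> * of_real t)"
  defines "k \<equiv> w\<^sup>2 - inverse (w\<^sup>2)" and "c \<equiv> w\<^sup>2 + inverse (w\<^sup>2)"
  defines "G \<equiv> (\<lambda>i m. coeff (cartan_poly w i m) N)"
  shows "of_nat ((n1 + n2) choose N) * (k * DF t (l - real N))
    = n1 * (c * G n1 n2 - 2 * G (n1 - 1) (n2 + 1)) + n2 * (c * G n1 n2 - 2 * G (n1 + 1) (n2 - 1))"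
    and "of_nat ((n1 + n2) choose N) * (k * (2 * (l - real N) * F t (l - real N)))
    = n1 * (c * G n1 n2 - 2 * G (n1 - 1) (n2 + 1)) - n2 * (c * G n1 n2 - 2 * G (n1 + 1) (n2 - 1))"
proof -
  have w0: "w \<noteq> 0" by (simp add: w_def)
  note fl = cartan_poly_flow[OF w0, folded k_def c_def]
  have "of_nat ((n1 + n2) choose N) * (k * DF t (l - real N)) = coeff (smult k (flow n1 (plus_form w ^ n1) * minus_form w ^ n2)
     - smult k (plus_form w ^ n1 * flow n2 (minus_form w ^ n2))) N"
  proof -
    have "of_nat ((n1 + n2) choose N) * (k * DF t (l - real N)) = k * (of_nat ((n1 + n2) choose N) * DF t (l - real N))"
      by (simp only: mult.left_commute)
    then show ?thesis
      unfolding cartan_flow(1)[OF assms(1), of t, folded w_def] by (simp add: right_diff_distrib)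
  qed
  then show "of_nat ((n1 + n2) choose N) * (k * DF t (l - real N))
    = n1 * (c * G n1 n2 - 2 * G (n1 - 1) (n2 + 1)) + n2 * (c * G n1 n2 - 2 * G (n1 + 1) (n2 - 1))"
    unfolding fl G_def by simp
  have "of_nat ((n1 + n2) choose N) * (k * (2 * (l - real N) * F t (l - real N)))
     = coeff (smult k (flow n1 (plus_form w ^ n1) * minus_form w ^ n2)
     + smult k (plus_form w ^ n1 * flow n2 (minus_form w ^ n2))) N"
  proof -
    have "of_nat ((n1 + n2) choose N) * (k * (2 * (l - real N) * F t (l - real N))) = k * (of_nat ((n1 + n2) choose N) * (2 * (l - real N) * F t (l - real N)))"
      by (simp only: mult.left_commute)
    then show ?thesis
      unfolding cartan_flow(2)[OF assms(1), of t, folded w_def] by (simp add: distrib_left)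
  qed
  then show "of_nat ((n1 + n2) choose N) * (k * (2 * (l - real N) * F t (l - real N)))
    = n1 * (c * G n1 n2 - 2 * G (n1 - 1) (n2 + 1)) - n2 * (c * G n1 n2 - 2 * G (n1 + 1) (n2 - 1))"
    unfolding fl G_def by simp
qed

end

section \<open>The full spherical functions on the compact torus\<close>

text \<open>The values \<open>cos (2 t)\<close> fill the interval from \<open>-1\<close> to \<open>1\<close>, so a polynomial identity may be checked on
  the regular part of the compact torus.\<close>

lemma poly_eq_on_arc:
  fixes f g :: "complex poly"
  assumes "\<And>t. 0 < t \<Longrightarrow> t < pi / 2 \<Longrightarrow>
    poly f (of_real (cos (2 * t))) = poly g (of_real (cos (2 * t)))"
  shows "f = g"
proof (rule ccontr)
  assume "f \<noteq> g"
  then have "finite {z. poly (f - g) z = 0}" by (intro poly_roots_finite) simp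
  moreover have "complex_of_real ` {-1<..<1} \<subseteq> {z. poly (f - g) z = 0}"
  proof
    fix z assume "z \<in> complex_of_real ` {-1<..<1}"
    then obtain x where x: "-1 < x" "x < 1" "z = of_real x" by auto
    define t where "t = arccos x / 2"
    have "0 < t" "t < pi / 2" using arccos_lt_bounded[of x] x by (auto simp: t_def)
    moreover have "cos (2 * t) = x" using x by (simp add: t_def)
    ultimately show "z \<in> {z. poly (f - g) z = 0}" using assms[of t] x by simp
  qed
  ultimately have "finite (complex_of_real ` {-1<..<1})" by (rule finite_subset[rotated])
  then have "finite {-1<..<1::real}" by (rule finite_imageD) (simp add: inj_on_def)
  then show False by (simp add: infinite_Ioo)
qed

lemma minv_inverse:
  assumes "meq I I (mmul I A B) kd" "meq I I (mmul I B A) kd"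
  shows "meq I I (mmul I A (minv I A)) kd"
  unfolding minv_def by (rule someI2[of _ B]) (use assms in auto)

lemma mmul_assoc: "mmul I (mmul J A B) C p q = mmul J A (mmul I B C) p q"
  unfolding mmul_def sum_distrib_left sum_distrib_right
  by (subst sum.swap) (simp add: mult.assoc)

lemma sum_kd_real:
  fixes f :: "real \<Rightarrow> complex"
  assumes "finite I" "r \<notin> I \<Longrightarrow> a = 0"
  shows "(\<Sum>s\<in>I. f s * of_real (a * kd s r)) = of_real a * f r"
proof -
  have "(\<Sum>s\<in>I. f s * of_real (a * kd s r)) = (\<Sum>s\<in>I. if s = r then of_real a * f r else 0)"
    by (rule sum.cong) (auto simp: kd_def)
  then show ?thesis using assms by auto
qed

locale spherical_family =
  fixes l :: real and T :: "real \<Rightarrow> complex^2^2 \<Rightarrow> real \<Rightarrow> real \<Rightarrow> complex"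
    and \<beta> :: "real \<times> real \<Rightarrow> real \<times> real \<Rightarrow> real \<Rightarrow> complex" and n :: nat
  assumes l: "2 * l = real n"
    and T: "\<And>m. 2 * m \<in> \<nat> \<Longrightarrow> spin_rep m (T m)"
    and \<beta>: "\<And>d h. h \<in> wts l \<Longrightarrow> equivariant_isometry T l (zeta l d h) (\<beta> (zeta l d h))"
begin

lemma half_integral: "2 * l \<in> \<nat>"
  using l by simp

lemma isometry:
  assumes "j \<in> wts l"
  shows "isometry_setting l ((d + l + j) / 2) ((d + l - j) / 2) T (\<beta> (zeta l d j))"
proof -
  obtain i where i: "i \<le> n" "j = real i - l" using assms wts_eq_image[OF l] by auto
  have "2 * ((d + l + j) / 2) = real (d + i)" using i by simp
  then have 1: "2 * ((d + l + j) / 2) \<in> \<nat>" by (metis of_nat_in_Nats)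
  have "2 * ((d + l - j) / 2) = real (d + (n - i))" using i l by (simp add: of_nat_diff)
  then have 2: "2 * ((d + l - j) / 2) \<in> \<nat>" by (metis of_nat_in_Nats)
  show ?thesis
    using T[OF half_integral] T[OF 1] T[OF 2] half_integral 1 2 \<beta>[OF assms, of d]
    by unfold_locales (auto simp: zeta_def)
qed

text \<open>Rows outside of the weight set are zero, so that the neighbours \<open>p \<plusminus> 1\<close> in the radial equations are
  defined for every weight \<open>p\<close>.\<close>

definition \<Phi> :: "nat \<Rightarrow> real \<Rightarrow> real \<Rightarrow> real \<Rightarrow> complex"
  where "\<Phi> d t p j = (if p \<in> wts l then full_spherical T \<beta> l d (exp (\<i> * of_real t)) p j else 0)"

text \<open>The derivation \<open>w d/dw\<close> in terms of the parameter of \<open>w = exp (\<i> * t)\<close>.\<close>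

definition D\<Phi> :: "nat \<Rightarrow> real \<Rightarrow> real \<Rightarrow> real \<Rightarrow> complex"
  where "D\<Phi> d t p j = - \<i> * vector_derivative (\<lambda>t. \<Phi> d t p j) (at t)"

definition D2\<Phi> :: "nat \<Rightarrow> real \<Rightarrow> real \<Rightarrow> real \<Rightarrow> complex"
  where "D2\<Phi> d t p j = - \<i> * vector_derivative (\<lambda>t. D\<Phi> d t p j) (at t)"

definition q :: "real \<Rightarrow> complex"
  where "q t = exp (2 * \<i> * of_real t)"

definition k :: "real \<Rightarrow> complex"
  where "k t = q t - inverse (q t)"

definition c :: "real \<Rightarrow> complex"
  where "c t = q t + inverse (q t)"

text \<open>Column \<open>j\<close> belongs to the pair \<open>zeta l d j\<close>; with its values the Casimir eigenvalues in \<open>radial\<close>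
  become twice the diagonal entries of \<open>Lam l d\<close> and \<open>Gam l d\<close>.\<close>

lemma \<Phi>_derivs:
  assumes "j \<in> wts l"
  shows "((\<lambda>t. \<Phi> d t p j) has_vector_derivative \<i> * D\<Phi> d t p j) (at t)" (is ?A)
    and "((\<lambda>t. D\<Phi> d t p j) has_vector_derivative \<i> * D2\<Phi> d t p j) (at t)" (is ?B)
    and "p \<in> wts l \<Longrightarrow>
      (k t)\<^sup>2 * (((real d + l)\<^sup>2 / 2 + j\<^sup>2 / 2 + real d + l) * \<Phi> d t p j - of_real (p\<^sup>2 / 2) * \<Phi> d t p j - D2\<Phi> d t p j / 8) =
      of_real ((l + p) * (l - p + 1)) * (c t * \<Phi> d t (p - 1) j - 2 * \<Phi> d t p j)
      + of_real ((l - p) * (l + p + 1)) * (c t * \<Phi> d t (p + 1) j - 2 * \<Phi> d t p j)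
      + k t * c t * D\<Phi> d t p j / 2" (is "_ \<Longrightarrow> ?C")
    and "p \<in> wts l \<Longrightarrow>
      (k t)\<^sup>2 * (j * (real d + l + 1) * \<Phi> d t p j - of_real (p / 2) * D\<Phi> d t p j) =
      k t * (of_real ((l - p) * (l + p + 1)) * \<Phi> d t (p + 1) j
        - of_real ((l + p) * (l - p + 1)) * \<Phi> d t (p - 1) j + c t * p * \<Phi> d t p j)" (is "_ \<Longrightarrow> ?D")
proof -
  interpret isometry_setting l "(d + l + j) / 2" "(d + l - j) / 2" T "\<beta> (zeta l d j)"
    by (rule isometry[OF assms])
  have \<Phi>: "\<Phi> d t p j = F t p" for t p
    using spherical_eq_F[of p t] F_zero[of p t] by (simp add: \<Phi>_def full_spherical_def zeta_def)
  have D: "D\<Phi> d t p j = DF t p" for t p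
    unfolding D\<Phi>_def \<Phi> vector_derivative_at[OF F_deriv] by simp
  have D2: "D2\<Phi> d t p j = D2F t p" for t p
    unfolding D2\<Phi>_def D vector_derivative_at[OF DF_deriv] by simp
  show ?A unfolding \<Phi> D by (rule F_deriv)
  show ?B unfolding D D2 by (rule DF_deriv)
  have e1: "(d + l + j) / 2 * ((d + l + j) / 2 + 1) + (d + l - j) / 2 * ((d + l - j) / 2 + 1)
      = (real d + l)\<^sup>2 / 2 + j\<^sup>2 / 2 + real d + l"
    by (simp add: field_simps power2_eq_square)
  have e2: "(d + l + j) / 2 * ((d + l + j) / 2 + 1) - (d + l - j) / 2 * ((d + l - j) / 2 + 1)
      = j * (real d + l + 1)"
    by (simp add: field_simps)
  show ?C if "p \<in> wts l"
    using radial(1)[OF that, of t] unfolding e1 \<Phi> D D2 k_def c_def q_def .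
  show ?D if "p \<in> wts l"
    using radial(2)[OF that, of t] unfolding e2 \<Phi> D D2 k_def c_def q_def .
qed

lemma cartan:
  assumes "i \<le> n"
  shows "cartan_setting l ((0 + l + (real i - l)) / 2) ((0 + l - (real i - l)) / 2) T (\<beta> (zeta l 0 (real i - l))) i (n - i)"
proof -
  have "real i - l \<in> wts l" using assms unfolding wts_eq_image[OF l] by auto
  then interpret isometry_setting l "(0 + l + (real i - l)) / 2" "(0 + l - (real i - l)) / 2" T "\<beta> (zeta l 0 (real i - l))"
    using isometry[of "real i - l" 0] by simp
  show ?thesis
    by unfold_locales (use l assms in \<open>auto simp: of_nat_diff field_simps\<close>)
qed

lemma wts_cases:
  assumes "p \<in> wts l"
  obtains N where "N \<le> n" "p = l - real N"
proof -
  from wts_uminus[OF half_integral assms] obtain N where "N \<le> n" "- p = real N - l"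
    unfolding wts_eq_image[OF l] by auto
  then show ?thesis by (intro that[of N]) auto
qed

lemma \<Phi>0_eq:
  assumes "i \<le> n" "N \<le> n"
  shows "of_nat (n choose N) * \<Phi> 0 t (l - real N) (real i - l)
    = coeff (cartan_poly (exp (\<i> * of_real t)) i (n - i)) N"
proof -
  interpret cartan_setting l "(0 + l + (real i - l)) / 2" "(0 + l - (real i - l)) / 2" T "\<beta> (zeta l 0 (real i - l))" i "n - i"
    by (rule cartan[OF assms(1)])
  have "\<Phi> 0 t (l - real N) (real i - l) = F t (l - real N)"
    using spherical_eq_F[of "l - real N" t] F_zero[of "l - real N" t]
    by (simp add: \<Phi>_def full_spherical_def zeta_def)
  then show ?thesis using cartan_F[of N t] assms by simp
qed

text \<open>The relations of \<open>cartan_contiguous\<close> after division by the binomial coefficient of the row. A column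
  index that leaves the weight set comes with coefficient zero.\<close>

lemma \<Phi>0_contiguous:
  fixes p j t :: real
  assumes "p \<in> wts l" "j \<in> wts l"
  shows "k t * D\<Phi> 0 t p j = 2 * l * c t * \<Phi> 0 t p j - 2 * (l + j) * \<Phi> 0 t p (j - 1) - 2 * (l - j) * \<Phi> 0 t p (j + 1)"
    and "2 * k t * p * \<Phi> 0 t p j = 2 * j * c t * \<Phi> 0 t p j - 2 * (l + j) * \<Phi> 0 t p (j - 1) + 2 * (l - j) * \<Phi> 0 t p (j + 1)"
proof -
  obtain N where N: "N \<le> n" "p = l - real N" using assms(1) by (rule wts_cases)
  obtain i where i: "i \<le> n" "j = real i - l" using assms(2) wts_eq_image[OF l] by auto
  interpret cartan_setting l "(0 + l + (real i - l)) / 2" "(0 + l - (real i - l)) / 2" T "\<beta> (zeta l 0 (real i - l))" i "n - i"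
    by (rule cartan[OF i(1)])
  have \<Phi>: "\<Phi> 0 t (l - real N) (real i - l) = F t (l - real N)" for t
    using spherical_eq_F[of "l - real N" t] F_zero[of "l - real N" t]
    by (simp add: \<Phi>_def full_spherical_def zeta_def)
  have D: "D\<Phi> 0 t (l - real N) (real i - l) = DF t (l - real N)"
    unfolding D\<Phi>_def \<Phi> vector_derivative_at[OF F_deriv] by simp
  define w where "w = exp (\<i> * of_real t)"
  have w2: "w\<^sup>2 = q t" by (simp add: w_def q_def mult_ac flip: exp_double)
  let ?C = "of_nat (n choose N) :: complex"
  have C: "?C \<noteq> 0" using N by simp
  have nn: "i + (n - i) = n" using i by simp
  define g where "g = coeff (cartan_poly w i (n - i)) N"
  define gm where "gm = coeff (cartan_poly w (i - 1) (n - i + 1)) N"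
  define gp where "gp = coeff (cartan_poly w (i + 1) (n - i - 1)) N"
  have G0: "g = ?C * \<Phi> 0 t p j"
    using \<Phi>0_eq[OF i(1) N(1), of t] by (simp add: w_def N i g_def)
  have Gm: "of_nat i * gm = (l + j) * (?C * \<Phi> 0 t p (j - 1))"
  proof (cases i)
    case 0
    then show ?thesis using i by simp
  next
    case (Suc i')
    then have "i' \<le> n" "n - i' = n - i + 1" "real i' - l = j - 1" using i by auto
    then show ?thesis using \<Phi>0_eq[of i' N t] N i Suc by (simp add: w_def gm_def)
  qed
  have Gp: "of_nat (n - i) * gp = (l - j) * (?C * \<Phi> 0 t p (j + 1))"
  proof (cases "i = n")
    case True
    then show ?thesis using i l by simp
  next
    case False
    then have le: "i + 1 \<le> n" and e: "n - (i + 1) = n - i - 1" "real (i + 1) - l = j + 1" using i by auto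
    have "complex_of_real (l - j) = of_nat (n - i)"
    proof -
      have "l - j = real (n - i)" using i l by (simp add: of_nat_diff)
      then show ?thesis by simp
    qed
    then show ?thesis using \<Phi>0_eq[OF le N(1), of t] unfolding e w_def[symmetric] N(2)[symmetric] gp_def by simp
  qed
  have ii: "complex_of_real (l + j) = of_nat i" using i by simp
  have jj: "complex_of_real (l - j) = of_nat (n - i)"
  proof -
    have "l - j = real (n - i)" using i l by (simp add: of_nat_diff)
    then show ?thesis by simp
  qed
  note ct = cartan_contiguous[of N t, folded w_def, unfolded w2 nn, OF N(1), folded k_def c_def]
  have "?C * (k t * D\<Phi> 0 t p j) = of_nat i * (c t * g - 2 * gm) + of_nat (n - i) * (c t * g - 2 * gp)"
    using ct(1) by (simp only: N(2) i(2) D g_def gm_def gp_def)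
  also have "\<dots> = of_nat i * (c t * g) - 2 * (of_nat i * gm) + (of_nat (n - i) * (c t * g) - 2 * (of_nat (n - i) * gp))"
    by (simp add: algebra_simps)
  also have "\<dots> = ?C * (2 * l * c t * \<Phi> 0 t p j - 2 * (l + j) * \<Phi> 0 t p (j - 1) - 2 * (l - j) * \<Phi> 0 t p (j + 1))"
    unfolding Gm Gp G0 unfolding ii[symmetric] jj[symmetric] by (simp add: algebra_simps)
  finally show "k t * D\<Phi> 0 t p j = 2 * l * c t * \<Phi> 0 t p j - 2 * (l + j) * \<Phi> 0 t p (j - 1) - 2 * (l - j) * \<Phi> 0 t p (j + 1)"
    using C by simp
  have "?C * (k t * (2 * (l - real N) * \<Phi> 0 t p j)) = of_nat i * (c t * g - 2 * gm) - of_nat (n - i) * (c t * g - 2 * gp)"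
    using ct(2) by (simp only: N(2) i(2) \<Phi> g_def gm_def gp_def)
  also have "\<dots> = of_nat i * (c t * g) - 2 * (of_nat i * gm) - (of_nat (n - i) * (c t * g) - 2 * (of_nat (n - i) * gp))"
    by (simp add: algebra_simps)
  also have "\<dots> = ?C * (2 * j * c t * \<Phi> 0 t p j - 2 * (l + j) * \<Phi> 0 t p (j - 1) + 2 * (l - j) * \<Phi> 0 t p (j + 1))"
    unfolding Gm Gp G0 unfolding ii[symmetric] jj[symmetric] by (simp add: algebra_simps)
  finally show "2 * k t * p * \<Phi> 0 t p j = 2 * j * c t * \<Phi> 0 t p j - 2 * (l + j) * \<Phi> 0 t p (j - 1) + 2 * (l - j) * \<Phi> 0 t p (j + 1)"
    using C by (simp add: mult_ac N)
qed

text \<open>Up to invertible scaling of rows and reversal of their order, this is the coefficient matrix of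
  \<open>cartan_matrix_inverse\<close>.\<close>

lemma \<Phi>0_invertible:
  assumes "exp (\<i> * of_real t) ^ 4 \<noteq> (1::complex)"
  obtains B where "meq (wts l) (wts l) (mmul (wts l) (\<Phi> 0 t) B) kd" "meq (wts l) (wts l) (mmul (wts l) B (\<Phi> 0 t)) kd"
proof -
  define w where "w = exp (\<i> * complex_of_real t)"
  obtain B0 :: "nat \<Rightarrow> nat \<Rightarrow> complex" where B0:
    "\<And>N j. N \<le> n \<Longrightarrow> j \<le> n \<Longrightarrow> (\<Sum>i\<le>n. coeff (cartan_poly w i (n - i)) N * B0 i j) = kd N j"
    "\<And>i j. i \<le> n \<Longrightarrow> j \<le> n \<Longrightarrow> (\<Sum>N\<le>n. B0 i N * coeff (cartan_poly w j (n - j)) N) = kd i j"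
    using cartan_matrix_inverse[of w n] assms unfolding w_def by auto
  \<comment> \<open>column \<open>i - l\<close> has number \<open>i\<close>, row \<open>l - N\<close> has number \<open>N\<close>\<close>
  define B where "B = (\<lambda>j p. B0 (nat \<lfloor>l + j\<rfloor>) (nat \<lfloor>l - p\<rfloor>) * of_nat (n choose nat \<lfloor>l - p\<rfloor>))"
  have B: "B (real i - l) (l - real N) = B0 i N * of_nat (n choose N)" for i N
    by (simp add: B_def)
  have up: "wts l = (\<lambda>i. real i - l) ` {..n}" by (rule wts_eq_image[OF l])
  have dn: "wts l = (\<lambda>N. l - real N) ` {..n}"
  proof -
    have "wts l = uminus ` wts l"
      using wts_uminus[OF half_integral] by (force intro: image_eqI[of _ _ "- x" for x])
    also have "\<dots> = (\<lambda>N. l - real N) ` {..n}" by (subst up) (simp add: image_image)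
    finally show ?thesis .
  qed
  have su: "(\<Sum>r\<in>wts l. f r) = (\<Sum>i\<le>n. f (real i - l))" for f :: "real \<Rightarrow> complex"
    unfolding up by (simp add: sum.reindex inj_on_def)
  have sd: "(\<Sum>r\<in>wts l. f r) = (\<Sum>N\<le>n. f (l - real N))" for f :: "real \<Rightarrow> complex"
    unfolding dn by (simp add: sum.reindex inj_on_def)
  show ?thesis
  proof (rule that[of B]; unfold meq_def; intro ballI)
    fix p p' assume "p \<in> wts l" "p' \<in> wts l"
    then obtain N N' where N: "N \<le> n" "p = l - real N" and N': "N' \<le> n" "p' = l - real N'"
      by (metis wts_cases)
    have C: "(of_nat (n choose N) :: complex) \<noteq> 0" using N by simp
    have "of_nat (n choose N) * mmul (wts l) (\<Phi> 0 t) B p p'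
        = (\<Sum>i\<le>n. of_nat (n choose N) * \<Phi> 0 t (l - real N) (real i - l) * B0 i N') * of_nat (n choose N')"
      unfolding mmul_def su N N' B sum_distrib_left sum_distrib_right by (simp add: mult_ac)
    also have "\<dots> = (\<Sum>i\<le>n. coeff (cartan_poly w i (n - i)) N * B0 i N') * of_nat (n choose N')"
      by (simp add: \<Phi>0_eq[OF _ N(1)] w_def)
    also have "\<dots> = of_nat (n choose N) * kd p p'"
      using B0(1)[OF N(1) N'(1)] by (simp add: N N' kd_def)
    finally show "mmul (wts l) (\<Phi> 0 t) B p p' = kd p p'" using C by simp
  next
    fix j j' assume "j \<in> wts l" "j' \<in> wts l"
    then obtain i i' where i: "i \<le> n" "j = real i - l" and i': "i' \<le> n" "j' = real i' - l"
      unfolding up by auto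
    have "mmul (wts l) B (\<Phi> 0 t) j j'
        = (\<Sum>N\<le>n. B0 i N * (of_nat (n choose N) * \<Phi> 0 t (l - real N) (real i' - l)))"
      unfolding mmul_def sd i i' B by (simp add: mult_ac)
    also have "\<dots> = (\<Sum>N\<le>n. B0 i N * coeff (cartan_poly w i' (n - i')) N)"
      by (rule sum.cong) (simp_all add: \<Phi>0_eq[OF i'(1)] w_def)
    also have "\<dots> = kd j j'" using B0(2)[OF i(1) i'(1)] by (simp add: i i' kd_def)
    finally show "mmul (wts l) B (\<Phi> 0 t) j j' = kd j j'" .
  qed
qed

lemma q_deriv: "(q has_vector_derivative \<i> * (2 * q t)) (at t)"
proof -
  have "((\<lambda>z. exp (2 * \<i> * z)) has_field_derivative \<i> * (2 * exp (2 * \<i> * of_real t))) (at (of_real t))"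
    by (auto intro!: derivative_eq_intros)
  from has_vector_derivative_real_field[OF this, of UNIV] show ?thesis by (simp add: q_def[abs_def])
qed

lemma inverse_q_deriv: "((\<lambda>t. inverse (q t)) has_vector_derivative - (\<i> * (2 * inverse (q t)))) (at t)"
proof -
  have "((\<lambda>z. exp (- (2 * \<i> * z))) has_field_derivative - (\<i> * (2 * exp (- (2 * \<i> * of_real t))))) (at (of_real t))"
    by (auto intro!: derivative_eq_intros)
  from has_vector_derivative_real_field[OF this, of UNIV] show ?thesis by (simp add: q_def exp_minus)
qed

lemma k_deriv: "(k has_vector_derivative \<i> * (2 * c t)) (at t)"
  using has_vector_derivative_diff[OF q_deriv inverse_q_deriv, of t]
  by (simp add: k_def[abs_def] c_def algebra_simps)

lemma c_deriv: "(c has_vector_derivative \<i> * (2 * k t)) (at t)"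
  using has_vector_derivative_add[OF q_deriv inverse_q_deriv, of t]
  by (simp add: c_def[abs_def] k_def algebra_simps)

lemma poly_c_deriv:
  "((\<lambda>t. poly f (c t / 2)) has_vector_derivative \<i> * (k t * poly (pderiv f) (c t / 2))) (at t)"
proof -
  have "((\<lambda>t. c t / 2) has_vector_derivative \<i> * k t) (at t)"
    using has_vector_derivative_mult_right[OF c_deriv, of "1/2" t] by simp
  from field_vector_diff_chain_at[OF this poly_DERIV, of f] show ?thesis
    by (simp add: o_def mult_ac)
qed

lemma c_eq_cos: "c t / 2 = of_real (cos (2 * t))"
  unfolding c_def q_def cos_of_real[symmetric] cos_exp_eq by (simp add: exp_minus mult_ac)

lemma k_eq_sin: "k t = 2 * \<i> * of_real (sin (2 * t))"
  unfolding k_def q_def sin_of_real[symmetric] sin_exp_eq by (simp add: exp_minus mult_ac)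

lemma k_square: "(k t)\<^sup>2 = (c t)\<^sup>2 - 4"
proof -
  have "q t * inverse (q t) = 1" by (simp add: q_def)
  then show ?thesis unfolding k_def c_def by algebra
qed

lemma regular:
  assumes "0 < t" "t < pi / 2"
  shows "k t \<noteq> 0" "exp (\<i> * of_real t) ^ 4 \<noteq> (1::complex)"
proof -
  have "sin (2 * t) > 0" using assms by (intro sin_gt_zero) auto
  then show k: "k t \<noteq> 0" unfolding k_eq_sin by simp
  have "exp (\<i> * complex_of_real t) ^ 4 = q t * q t"
    by (simp add: q_def mult_ac flip: exp_of_nat_mult exp_add)
  moreover have "q t * q t = 1 \<Longrightarrow> k t = 0"
    by (simp add: k_def inverse_unique)
  ultimately show "exp (\<i> * of_real t) ^ 4 \<noteq> (1::complex)" using k by auto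
qed

lemma \<Phi>0_cancel:
  assumes "0 < t" "t < pi / 2" "s \<in> wts l"
    and z: "\<And>p. p \<in> wts l \<Longrightarrow> (\<Sum>r\<in>wts l. \<Phi> 0 t p r * v r) = 0"
  shows "v s = 0"
proof -
  let ?W = "wts l"
  obtain B where B: "meq ?W ?W (mmul ?W B (\<Phi> 0 t)) kd"
    using \<Phi>0_invertible[OF regular(2)[OF assms(1,2)]] by blast
  have "v s = mmul ?W (mmul ?W B (\<Phi> 0 t)) (\<lambda>r _. v r) s ()"
    using mmul_kd_left[of ?W s "mmul ?W B (\<Phi> 0 t)" 1 "\<lambda>r _. v r" "()"] B assms(3) finite_wts
    by (simp add: meq_def)
  also have "\<dots> = mmul ?W B (mmul ?W (\<Phi> 0 t) (\<lambda>r _. v r)) s ()" by (rule mmul_assoc)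
  also have "\<dots> = 0"
    unfolding mmul_def[of _ B] by (rule sum.neutral) (use z in \<open>simp add: mmul_def\<close>)
  finally show ?thesis .
qed

lemma \<Phi>0_Ulu:
  assumes "r \<in> wts l"
  shows "(\<Sum>s\<in>wts l. \<Phi> 0 t p s * of_real (Ulu l s r))
    = 2 * (l - r) * \<Phi> 0 t p (r + 1) - 2 * (l + r) * \<Phi> 0 t p (r - 1)"
proof -
  have "(\<Sum>s\<in>wts l. \<Phi> 0 t p s * of_real (Ulu l s r))
    = (\<Sum>s\<in>wts l. \<Phi> 0 t p s * of_real (2 * (l - r) * kd s (r + 1)))
    - (\<Sum>s\<in>wts l. \<Phi> 0 t p s * of_real (2 * (l + r) * kd s (r - 1)))"
    unfolding sum_subtractf[symmetric] by (rule sum.cong) (auto simp: Ulu_def kd_def algebra_simps)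
  also have "(\<Sum>s\<in>wts l. \<Phi> 0 t p s * of_real (2 * (l - r) * kd s (r + 1))) = of_real (2 * (l - r)) * \<Phi> 0 t p (r + 1)"
    by (rule sum_kd_real[OF finite_wts]) (use wts_raise_iff[OF half_integral assms] in auto)
  also have "(\<Sum>s\<in>wts l. \<Phi> 0 t p s * of_real (2 * (l + r) * kd s (r - 1))) = of_real (2 * (l + r)) * \<Phi> 0 t p (r - 1)"
    by (rule sum_kd_real[OF finite_wts]) (use wts_lower_iff[OF half_integral assms] in auto)
  finally show ?thesis by simp
qed

lemma \<Phi>0_Smat:
  assumes "r \<in> wts l"
  shows "(\<Sum>s\<in>wts l. \<Phi> 0 t p s * of_real (Smat l s r))
    = - (l - r) * \<Phi> 0 t p (r + 1) - (l + r) * \<Phi> 0 t p (r - 1)"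
proof -
  have "(\<Sum>s\<in>wts l. \<Phi> 0 t p s * of_real (Smat l s r))
    = (\<Sum>s\<in>wts l. \<Phi> 0 t p s * of_real (- (l - r) * kd s (r + 1)))
    - (\<Sum>s\<in>wts l. \<Phi> 0 t p s * of_real ((l + r) * kd s (r - 1)))"
    unfolding sum_subtractf[symmetric] by (rule sum.cong) (auto simp: Smat_def kd_def algebra_simps)
  also have "(\<Sum>s\<in>wts l. \<Phi> 0 t p s * of_real (- (l - r) * kd s (r + 1))) = of_real (- (l - r)) * \<Phi> 0 t p (r + 1)"
    by (rule sum_kd_real[OF finite_wts]) (use wts_raise_iff[OF half_integral assms] in auto)
  also have "(\<Sum>s\<in>wts l. \<Phi> 0 t p s * of_real ((l + r) * kd s (r - 1))) = of_real (l + r) * \<Phi> 0 t p (r - 1)"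
    by (rule sum_kd_real[OF finite_wts]) (use wts_lower_iff[OF half_integral assms] in auto)
  finally show ?thesis by simp
qed

lemma \<Phi>0_Udiag:
  assumes "r \<in> wts l"
  shows "(\<Sum>s\<in>wts l. \<Phi> 0 t p s * of_real (Udiag l s r)) = 2 * r * \<Phi> 0 t p r"
proof -
  have "(\<Sum>s\<in>wts l. \<Phi> 0 t p s * of_real (Udiag l s r)) = (\<Sum>s\<in>wts l. \<Phi> 0 t p s * of_real (2 * r * kd s r))"
    by (rule sum.cong) (auto simp: Udiag_def kd_def)
  also have "\<dots> = of_real (2 * r) * \<Phi> 0 t p r"
    by (rule sum_kd_real[OF finite_wts]) (use assms in auto)
  finally show ?thesis by simp
qed

text \<open>Conjugating the diagonal matrix of weights by the degree-zero matrix gives, up to scalar factors,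
  the leading coefficient of \<open>Delta\<close>.\<close>

lemma \<Phi>0_P:
  fixes p r t :: real
  assumes "p \<in> wts l" "r \<in> wts l"
  shows "2 * k t * p * \<Phi> 0 t p r = (\<Sum>s\<in>wts l. \<Phi> 0 t p s * (c t * of_real (Udiag l s r) + of_real (Ulu l s r)))"
proof -
  have "(\<Sum>s\<in>wts l. \<Phi> 0 t p s * (c t * of_real (Udiag l s r) + of_real (Ulu l s r)))
    = c t * (\<Sum>s\<in>wts l. \<Phi> 0 t p s * of_real (Udiag l s r)) + (\<Sum>s\<in>wts l. \<Phi> 0 t p s * of_real (Ulu l s r))"
    unfolding sum_distrib_left sum.distrib[symmetric] by (rule sum.cong) (simp_all add: algebra_simps)
  then show ?thesis
    unfolding \<Phi>0_Udiag[OF assms(2)] \<Phi>0_Ulu[OF assms(2)] \<Phi>0_contiguous(2)[OF assms] by (simp add: algebra_simps)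
qed

text \<open>The logarithmic derivative of the degree-zero matrix; it supplies the matrix \<open>Smat\<close> in the
  first-order coefficient of \<open>Omega\<close>.\<close>

lemma \<Phi>0_D:
  fixes p r t :: real
  assumes "p \<in> wts l" "r \<in> wts l"
  shows "k t * D\<Phi> 0 t p r = 2 * l * c t * \<Phi> 0 t p r + 2 * (\<Sum>s\<in>wts l. \<Phi> 0 t p s * of_real (Smat l s r))"
  unfolding \<Phi>0_contiguous(1)[OF assms] \<Phi>0_Smat[OF assms(2)] by (simp add: algebra_simps)

end

section \<open>Conjugation by the degree-zero function\<close>

locale spherical_polynomials = spherical_family +
  fixes R :: "nat \<Rightarrow> real polymat"
  assumes R: "\<And>d w. w \<noteq> 0 \<Longrightarrow> w ^ 4 \<noteq> 1 \<Longrightarrow>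
      meq (wts l) (wts l) (\<lambda>p j. poly (R d p j) (phi w)) (Qfun T \<beta> l d w)"
begin

text \<open>This is the definition of \<open>R\<close> multiplied by the degree-zero matrix, which is legitimate as soon as that
  matrix is known to be invertible: otherwise the choice of \<open>minv\<close> carries no information.\<close>

lemma factorization:
  assumes t: "0 < t" "t < pi / 2" and j: "j \<in> wts l"
  shows "\<Phi> d t p j = (\<Sum>r\<in>wts l. \<Phi> 0 t p r * poly (R d r j) (c t / 2))"
proof (cases "p \<in> wts l")
  case False
  then show ?thesis by (simp add: \<Phi>_def)
next
  case p: True
  let ?W = "wts l"
  define w where "w = exp (\<i> * complex_of_real t)"
  define fs where "fs = (\<lambda>d. full_spherical T \<beta> l d w)"
  have fs: "fs d p j = \<Phi> d t p j" if "p \<in> ?W" for d p j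
    using that by (simp add: fs_def \<Phi>_def w_def)
  have w: "w \<noteq> 0" "w ^ 4 \<noteq> 1" using regular(2)[OF t] by (auto simp: w_def)
  have "w\<^sup>2 = q t" by (simp add: w_def q_def mult_ac flip: exp_double)
  then have ph: "phi w = c t / 2" by (simp add: phi_def c_def)
  obtain B where B: "meq ?W ?W (mmul ?W (\<Phi> 0 t) B) kd" "meq ?W ?W (mmul ?W B (\<Phi> 0 t)) kd"
    using \<Phi>0_invertible[OF regular(2)[OF t]] by blast
  have "meq ?W ?W (mmul ?W (fs 0) B) kd" "meq ?W ?W (mmul ?W B (fs 0)) kd"
    using B by (simp_all add: meq_def mmul_def fs cong: sum.cong)
  then have inv: "meq ?W ?W (mmul ?W (fs 0) (minv ?W (fs 0))) kd"
    by (rule minv_inverse)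
  have Q: "poly (R d r j) (c t / 2) = mmul ?W (minv ?W (fs 0)) (fs d) r j" if "r \<in> ?W" for r
    using R[OF w, of d] that j by (simp add: meq_def ph Qfun_def fs_def)
  have "(\<Sum>r\<in>?W. \<Phi> 0 t p r * poly (R d r j) (c t / 2)) = mmul ?W (fs 0) (mmul ?W (minv ?W (fs 0)) (fs d)) p j"
    unfolding mmul_def[of _ "fs 0"]
    by (rule sum.cong) (simp_all add: fs p Q)
  also have "\<dots> = mmul ?W (mmul ?W (fs 0) (minv ?W (fs 0))) (fs d) p j"
    by (rule mmul_assoc[symmetric])
  also have "\<dots> = 1 * fs d p j"
    by (rule mmul_kd_left) (use finite_wts p inv in \<open>auto simp: meq_def\<close>)
  finally show ?thesis using p by (simp add: fs)
qed

lemma factorization_deriv: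
  assumes t: "0 < t" "t < pi / 2" and j: "j \<in> wts l"
  shows "D\<Phi> d t p j = (\<Sum>r\<in>wts l. D\<Phi> 0 t p r * poly (R d r j) (c t / 2)
      + k t * \<Phi> 0 t p r * poly (pderiv (R d r j)) (c t / 2))"
proof -
  have "((\<lambda>t. \<Sum>r\<in>wts l. \<Phi> 0 t p r * poly (R d r j) (c t / 2)) has_vector_derivative
     (\<Sum>r\<in>wts l. \<Phi> 0 t p r * (\<i> * (k t * poly (pderiv (R d r j)) (c t / 2))) + \<i> * D\<Phi> 0 t p r * poly (R d r j) (c t / 2))) (at t)"
    by (intro has_vector_derivative_sum has_vector_derivative_mult \<Phi>_derivs(1) poly_c_deriv)
  then have "((\<lambda>t. \<Phi> d t p j) has_vector_derivative
     (\<Sum>r\<in>wts l. \<Phi> 0 t p r * (\<i> * (k t * poly (pderiv (R d r j)) (c t / 2))) + \<i> * D\<Phi> 0 t p r * poly (R d r j) (c t / 2))) (at t)"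
    by (rule has_vector_derivative_transform_within_open[where S = "{0<..<pi/2}"])
       (use t j in \<open>auto simp: factorization\<close>)
  from vector_derivative_unique_at[OF \<Phi>_derivs(1)[OF j] this]
  have "\<i> * D\<Phi> d t p j = \<i> * (\<Sum>r\<in>wts l. D\<Phi> 0 t p r * poly (R d r j) (c t / 2)
      + k t * \<Phi> 0 t p r * poly (pderiv (R d r j)) (c t / 2))"
    unfolding sum_distrib_left by (simp add: algebra_simps)
  then show ?thesis by simp
qed

lemma factorization_deriv2:
  assumes t: "0 < t" "t < pi / 2" and j: "j \<in> wts l"
  shows "D2\<Phi> d t p j = (\<Sum>r\<in>wts l. D2\<Phi> 0 t p r * poly (R d r j) (c t / 2)
      + 2 * (k t * D\<Phi> 0 t p r) * poly (pderiv (R d r j)) (c t / 2)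
      + 2 * c t * \<Phi> 0 t p r * poly (pderiv (R d r j)) (c t / 2)
      + (k t)\<^sup>2 * \<Phi> 0 t p r * poly (pderiv (pderiv (R d r j))) (c t / 2))"
proof -
  let ?P = "\<lambda>r t. poly (R d r j) (c t / 2)" and ?P1 = "\<lambda>r t. poly (pderiv (R d r j)) (c t / 2)"
    and ?P2 = "\<lambda>r t. poly (pderiv (pderiv (R d r j))) (c t / 2)"
  have "((\<lambda>t. \<Sum>r\<in>wts l. D\<Phi> 0 t p r * ?P r t + k t * \<Phi> 0 t p r * ?P1 r t) has_vector_derivative
     (\<Sum>r\<in>wts l. (D\<Phi> 0 t p r * (\<i> * (k t * ?P1 r t)) + \<i> * D2\<Phi> 0 t p r * ?P r t)
       + (k t * \<Phi> 0 t p r * (\<i> * (k t * ?P2 r t)) + (k t * (\<i> * D\<Phi> 0 t p r) + \<i> * (2 * c t) * \<Phi> 0 t p r) * ?P1 r t))) (at t)"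
    by (intro has_vector_derivative_sum has_vector_derivative_add has_vector_derivative_mult
        \<Phi>_derivs(1,2) poly_c_deriv k_deriv)
  then have "((\<lambda>t. D\<Phi> d t p j) has_vector_derivative
     (\<Sum>r\<in>wts l. (D\<Phi> 0 t p r * (\<i> * (k t * ?P1 r t)) + \<i> * D2\<Phi> 0 t p r * ?P r t)
       + (k t * \<Phi> 0 t p r * (\<i> * (k t * ?P2 r t)) + (k t * (\<i> * D\<Phi> 0 t p r) + \<i> * (2 * c t) * \<Phi> 0 t p r) * ?P1 r t))) (at t)"
    by (rule has_vector_derivative_transform_within_open[where S = "{0<..<pi/2}"])
       (use t j in \<open>auto simp: factorization_deriv\<close>)
  from vector_derivative_unique_at[OF \<Phi>_derivs(2)[OF j] this]
  have "\<i> * D2\<Phi> d t p j = \<i> * (\<Sum>r\<in>wts l. D2\<Phi> 0 t p r * ?P r t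
      + 2 * (k t * D\<Phi> 0 t p r) * ?P1 r t + 2 * c t * \<Phi> 0 t p r * ?P1 r t + (k t)\<^sup>2 * \<Phi> 0 t p r * ?P2 r t)"
    unfolding sum_distrib_left by (simp add: algebra_simps power2_eq_square)
  then show ?thesis by simp
qed

text \<open>The columns of the degree-zero matrix satisfy the radial equation with \<open>d = 0\<close>. Subtracting it, with
  the entries of \<open>R\<close> as coefficients, from the equation for degree \<open>d\<close> leaves the derivative terms only,
  and \<open>\<Phi>0_P\<close> brings them to the form of the degree-zero matrix times a vector.\<close>

lemma delta_pointwise:
  assumes t: "0 < t" "t < pi / 2" and j: "j \<in> wts l" and s: "s \<in> wts l"
  shows "s * (l + 1) * poly (R d s j) (c t / 2)
      + (\<Sum>r\<in>wts l. (c t * of_real (Udiag l s r) + of_real (Ulu l s r)) * poly (pderiv (R d r j)) (c t / 2)) / 4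
    = j * (d + l + 1) * poly (R d s j) (c t / 2)"
proof -
  let ?W = "wts l"
  let ?P = "\<lambda>r. poly (R d r j) (c t / 2)" and ?P1 = "\<lambda>r. poly (pderiv (R d r j)) (c t / 2)"
  define M where "M = (\<lambda>s r. c t * of_real (Udiag l s r) + of_real (Ulu l s r))"
  define S where "S = (\<lambda>s. \<Sum>r\<in>?W. M s r * ?P1 r)"
  define v where "v = (\<lambda>s. (of_real (j * (d + l + 1)) - of_real (s * (l + 1))) * ?P s - S s / 4)"
  have "v s = 0"
  proof (rule \<Phi>0_cancel[OF t s])
    fix p assume p: "p \<in> ?W"
    let ?a = "complex_of_real ((l - p) * (l + p + 1))" and ?b = "complex_of_real ((l + p) * (l - p + 1))"
    let ?Ld = "complex_of_real (j * (d + l + 1))" and ?L0 = "\<lambda>r. complex_of_real (r * (l + 1))"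
    note k0 = regular(1)[OF t]
    have "(k t)\<^sup>2 * (\<Sum>r\<in>?W. (?Ld * \<Phi> 0 t p r * ?P r - of_real (p / 2) * (D\<Phi> 0 t p r * ?P r + k t * \<Phi> 0 t p r * ?P1 r)))
       = k t * (\<Sum>r\<in>?W. (?a * \<Phi> 0 t (p + 1) r - ?b * \<Phi> 0 t (p - 1) r + c t * p * \<Phi> 0 t p r) * ?P r)"
      using \<Phi>_derivs(4)[OF j p, of t d] unfolding factorization[OF t j, of d] factorization_deriv[OF t j]
      by (simp add: sum_distrib_left sum_distrib_right sum.distrib sum_subtractf algebra_simps)
    also have "\<dots> = (\<Sum>r\<in>?W. (k t)\<^sup>2 * (?L0 r * \<Phi> 0 t p r - of_real (p / 2) * D\<Phi> 0 t p r) * ?P r)"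
      unfolding sum_distrib_left
    proof (rule sum.cong[OF refl])
      fix r assume "r \<in> ?W"
      from \<Phi>_derivs(4)[OF this p, of t 0]
      show "k t * ((?a * \<Phi> 0 t (p + 1) r - ?b * \<Phi> 0 t (p - 1) r + c t * p * \<Phi> 0 t p r) * ?P r)
        = (k t)\<^sup>2 * (?L0 r * \<Phi> 0 t p r - of_real (p / 2) * D\<Phi> 0 t p r) * ?P r"
        by simp
    qed
    finally have "(k t)\<^sup>2 * (\<Sum>r\<in>?W. (?Ld - ?L0 r) * \<Phi> 0 t p r * ?P r - 2 * k t * p * \<Phi> 0 t p r * ?P1 r / 4) = 0"
      by (simp add: sum_distrib_left sum_distrib_right sum.distrib sum_subtractf algebra_simps)
    then have "0 = (\<Sum>r\<in>?W. (?Ld - ?L0 r) * \<Phi> 0 t p r * ?P r - 2 * k t * p * \<Phi> 0 t p r * ?P1 r / 4)"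
      using k0 by simp
    also have "\<dots> = (\<Sum>r\<in>?W. (?Ld - ?L0 r) * \<Phi> 0 t p r * ?P r) - (\<Sum>r\<in>?W. (\<Sum>s\<in>?W. \<Phi> 0 t p s * M s r) * ?P1 r) / 4"
      unfolding sum_subtractf sum_divide_distrib by (simp add: \<Phi>0_P[OF p] M_def)
    also have "(\<Sum>r\<in>?W. (\<Sum>s\<in>?W. \<Phi> 0 t p s * M s r) * ?P1 r) = (\<Sum>s\<in>?W. \<Phi> 0 t p s * S s)"
      unfolding S_def sum_distrib_left sum_distrib_right by (subst sum.swap) (simp add: mult.assoc)
    also have "(\<Sum>r\<in>?W. (?Ld - ?L0 r) * \<Phi> 0 t p r * ?P r) - (\<Sum>s\<in>?W. \<Phi> 0 t p s * S s) / 4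
      = (\<Sum>r\<in>?W. \<Phi> 0 t p r * v r)"
      unfolding v_def sum_divide_distrib sum_subtractf[symmetric]
      by (rule sum.cong) (simp_all add: algebra_simps)
    finally show "(\<Sum>r\<in>?W. \<Phi> 0 t p r * v r) = 0" by simp
  qed
  then show ?thesis unfolding v_def S_def M_def by (simp add: algebra_simps)
qed

text \<open>As for \<open>delta_pointwise\<close>, with the second-order equation. The first derivative of \<open>R\<close> collects three
  contributions: the logarithmic derivative of the degree-zero matrix, the derivative \<open>2 c\<close> of the factor
  \<open>k\<close> from the chain rule, and the first-order term \<open>k c\<close> of the radial equation. The last two add
  up to the constant \<open>3\<close> in \<open>2 l + 3\<close>.\<close>

lemma omega_pointwise:
  assumes t: "0 < t" "t < pi / 2" and j: "j \<in> wts l" and s: "s \<in> wts l"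
  defines "lam \<equiv> (\<lambda>(d::nat) j. complex_of_real ((real d + l)\<^sup>2 / 2 + j\<^sup>2 / 2 + real d + l))"
  shows "lam 0 s * poly (R d s j) (c t / 2)
      + (2 * l + 3) * c t / 4 * poly (pderiv (R d s j)) (c t / 2)
      + (\<Sum>r\<in>wts l. of_real (Smat l s r) * poly (pderiv (R d r j)) (c t / 2)) / 2
      + (k t)\<^sup>2 / 8 * poly (pderiv (pderiv (R d s j))) (c t / 2)
    = lam d j * poly (R d s j) (c t / 2)"
proof -
  let ?W = "wts l"
  let ?P = "\<lambda>r. poly (R d r j) (c t / 2)" and ?P1 = "\<lambda>r. poly (pderiv (R d r j)) (c t / 2)"
    and ?P2 = "\<lambda>r. poly (pderiv (pderiv (R d r j))) (c t / 2)"
  define S where "S = (\<lambda>s. \<Sum>r\<in>?W. of_real (Smat l s r) * ?P1 r)"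
  define v where "v = (\<lambda>s. (lam d j - lam 0 s) * ?P s - (2 * l + 3) * c t / 4 * ?P1 s
     - S s / 2 - (k t)\<^sup>2 / 8 * ?P2 s)"
  have "v s = 0"
  proof (rule \<Phi>0_cancel[OF t s])
    fix p assume p: "p \<in> ?W"
    let ?a = "complex_of_real ((l - p) * (l + p + 1))" and ?b = "complex_of_real ((l + p) * (l - p + 1))"
    let ?p = "complex_of_real (p\<^sup>2 / 2)"
    note k0 = regular(1)[OF t]
    define X where "X = (\<lambda>r. (?b * (c t * \<Phi> 0 t (p - 1) r - 2 * \<Phi> 0 t p r)
        + ?a * (c t * \<Phi> 0 t (p + 1) r - 2 * \<Phi> 0 t p r) + k t * c t * D\<Phi> 0 t p r / 2) * ?P r)"
    define Y where "Y = (\<lambda>r. D2\<Phi> 0 t p r * ?P r + 2 * (k t * D\<Phi> 0 t p r) * ?P1 r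
        + 2 * c t * \<Phi> 0 t p r * ?P1 r + (k t)\<^sup>2 * \<Phi> 0 t p r * ?P2 r)"
    have X: "X r = (k t)\<^sup>2 * (lam 0 r * \<Phi> 0 t p r - ?p * \<Phi> 0 t p r - D2\<Phi> 0 t p r / 8) * ?P r"
      if "r \<in> ?W" for r
      using \<Phi>_derivs(3)[OF that p, of t 0] by (simp add: lam_def X_def)
    have "(k t)\<^sup>2 * (lam d j * (\<Sum>r\<in>?W. \<Phi> 0 t p r * ?P r) - ?p * (\<Sum>r\<in>?W. \<Phi> 0 t p r * ?P r) - (\<Sum>r\<in>?W. Y r) / 8)
       = ?b * (c t * (\<Sum>r\<in>?W. \<Phi> 0 t (p - 1) r * ?P r) - 2 * (\<Sum>r\<in>?W. \<Phi> 0 t p r * ?P r))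
       + ?a * (c t * (\<Sum>r\<in>?W. \<Phi> 0 t (p + 1) r * ?P r) - 2 * (\<Sum>r\<in>?W. \<Phi> 0 t p r * ?P r))
       + k t * c t * (\<Sum>r\<in>?W. D\<Phi> 0 t p r * ?P r + k t * \<Phi> 0 t p r * ?P1 r) / 2"
      using \<Phi>_derivs(3)[OF j p, of t d]
      unfolding factorization[OF t j, of d] factorization_deriv[OF t j] factorization_deriv2[OF t j]
      by (simp only: lam_def Y_def)
    also have "\<dots> = (\<Sum>r\<in>?W. X r + (k t)\<^sup>2 * c t / 2 * \<Phi> 0 t p r * ?P1 r)"
      unfolding X_def sum_distrib_left sum_divide_distrib sum.distrib[symmetric] sum_subtractf[symmetric]
      by (rule sum.cong) (simp_all add: algebra_simps add_divide_distrib power2_eq_square)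
    finally have "(k t)\<^sup>2 * (\<Sum>r\<in>?W. lam d j * (\<Phi> 0 t p r * ?P r) - ?p * (\<Phi> 0 t p r * ?P r) - Y r / 8)
        - (\<Sum>r\<in>?W. X r + (k t)\<^sup>2 * c t / 2 * \<Phi> 0 t p r * ?P1 r) = 0"
      by (simp add: sum_distrib_left sum_divide_distrib sum_subtractf)
    also have "(k t)\<^sup>2 * (\<Sum>r\<in>?W. lam d j * (\<Phi> 0 t p r * ?P r) - ?p * (\<Phi> 0 t p r * ?P r) - Y r / 8)
        - (\<Sum>r\<in>?W. X r + (k t)\<^sup>2 * c t / 2 * \<Phi> 0 t p r * ?P1 r)
      = (k t)\<^sup>2 * (\<Sum>r\<in>?W. \<Phi> 0 t p r * ((lam d j - lam 0 r) * ?P r - 3 * c t / 4 * ?P1 r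
        - (k t)\<^sup>2 / 8 * ?P2 r) - k t * D\<Phi> 0 t p r * ?P1 r / 4)"
      unfolding sum_distrib_left sum_subtractf[symmetric]
      by (rule sum.cong) (simp_all add: X Y_def algebra_simps add_divide_distrib diff_divide_distrib)
    finally have "(k t)\<^sup>2 * (\<Sum>r\<in>?W. \<Phi> 0 t p r * ((lam d j - lam 0 r) * ?P r - 3 * c t / 4 * ?P1 r
        - (k t)\<^sup>2 / 8 * ?P2 r) - k t * D\<Phi> 0 t p r * ?P1 r / 4) = 0" .
    then have "0 = (\<Sum>r\<in>?W. \<Phi> 0 t p r * ((lam d j - lam 0 r) * ?P r - 3 * c t / 4 * ?P1 r
        - (k t)\<^sup>2 / 8 * ?P2 r) - k t * D\<Phi> 0 t p r * ?P1 r / 4)"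
      using k0 by simp
    also have "\<dots> = (\<Sum>r\<in>?W. \<Phi> 0 t p r * ((lam d j - lam 0 r) * ?P r - (2 * l + 3) * c t / 4 * ?P1 r - (k t)\<^sup>2 / 8 * ?P2 r))
        - (\<Sum>r\<in>?W. (\<Sum>s\<in>?W. \<Phi> 0 t p s * of_real (Smat l s r)) * ?P1 r) / 2"
      unfolding sum_subtractf[symmetric] sum_divide_distrib
      by (rule sum.cong) (simp_all add: \<Phi>0_D[OF p] add_divide_distrib algebra_simps)
    also have "(\<Sum>r\<in>?W. (\<Sum>s\<in>?W. \<Phi> 0 t p s * of_real (Smat l s r)) * ?P1 r)
        = (\<Sum>s\<in>?W. \<Phi> 0 t p s * S s)"
      unfolding S_def sum_distrib_left sum_distrib_right by (subst sum.swap) (simp add: mult.assoc)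
    also have "(\<Sum>r\<in>?W. \<Phi> 0 t p r * ((lam d j - lam 0 r) * ?P r - (2 * l + 3) * c t / 4 * ?P1 r - (k t)\<^sup>2 / 8 * ?P2 r))
        - (\<Sum>s\<in>?W. \<Phi> 0 t p s * S s) / 2 = (\<Sum>r\<in>?W. \<Phi> 0 t p r * v r)"
      unfolding v_def sum_divide_distrib sum_subtractf[symmetric]
      by (rule sum.cong) (simp_all add: algebra_simps)
    finally show "(\<Sum>r\<in>?W. \<Phi> 0 t p r * v r) = 0" by simp
  qed
  then show ?thesis unfolding v_def S_def by (simp add: algebra_simps)
qed

text \<open>On the arc \<open>c t = 2 z\<close> and \<open>(k t)\<^sup>2 = 4 (z\<^sup>2 - 1)\<close>; the factor \<open>2\<close> between \<open>omega_pointwise\<close> and the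
  operator is that between the Casimir eigenvalues and \<open>Lam\<close>.\<close>

lemma Omega_eigen:
  assumes s: "s \<in> wts l" and j: "j \<in> wts l"
  shows "left_act (wts l) (Omega l) (R d) s j = mmul (wts l) (R d) (\<lambda>p j. cp (Lam l d p j)) s j"
proof (rule poly_eq_on_arc)
  fix t :: real assume t: "0 < t" "t < pi / 2"
  let ?W = "wts l" and ?z = "complex_of_real (cos (2 * t))"
  have z: "c t / 2 = ?z" by (rule c_eq_cos)
  have ct: "c t = 2 * ?z" using z by (simp add: field_simps)
  have kt: "(k t)\<^sup>2 = 4 * (?z\<^sup>2 - 1)" unfolding k_square ct by (simp add: power2_eq_square)
  have kd1: "(\<Sum>r\<in>?W. g r * kd s r * h r) = g s * h s" for g h :: "real \<Rightarrow> complex"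
  proof -
    have "(\<Sum>r\<in>?W. g r * kd s r * h r) = (\<Sum>r\<in>?W. if r = s then g s * h s else 0)"
      by (rule sum.cong) (auto simp: kd_def)
    then show ?thesis using s by (simp add: finite_wts)
  qed
  have kd_poly: "poly (kd a b) x = kd a b" for a b :: real and x :: complex
    by (simp add: kd_def)
  have kd_real: "complex_of_real (kd a b) = kd a b" for a b :: real
    by (simp add: kd_def)
  have "poly (left_act ?W (Omega l) (R d) s j) ?z =
      (\<Sum>r\<in>?W. of_real (1/4 * (r\<^sup>2 + l * (l + 2))) * kd s r * poly (R d r j) ?z)
    + (\<Sum>r\<in>?W. of_real (1/4) * (of_real (2 * l + 3) * ?z * kd s r + of_real (Smat l s r)) * poly (pderiv (R d r j)) ?z)
    + (\<Sum>r\<in>?W. of_real (1/4) * (?z\<^sup>2 - 1) * kd s r * poly (pderiv (pderiv (R d r j))) ?z)"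
    by (simp add: left_act_def Omega_def mmul_def poly_sum numeral_3_eq_3 lessThan_Suc Lam_def kd_poly kd_real algebra_simps add_divide_distrib sum.distrib)
  also have "(\<Sum>r\<in>?W. of_real (1/4) * (of_real (2 * l + 3) * ?z * kd s r + of_real (Smat l s r)) * poly (pderiv (R d r j)) ?z)
     = (\<Sum>r\<in>?W. of_real (1/4) * of_real (2 * l + 3) * ?z * kd s r * poly (pderiv (R d r j)) ?z)
     + (\<Sum>r\<in>?W. of_real (Smat l s r) * poly (pderiv (R d r j)) ?z) / 4"
    unfolding sum_divide_distrib sum.distrib[symmetric] by (rule sum.cong) (simp_all add: algebra_simps)
  finally have L: "poly (left_act ?W (Omega l) (R d) s j) ?z =
      of_real (1/4 * (s\<^sup>2 + l * (l + 2))) * poly (R d s j) ?z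
    + (of_real (1/4) * of_real (2 * l + 3) * ?z * poly (pderiv (R d s j)) ?z
     + (\<Sum>r\<in>?W. of_real (Smat l s r) * poly (pderiv (R d r j)) ?z) / 4)
    + of_real (1/4) * (?z\<^sup>2 - 1) * poly (pderiv (pderiv (R d s j))) ?z"
    unfolding kd1 .
  have "poly (mmul ?W (R d) (\<lambda>p j. cp (Lam l d p j)) s j) ?z
     = (\<Sum>r\<in>?W. if r = j then poly (R d s j) ?z * of_real (1/4 * ((real d)\<^sup>2 + j\<^sup>2 + 2 * real d * (l + 1) + l * (l + 2))) else 0)"
    unfolding mmul_def poly_sum by (rule sum.cong) (auto simp: Lam_def kd_def)
  then have Rr: "poly (mmul ?W (R d) (\<lambda>p j. cp (Lam l d p j)) s j) ?z
     = poly (R d s j) ?z * of_real (1/4 * ((real d)\<^sup>2 + j\<^sup>2 + 2 * real d * (l + 1) + l * (l + 2)))"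
    using j by (simp add: finite_wts)
  let ?S = "\<Sum>r\<in>?W. of_real (Smat l s r) * poly (pderiv (R d r j)) ?z"
  have "2 * poly (left_act ?W (Omega l) (R d) s j) ?z
      = of_real ((real 0 + l)\<^sup>2 / 2 + s\<^sup>2 / 2 + real 0 + l) * poly (R d s j) ?z
      + (2 * l + 3) * (2 * ?z) / 4 * poly (pderiv (R d s j)) ?z + ?S / 2
      + 4 * (?z\<^sup>2 - 1) / 8 * poly (pderiv (pderiv (R d s j))) ?z"
    unfolding L by (simp add: field_simps power2_eq_square)
  also have "\<dots> = of_real ((real d + l)\<^sup>2 / 2 + j\<^sup>2 / 2 + real d + l) * poly (R d s j) ?z"
    using omega_pointwise[OF t j s, of d] unfolding z unfolding kt ct by simp
  also have "\<dots> = 2 * poly (mmul ?W (R d) (\<lambda>p j. cp (Lam l d p j)) s j) ?z"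
    unfolding Rr by (simp add: field_simps power2_eq_square)
  finally have "2 * poly (left_act ?W (Omega l) (R d) s j) ?z = 2 * poly (mmul ?W (R d) (\<lambda>p j. cp (Lam l d p j)) s j) ?z" .
  then show "poly (left_act ?W (Omega l) (R d) s j) ?z = poly (mmul ?W (R d) (\<lambda>p j. cp (Lam l d p j)) s j) ?z"
    by simp
qed

lemma Delta_eigen:
  assumes s: "s \<in> wts l" and j: "j \<in> wts l"
  shows "left_act (wts l) (Delta l) (R d) s j = mmul (wts l) (R d) (\<lambda>p j. cp (Gam l d p j)) s j"
proof (rule poly_eq_on_arc)
  fix t :: real assume t: "0 < t" "t < pi / 2"
  let ?W = "wts l" and ?z = "complex_of_real (cos (2 * t))"
  have z: "c t / 2 = ?z" by (rule c_eq_cos)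
  have ct: "c t = 2 * ?z" using z by (simp add: field_simps)
  have L: "poly (left_act ?W (Delta l) (R d) s j) ?z = of_real (1/2 * s * (l + 1)) * poly (R d s j) ?z
    + (\<Sum>r\<in>?W. (2 * ?z * of_real (Udiag l s r) + of_real (Ulu l s r)) * poly (pderiv (R d r j)) ?z) / 8"
  proof -
    have "(\<Sum>r\<in>?W. of_real (Gam l 0 s r) * poly (R d r j) ?z)
        = (\<Sum>r\<in>?W. if r = s then of_real (1/2 * s * (l + 1)) * poly (R d s j) ?z else 0)"
      by (rule sum.cong) (auto simp: Gam_def kd_def)
    also have "\<dots> = of_real (1/2 * s * (l + 1)) * poly (R d s j) ?z"
      using s by (simp add: finite_wts)
    finally have "(\<Sum>r\<in>?W. of_real (Gam l 0 s r) * poly (R d r j) ?z) = \<dots>" .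
    moreover have "poly (left_act ?W (Delta l) (R d) s j) ?z = (\<Sum>r\<in>?W. of_real (Gam l 0 s r) * poly (R d r j) ?z)
      + (\<Sum>r\<in>?W. of_real (1/8) * (2 * ?z * of_real (Udiag l s r) + of_real (Ulu l s r)) * poly (pderiv (R d r j)) ?z)"
      by (simp add: left_act_def Delta_def mmul_def poly_sum numeral_2_eq_2 lessThan_Suc algebra_simps add_divide_distrib sum.distrib)
    ultimately show ?thesis by (simp add: sum_divide_distrib)
  qed
  have "poly (mmul ?W (R d) (\<lambda>p j. cp (Gam l d p j)) s j) ?z
     = (\<Sum>r\<in>?W. if r = j then poly (R d s j) ?z * of_real (1/2 * j * (l + real d + 1)) else 0)"
    unfolding mmul_def poly_sum by (rule sum.cong) (auto simp: Gam_def kd_def)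
  then have Rr: "poly (mmul ?W (R d) (\<lambda>p j. cp (Gam l d p j)) s j) ?z
     = poly (R d s j) ?z * of_real (1/2 * j * (l + real d + 1))"
    using j by (simp add: finite_wts)
  let ?S = "\<Sum>r\<in>?W. (2 * ?z * of_real (Udiag l s r) + of_real (Ulu l s r)) * poly (pderiv (R d r j)) ?z"
  have "2 * poly (left_act ?W (Delta l) (R d) s j) ?z = of_real (s * (l + 1)) * poly (R d s j) ?z + ?S / 4"
    unfolding L by simp
  also have "\<dots> = of_real (j * (d + l + 1)) * poly (R d s j) ?z"
    using delta_pointwise[OF t j s, of d] unfolding z unfolding ct by simp
  also have "\<dots> = 2 * poly (mmul ?W (R d) (\<lambda>p j. cp (Gam l d p j)) s j) ?z"
    unfolding Rr by simp
  finally have "2 * poly (left_act ?W (Delta l) (R d) s j) ?z = 2 * poly (mmul ?W (R d) (\<lambda>p j. cp (Gam l d p j)) s j) ?z" .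
  then show "poly (left_act ?W (Delta l) (R d) s j) ?z = poly (mmul ?W (R d) (\<lambda>p j. cp (Gam l d p j)) s j) ?z"
    by simp
qed

end

section \<open>The transposed operators\<close>

lemma wts_eq_idx: "2 * l = real n \<Longrightarrow> wts l = (\<lambda>i. l - real i) ` idx l"
proof -
  assume n: "2 * l = real n"
  have "idx l = {..n}" using n by (auto simp: idx_def)
  moreover have "2 * l \<in> \<nat>" using n by simp
  then have "wts l = uminus ` wts l"
    using wts_uminus[of l] by (force intro: image_eqI[of _ _ "- x" for x])
  ultimately show ?thesis by (subst \<open>wts l = uminus ` wts l\<close>) (simp add: wts_eq_image[OF n] image_image)
qed

lemma sum_wts_idx:
  assumes "2 * l = real n"
  shows "(\<Sum>r\<in>wts l. f r) = (\<Sum>i\<in>idx l. f (l - real i))"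
  unfolding wts_eq_idx[OF assms] by (simp add: sum.reindex inj_on_def)

text \<open>An entrywise comparison of coefficient matrices. The substitution \<open>j = l - i\<close> turns \<open>Smat\<close>, transposed,
  into the negative of \<open>Ct\<close>, and the constant \<open>2 (l\<^sup>2 + l)\<close> is absorbed into the zeroth-order term.\<close>

lemma transpose_Omega:
  assumes n: "2 * l = real n" and i: "i \<in> idx l" and j: "j \<in> idx l"
  shows "cp (-4) * right_act (wts l) P (dop_transpose (Omega l)) (l - real i) (l - real j)
      + cp (2 * (l\<^sup>2 + l)) * P (l - real i) (l - real j)
    = right_act (idx l) (relabel l P) (Dtilde l) i j"
proof -
  let ?P = "\<lambda>r s. (pderiv ^^ s) (P (l - real i) (l - real r))"
  let ?A = "\<lambda>s r. (Omega l ! s) (l - real j) (l - real r)"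
  have fin: "finite (idx l)" using n by (auto simp: idx_def)
  have kdr: "kd (l - real a) (l - real b) = (kd a b :: complex poly)" "kd (l - real a) (l - real b) = (kd a b :: real)" for a b
    by (auto simp: kd_def)
  have id: "P (l - real i) (l - real j) = (\<Sum>r\<in>idx l. ?P r 0 * kd r j)"
  proof -
    have "(\<Sum>r\<in>idx l. ?P r 0 * kd r j) = (\<Sum>r\<in>idx l. if r = j then ?P j 0 else 0)"
      by (rule sum.cong) (auto simp: kd_def)
    then show ?thesis using fin j by simp
  qed
  have e0: "cp (-4) * ?A 0 r + cp (2 * (l\<^sup>2 + l)) * kd r j = (Dtilde l ! 0) r j" for r
    by (auto simp: Omega_def Dtilde_def Lam_def Vt_def kd_def power2_eq_square field_simps)
  have S: "Smat l (l - real j) (l - real r) = - Ct l r j" for r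
    by (auto simp: Smat_def Ct_def kd_def)
  have e1: "cp (-4) * ?A 1 r = (Dtilde l ! 1) r j" for r
    by (auto simp: Omega_def Dtilde_def S Ut_def kd_def algebra_simps)
  have e2: "cp (-4) * ?A 2 r = (Dtilde l ! 2) r j" for r
    by (auto simp: Omega_def Dtilde_def kd_def algebra_simps)
  have "right_act (wts l) P (dop_transpose (Omega l)) (l - real i) (l - real j)
     = (\<Sum>r\<in>idx l. ?P r 0 * ?A 0 r) + (\<Sum>r\<in>idx l. ?P r 1 * ?A 1 r) + (\<Sum>r\<in>idx l. ?P r 2 * ?A 2 r)"
    by (simp add: right_act_def dop_transpose_def Omega_def mmul_def sum_wts_idx[OF n] numeral_3_eq_3 numeral_2_eq_2 lessThan_Suc)
  then have "cp (-4) * right_act (wts l) P (dop_transpose (Omega l)) (l - real i) (l - real j)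
      + cp (2 * (l\<^sup>2 + l)) * P (l - real i) (l - real j)
    = (\<Sum>r\<in>idx l. ?P r 0 * (cp (-4) * ?A 0 r + cp (2 * (l\<^sup>2 + l)) * kd r j))
    + (\<Sum>r\<in>idx l. ?P r 1 * (cp (-4) * ?A 1 r)) + (\<Sum>r\<in>idx l. ?P r 2 * (cp (-4) * ?A 2 r))"
    unfolding id by (simp only: distrib_left sum_distrib_left sum.distrib mult_ac add_ac)
  also have "\<dots> = right_act (idx l) (relabel l P) (Dtilde l) i j"
    unfolding e0 e1 e2
    by (simp add: right_act_def Dtilde_def mmul_def relabel_def numeral_3_eq_3 numeral_2_eq_2 lessThan_Suc)
  finally show ?thesis .
qed

lemma transpose_Delta:
  assumes n: "2 * l = real n" and l: "l > 0" and i: "i \<in> idx l" and j: "j \<in> idx l"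
  shows "cp (- 2 / l) * right_act (wts l) P (dop_transpose (Delta l)) (l - real i) (l - real j)
      - cp (l + 1) * P (l - real i) (l - real j)
    = cp (-2) * right_act (idx l) (relabel l P) (Etilde l) i j"
proof -
  let ?P = "\<lambda>r s. (pderiv ^^ s) (P (l - real i) (l - real r))"
  let ?A = "\<lambda>s r. (Delta l ! s) (l - real j) (l - real r)"
  have fin: "finite (idx l)" using n by (auto simp: idx_def)
  have l0: "complex_of_real l \<noteq> 0" using l by simp
  have id: "P (l - real i) (l - real j) = (\<Sum>r\<in>idx l. ?P r 0 * kd r j)"
  proof -
    have "(\<Sum>r\<in>idx l. ?P r 0 * kd r j) = (\<Sum>r\<in>idx l. if r = j then ?P j 0 else 0)"
      by (rule sum.cong) (auto simp: kd_def)
    then show ?thesis using fin j by simp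
  qed
  have e0: "cp (- 2 / l) * ?A 0 r - cp (l + 1) * kd r j = cp (-2) * (Etilde l ! 0) r j" for r
    using l0 by (auto simp: Delta_def Etilde_def Gam_def At_def kd_def numeral_poly field_simps)
  have e1: "cp (- 2 / l) * ?A 1 r = cp (-2) * (Etilde l ! 1) r j" for r
    using l0 by (auto simp: Delta_def Etilde_def Udiag_def Ulu_def B0t_def B1t_def kd_def numeral_poly field_simps)
  have "right_act (wts l) P (dop_transpose (Delta l)) (l - real i) (l - real j)
     = (\<Sum>r\<in>idx l. ?P r 0 * ?A 0 r) + (\<Sum>r\<in>idx l. ?P r 1 * ?A 1 r)"
    by (simp add: right_act_def dop_transpose_def Delta_def mmul_def sum_wts_idx[OF n] numeral_2_eq_2 lessThan_Suc)
  then have "cp (- 2 / l) * right_act (wts l) P (dop_transpose (Delta l)) (l - real i) (l - real j)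
      - cp (l + 1) * P (l - real i) (l - real j)
    = (\<Sum>r\<in>idx l. ?P r 0 * (cp (- 2 / l) * ?A 0 r - cp (l + 1) * kd r j))
    + (\<Sum>r\<in>idx l. ?P r 1 * (cp (- 2 / l) * ?A 1 r))"
    unfolding id by (simp only: distrib_left right_diff_distrib sum_distrib_left sum_subtractf mult_ac add_ac add_diff_eq diff_add_eq)
  also have "\<dots> = cp (-2) * right_act (idx l) (relabel l P) (Etilde l) i j"
    unfolding e0 e1
    by (simp add: right_act_def Etilde_def mmul_def relabel_def numeral_2_eq_2 lessThan_Suc sum_distrib_left distrib_left mult_ac)
  finally show ?thesis .
qed

theorem theorem7p15:
  fixes l :: real
    and T :: "real \<Rightarrow> complex^2^2 \<Rightarrow> real \<Rightarrow> real \<Rightarrow> complex"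
    and \<beta> :: "real \<times> real \<Rightarrow> real \<times> real \<Rightarrow> real \<Rightarrow> complex"
    and R :: "nat \<Rightarrow> real polymat"
  assumes l: "2 * l \<in> \<nat>" "l > 0"
    and T: "\<And>m. 2 * m \<in> \<nat> \<Longrightarrow> spin_rep m (T m)"
    and \<beta>: "\<And>d h. h \<in> wts l \<Longrightarrow> equivariant_isometry T l (zeta l d h) (\<beta> (zeta l d h))"
    and R: "\<And>d w. w \<noteq> 0 \<Longrightarrow> w ^ 4 \<noteq> 1 \<Longrightarrow>
      meq (wts l) (wts l) (\<lambda>p j. poly (R d p j) (phi w)) (Qfun T \<beta> l d w)"
  shows "(\<forall>d. meq (wts l) (wts l) (left_act (wts l) (Omega l) (R d))
            (mmul (wts l) (R d) (\<lambda>p j. cp (Lam l d p j)))) \<and>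
         (\<forall>d. meq (wts l) (wts l) (left_act (wts l) (Delta l) (R d))
            (mmul (wts l) (R d) (\<lambda>p j. cp (Gam l d p j)))) \<and>
         (\<forall>P. meq (idx l) (idx l)
            (relabel l (\<lambda>p j. cp (-4) * right_act (wts l) P (dop_transpose (Omega l)) p j
                              + cp (2 * (l\<^sup>2 + l)) * P p j))
            (right_act (idx l) (relabel l P) (Dtilde l))) \<and>
         (\<forall>P. meq (idx l) (idx l)
            (relabel l (\<lambda>p j. cp (- 2 / l) * right_act (wts l) P (dop_transpose (Delta l)) p j
                              - cp (l + 1) * P p j))
            (\<lambda>i k. cp (-2) * right_act (idx l) (relabel l P) (Etilde l) i k))"
proof -
  obtain n where n: "2 * l = real n" using l(1) by (auto elim: Nats_cases)
  note positive = l(2)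
  interpret spherical_polynomials l T \<beta> n R
    by unfold_locales (use n T \<beta> R in auto)
  show ?thesis
    unfolding meq_def relabel_def
    by (intro conjI allI ballI Omega_eigen Delta_eigen 
        transpose_Omega[OF n, unfolded relabel_def] transpose_Delta[OF n positive, unfolded relabel_def])
qed

end
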